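(* Let $F$ be a field of characteristic $p\neq 2$ and let $\lambda$ be a partition of $n+1$. Then the blocks of the algebra $\operatorname{End}_{F\Sigma_n}(S^\lambda{\downarrow_{\Sigma_n}})$ are parametrized by the $p$-residues of the removable nodes of $[\lambda]$: the algebra is a direct product of blocks $E_r$, one for each element $r$ of the set of $p$-residues of removable nodes of $[\lambda]$. For each such $r$, the block $E_r$ has the structure of a truncated polynomial ring over $F$, and its dimension equals the number $m_r$ of removable nodes of $[\lambda]$ of $p$-residue $r$; that is, $E_r\cong F[x]/(x^{m_r})$ as $F$-algebras.
   Context: $S^\lambda$ is the Specht module of James for $F\Sigma_{n+1}$ and $\downarrow_{\Sigma_n}$ denotes restriction to $\Sigma_n$ (the stabilizer of $n+1$). The residue of the node in row $i$, column $j$ of a Young diagram is $j-i$, and its $p$-residue is $j-i$ taken modulo $p$ (i.e. the image of $j-i$ in $F$). A node of $[\lambda]$ is removable if deleting it leaves the Young diagram of a partition. The blocks of a finite-dimensional algebra are its indecomposable two-sided ideal direct summands. *)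

theory Defs
  imports
    "HOL-Library.Function_Algebras"
    "HOL-Combinatorics.Permutations"
    "HOL-Computational_Algebra.Polynomial"
    "HOL-Algebra.QuotRing"
    "HOL-Algebra.Module"
begin

section \<open>Partitions, Young diagrams, residues\<close>

definition partition_of :: "nat \<Rightarrow> nat list \<Rightarrow> bool" where
  "partition_of m lam \<longleftrightarrow> sorted_wrt (\<ge>) lam \<and> 0 \<notin> set lam \<and> sum_list lam = m"

text \<open>Rows and columns are numbered from 0; residues, being differences, are unaffected.\<close>

definition young_diagram :: "nat list \<Rightarrow> (nat \<times> nat) set" where
  "young_diagram lam = {(i, j). i < length lam \<and> j < lam ! i}"

definition removable_nodes :: "nat list \<Rightarrow> (nat \<times> nat) set" where
  "removable_nodes lam =
     {x \<in> young_diagram lam. \<exists>m mu. partition_of m mu \<and> young_diagram mu = young_diagram lam - {x}}"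

definition p_residue :: "nat \<times> nat \<Rightarrow> 'f::field" where
  "p_residue x = of_int (int (snd x) - int (fst x))"


section \<open>Specht modules\<close>

text \<open>
  A tableau of shape \<open>lam\<close> is a bijection from the diagram onto \<open>{1..m}\<close>. It is normalised to
  be 0 off the diagram, so that equality of functions is equality of tableaux; as permutations
  of \<open>{1..m}\<close> fix 0, they act on tableaux simply by composition.
\<close>

type_synonym tableau = "nat \<times> nat \<Rightarrow> nat"

definition tableaux :: "nat list \<Rightarrow> tableau set" where
  "tableaux lam = {t. bij_betw t (young_diagram lam) {1..sum_list lam} \<and>
                      (\<forall>x. x \<notin> young_diagram lam \<longrightarrow> t x = 0)}"

definition row_stabilizer :: "nat list \<Rightarrow> tableau \<Rightarrow> (nat \<Rightarrow> nat) set" where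
  "row_stabilizer lam t = {\<pi>. \<pi> permutes {1..sum_list lam} \<and>
     (\<forall>i. \<pi> ` t ` {x \<in> young_diagram lam. fst x = i} = t ` {x \<in> young_diagram lam. fst x = i})}"

definition column_stabilizer :: "nat list \<Rightarrow> tableau \<Rightarrow> (nat \<Rightarrow> nat) set" where
  "column_stabilizer lam t = {\<pi>. \<pi> permutes {1..sum_list lam} \<and>
     (\<forall>j. \<pi> ` t ` {x \<in> young_diagram lam. snd x = j} = t ` {x \<in> young_diagram lam. snd x = j})}"

definition tabloid :: "nat list \<Rightarrow> tableau \<Rightarrow> tableau set" where
  "tabloid lam t = {\<pi> \<circ> t | \<pi>. \<pi> \<in> row_stabilizer lam t}"

text \<open>
  The permutation module \<open>M\<^sup>\<lambda>\<close> is realised inside the space of all functions from sets of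
  tableaux to the field, a tabloid being identified with its indicator function. The group acts
  from the left.
\<close>

type_synonym 'f tabvec = "tableau set \<Rightarrow> 'f"

definition vscale :: "'f::field \<Rightarrow> 'f tabvec \<Rightarrow> 'f tabvec" where
  "vscale c v = (\<lambda>T. c * v T)"

definition basis_vec :: "tableau set \<Rightarrow> 'f::field tabvec" where
  "basis_vec T = (\<lambda>S. if S = T then 1 else 0)"

definition perm_act :: "(nat \<Rightarrow> nat) \<Rightarrow> 'f::field tabvec \<Rightarrow> 'f tabvec" where
  "perm_act \<pi> v = (\<lambda>T. v ((\<lambda>s. inv_into UNIV \<pi> \<circ> s) ` T))"

interpretation tabvec: vector_space "vscale :: 'f::field \<Rightarrow> 'f tabvec \<Rightarrow> 'f tabvec"
  by unfold_locales (auto simp: vscale_def fun_eq_iff algebra_simps)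

lemma perm_act_basis_vec:
  assumes "bij \<pi>"
  shows "perm_act \<pi> (basis_vec T) = basis_vec ((\<lambda>s. \<pi> \<circ> s) ` T)"
proof -
  have "(\<lambda>s. inv_into UNIV \<pi> \<circ> s) ` S = T \<longleftrightarrow> S = (\<lambda>s. \<pi> \<circ> s) ` T" for S :: "tableau set"
  proof -
    have "inv_into UNIV \<pi> \<circ> (\<pi> \<circ> s) = s" "\<pi> \<circ> (inv_into UNIV \<pi> \<circ> s) = s" for s :: tableau
      using assms by (simp_all add: fun_eq_iff bij_is_inj bij_is_surj surj_f_inv_f)
    then show ?thesis
      by (auto simp: image_image)
  qed
  then show ?thesis
    by (simp add: perm_act_def basis_vec_def)
qed

definition polytabloid :: "nat list \<Rightarrow> tableau \<Rightarrow> 'f::field tabvec" where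
  "polytabloid lam t =
     (\<Sum>\<pi> \<in> column_stabilizer lam t. vscale (of_int (sign \<pi>)) (basis_vec (tabloid lam (\<pi> \<circ> t))))"

definition specht :: "nat list \<Rightarrow> 'f::field tabvec set" where
  "specht lam = tabvec.span (polytabloid lam ` tableaux lam)"


section \<open>Algebras over a field\<close>

text \<open>
  Algebras over the field \<open>'f\<close> are given by records \<open>('f, 'a) module\<close>, which carry a ring
  structure and a scalar multiplication.
\<close>

definition alg_iso :: "('f, 'a) module \<Rightarrow> ('f, 'b) module \<Rightarrow> ('a \<Rightarrow> 'b) set" where
  "alg_iso A B = {h \<in> ring_iso A B. \<forall>c. \<forall>a \<in> carrier A. h (c \<odot>\<^bsub>A\<^esub> a) = c \<odot>\<^bsub>B\<^esub> h a}"

definition alg_isomorphic :: "('f, 'a) module \<Rightarrow> ('f, 'b) module \<Rightarrow> bool" where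
  "alg_isomorphic A B \<longleftrightarrow> alg_iso A B \<noteq> {}"

definition prod_alg :: "'i set \<Rightarrow> ('i \<Rightarrow> ('f, 'a) module) \<Rightarrow> ('f, 'i \<Rightarrow> 'a) module" where
  "prod_alg I A =
     \<lparr>carrier = (\<Pi>\<^sub>E i\<in>I. carrier (A i)),
      mult = (\<lambda>x y. \<lambda>i\<in>I. x i \<otimes>\<^bsub>A i\<^esub> y i),
      one = (\<lambda>i\<in>I. \<one>\<^bsub>A i\<^esub>),
      zero = (\<lambda>i\<in>I. \<zero>\<^bsub>A i\<^esub>),
      add = (\<lambda>x y. \<lambda>i\<in>I. x i \<oplus>\<^bsub>A i\<^esub> y i),
      smult = (\<lambda>c x. \<lambda>i\<in>I. c \<odot>\<^bsub>A i\<^esub> x i)\<rparr>"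

definition quot_alg :: "('f, 'a) module \<Rightarrow> 'a set \<Rightarrow> ('f, 'a set) module" where
  "quot_alg A I = ring.extend (A Quot I)
     (module.fields (\<lambda>c X. \<Union>a\<in>X. I +>\<^bsub>A\<^esub> (c \<odot>\<^bsub>A\<^esub> a)))"

definition poly_alg :: "('f::field, 'f poly) module" where
  "poly_alg = \<lparr>carrier = UNIV, mult = (*), one = 1, zero = 0, add = (+), smult = Polynomial.smult\<rparr>"

definition truncated_poly_alg :: "nat \<Rightarrow> ('f::field, 'f poly set) module" where
  "truncated_poly_alg m = quot_alg poly_alg (PIdl\<^bsub>poly_alg\<^esub> (monom 1 m))"

text \<open>The library predicate \<open>ideal\<close> means two-sided ideal.\<close>

definition ideal_direct_summand :: "'a set \<Rightarrow> ('f, 'a) module \<Rightarrow> bool" where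
  "ideal_direct_summand B A \<longleftrightarrow> ideal B A \<and>
     (\<exists>C. ideal C A \<and> B <+>\<^bsub>A\<^esub> C = carrier A \<and> B \<inter> C = {\<zero>\<^bsub>A\<^esub>})"

definition indecomposable_ideal :: "'a set \<Rightarrow> ('f, 'a) module \<Rightarrow> bool" where
  "indecomposable_ideal B A \<longleftrightarrow> ideal B A \<and> B \<noteq> {\<zero>\<^bsub>A\<^esub>} \<and>
     (\<forall>I J. ideal I A \<and> ideal J A \<and> I <+>\<^bsub>A\<^esub> J = B \<and> I \<inter> J = {\<zero>\<^bsub>A\<^esub>} \<longrightarrow>
            I = {\<zero>\<^bsub>A\<^esub>} \<or> J = {\<zero>\<^bsub>A\<^esub>})"

definition blocks :: "('f, 'a) module \<Rightarrow> 'a set set" where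
  "blocks A = {B. ideal_direct_summand B A \<and> indecomposable_ideal B A}"

text \<open>
  A direct summand viewed as an algebra in its own right: its identity is not that of \<open>A\<close> but
  the component of the latter in \<open>B\<close>, which is the identity element of \<open>B\<close>.
\<close>

definition block_alg :: "('f, 'a) module \<Rightarrow> 'a set \<Rightarrow> ('f, 'a) module" where
  "block_alg A B = A\<lparr>carrier := B,
     one := (THE e. e \<in> B \<and> (\<forall>b\<in>B. e \<otimes>\<^bsub>A\<^esub> b = b \<and> b \<otimes>\<^bsub>A\<^esub> e = b))\<rparr>"


section \<open>Endomorphism algebras\<close>

text \<open>
  \<open>End_alg G V\<close> is the algebra of linear endomorphisms of \<open>V\<close> commuting with the action of
  \<open>G\<close>. An endomorphism is represented by its extension by 0 to the whole ambient space, so that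
  sums, scalar multiples and composites are the plain pointwise ones.
\<close>

definition op_scale :: "'f::field \<Rightarrow> ('f tabvec \<Rightarrow> 'f tabvec) \<Rightarrow> ('f tabvec \<Rightarrow> 'f tabvec)" where
  "op_scale c f = (\<lambda>v. vscale c (f v))"

interpretation tabop: vector_space
  "op_scale :: 'f::field \<Rightarrow> ('f tabvec \<Rightarrow> 'f tabvec) \<Rightarrow> ('f tabvec \<Rightarrow> 'f tabvec)"
  by unfold_locales (auto simp: op_scale_def vscale_def fun_eq_iff algebra_simps)

definition End_alg ::
  "(nat \<Rightarrow> nat) set \<Rightarrow> 'f::field tabvec set \<Rightarrow> ('f, 'f tabvec \<Rightarrow> 'f tabvec) module" where
  "End_alg G V =
     \<lparr>carrier = {f. (\<forall>v\<in>V. f v \<in> V) \<and> (\<forall>v. v \<notin> V \<longrightarrow> f v = 0) \<and>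
                    (\<forall>v\<in>V. \<forall>w\<in>V. f (v + w) = f v + f w) \<and>
                    (\<forall>c. \<forall>v\<in>V. f (vscale c v) = vscale c (f v)) \<and>
                    (\<forall>\<pi>\<in>G. \<forall>v\<in>V. f (perm_act \<pi> v) = perm_act \<pi> (f v))},
      mult = (\<circ>),
      one = (\<lambda>v. if v \<in> V then v else 0),
      zero = 0,
      add = (+),
      smult = op_scale\<rparr>"

definition Sym :: "nat \<Rightarrow> (nat \<Rightarrow> nat) set" where
  "Sym n = {\<pi>. \<pi> permutes {1..n}}"

end

theory Submission
  imports Defs
begin

text \<open>
  Let \<open>V\<close> be the restricted Specht module, \<open>L\<close> the Jucys-Murphy element, that is the sum of the
  transpositions \<open>(x, n+1)\<close> for \<open>x \<le> n\<close>, and number the removable nodes from the bottom, with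
  residues \<open>r\<^sub>0, r\<^sub>1, \<dots>\<close>.

  By the Garnir relations for a single entry, \<open>L - r\<^sub>k\<close> maps the span of the polytabloids with
  \<open>n+1\<close> in a column of length at most that of the \<open>k\<close>-th removable node into the span for
  \<open>k+1\<close>; hence \<open>L\<close> is annihilated by the product \<open>\<chi>\<close> of the \<open>x - r\<^sub>k\<close>.

  Conversely, let \<open>f\<close> be an endomorphism. The Garnir relations show that \<open>V\<close> is generated by a
  polytabloid with \<open>n+1\<close> in column 0, and the kernel relations (dual to them) that a vector of \<open>V\<close>
  is determined by its coefficients at tabloids with \<open>n+1\<close> in row 0. So \<open>f\<close> is given by the numbers
  \<open>f e\<^sub>t (tabloid s)\<close> for such \<open>t\<close> and \<open>s\<close>, which up to sign depend only on the matrix counting the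
  entries \<open>x \<le> n\<close> in row \<open>i\<close> of \<open>s\<close> and column \<open>j\<close> of \<open>t\<close>, and vanish unless this is a 0-1
  matrix, as the characteristic is not 2. Such a matrix differs from the diagram by a zigzag of
  holes and extra entries, and the relations not involving \<open>n+1\<close> express everything through the
  zigzags that follow the removable nodes \<open>0, \<dots>, k - 1\<close> in turn and then jump to row 0. This leaves one
  parameter for each \<open>k\<close>. On the \<open>k\<close>-th zigzag \<open>L ^ j\<close> has coefficient 0 for \<open>j < k\<close> and a sign
  for \<open>j = k\<close>. Therefore the endomorphism algebra is \<open>F[L]\<close>, isomorphic to \<open>F[x]/(\<chi>)\<close>, and the
  blocks come from the Chinese remainder theorem.
\<close>

section \<open>Quotients of polynomial rings\<close>

text \<open>The coefficients of an endomorphism depend on the matrix only up to sign, so the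
  arguments track whether they vanish and ignore their signs. This is enough: an endomorphism whose
  coefficients vanish on all zigzags is zero, and adding a multiple of a power of L makes one
  coefficient vanish, and with it all those on zigzags of the same index.

  The zigzags are forced by counting. With n+1 in column 0 of t and in row 0 of s, the matrix has
  the row and column sums of the diagram, lowered by one in row 0 and in column 0. If the first
  column of some length contains n+1 or an entry below the diagram, it lacks an entry inside. Unless
  this hole is in row 0, the kernel relations push it to the bottom of the column. The row of that
  hole then has an entry to the right of the diagram, and the Garnir relations pull it to the first
  column outside, which is the first column of the next smaller length. So the defect passes from
  one removable node to the next until its hole is in row 0.\<close>

lemma bezout_linear_power:
  fixes q :: "'f::field poly"
  assumes "poly q r \<noteq> 0"
  shows "\<exists>u v. u * q + v * [:-r, 1:] ^ k = 1"
proof (induction k)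
  case 0
  have "0 * q + 1 * [:-r, 1:] ^ 0 = 1" by simp
  then show ?case by blast
next
  case (Suc k)
  then obtain u v where uv: "u * q + v * [:-r, 1:] ^ k = 1" by blast
  have "[:-r, 1:] dvd q - [:poly q r:]"
    by (simp add: poly_eq_0_iff_dvd [symmetric])
  then obtain q' where q': "q - [:poly q r:] = [:-r, 1:] * q'" by (auto elim: dvdE)
  define c where "c = [:inverse (poly q r):]"
  have "c * q - c * [:-r, 1:] * q' = c * (q - [:-r, 1:] * q')"
    by (simp only: right_diff_distrib mult.assoc)
  also have "q - [:-r, 1:] * q' = [:poly q r:]"
    unfolding q' [symmetric] by simp
  also have "c * [:poly q r:] = 1" using assms by (simp add: c_def)
  finally have 1: "c * q - c * [:-r, 1:] * q' = 1" .
  \<comment> \<open>The identity for exponent \<open>k\<close> is multiplied by the one for exponent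
    1; the term without a factor \<open>q\<close> gains one more factor
    \<open>x - r\<close>.\<close>
  have "1 = (u * q + v * [:-r, 1:] ^ k) * (c * q - c * [:-r, 1:] * q')"
    using uv 1 by simp
  also have "\<dots> = (u * (c * q - c * [:-r, 1:] * q') + v * [:-r, 1:] ^ k * c) * q
      + (- (v * c * q')) * [:-r, 1:] ^ Suc k"
    by (simp add: algebra_simps del: mult_pCons_left mult_pCons_right)
  finally have "(u * (c * q - c * [:-r, 1:] * q') + v * [:-r, 1:] ^ k * c) * q
      + (- (v * c * q')) * [:-r, 1:] ^ Suc k = 1" by (rule sym)
  then show ?case by (intro exI)
qed

text \<open>A Bezout identity multiplied by \<open>p\<close> writes \<open>p\<close> as a sum of two
  terms, each divisible by the product.\<close>

lemma linear_power_mult_dvd: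
  fixes q :: "'f::field poly"
  assumes "poly q r \<noteq> 0" "q dvd p" "[:-r, 1:] ^ k dvd p"
  shows "[:-r, 1:] ^ k * q dvd p"
proof -
  obtain u v where uv: "u * q + v * [:-r, 1:] ^ k = 1"
    using bezout_linear_power [OF assms(1)] by blast
  have eq: "p = u * (q * p) + v * ([:-r, 1:] ^ k * p)"
    using arg_cong [OF uv, of "\<lambda>x. x * p"] by (simp only: distrib_right mult.assoc mult_1)
  have "[:-r, 1:] ^ k * q dvd q * p"
    by (subst mult.commute) (intro mult_dvd_mono dvd_refl assms)
  moreover have "[:-r, 1:] ^ k * q dvd [:-r, 1:] ^ k * p"
    by (intro mult_dvd_mono dvd_refl assms)
  ultimately have "[:-r, 1:] ^ k * q dvd u * (q * p) + v * ([:-r, 1:] ^ k * p)"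
    by (rule dvd_add [OF dvd_mult dvd_mult])
  then show ?thesis unfolding eq [symmetric] .
qed

lemma prod_linear_powers_dvd:
  fixes p :: "'f::field poly"
  assumes "finite R" "\<And>r. r \<in> R \<Longrightarrow> [:-r, 1:] ^ m r dvd p"
  shows "(\<Prod>r\<in>R. [:-r, 1:] ^ m r) dvd p"
  using assms
proof (induction R rule: finite_induct)
  case (insert r R)
  have "poly (\<Prod>r\<in>R. [:-r, 1:] ^ m r) r \<noteq> 0"
    using insert.hyps by (simp add: poly_prod poly_power)
  then have "[:-r, 1:] ^ m r * (\<Prod>r\<in>R. [:-r, 1:] ^ m r) dvd p"
    using insert.IH insert.prems by (intro linear_power_mult_dvd) simp_all
  then show ?case using insert.hyps by simp
qed auto

lemma dvd_pcompose:
  fixes p q :: "'a::comm_semiring_1 poly"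
  assumes "p dvd q"
  shows "pcompose p s dvd pcompose q s"
  using assms by (metis dvd_def pcompose_mult)

lemma pcompose_monom_linear:
  fixes s :: "'a::comm_ring_1 poly"
  shows "pcompose (monom 1 k) s = s ^ k"
  by (induction k) (simp_all add: monom_Suc pcompose_pCons pcompose_1 monom_0)

lemma pcompose_power:
  fixes s :: "'a::comm_semiring_1 poly"
  shows "pcompose (p ^ k) s = pcompose p s ^ k"
  by (induction k) (simp_all add: pcompose_mult pcompose_1)

text \<open>Substituting \<open>x + r\<close> for \<open>x\<close> is an automorphism that takes
  \<open>x - r\<close> to \<open>x\<close>. It turns the power of a residue factor into the
  \<open>x ^ m\<close> of a truncated polynomial ring.\<close>

lemma monom_dvd_pcompose_iff:
  fixes p :: "'f::field poly"
  shows "monom 1 k dvd pcompose p [:r, 1:] \<longleftrightarrow> [:-r, 1:] ^ k dvd p"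
proof
  assume "monom 1 k dvd pcompose p [:r, 1:]"
  then have "pcompose (monom 1 k) [:-r, 1:] dvd pcompose (pcompose p [:r, 1:]) [:-r, 1:]"
    by (rule dvd_pcompose)
  then show "[:-r, 1:] ^ k dvd p"
    by (simp add: pcompose_monom_linear flip: pcompose_assoc) (simp add: pcompose_pCons)
next
  assume "[:-r, 1:] ^ k dvd p"
  then have "pcompose ([:-r, 1:] ^ k) [:r, 1:] dvd pcompose p [:r, 1:]"
    by (rule dvd_pcompose)
  then show "monom 1 k dvd pcompose p [:r, 1:]"
    by (simp add: pcompose_power pcompose_pCons monom_altdef)
qed

section \<open>The truncated polynomial algebra, computed on representatives\<close>

lemma cring_poly_alg: "cring (poly_alg :: ('f::field, 'f poly) module)"
proof (rule cringI)
  show "abelian_group (poly_alg :: ('f, 'f poly) module)"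
  proof (rule abelian_groupI)
    fix x :: "'f poly"
    have "- x \<oplus>\<^bsub>poly_alg\<^esub> x = \<zero>\<^bsub>poly_alg\<^esub>" by (simp add: poly_alg_def)
    then show "\<exists>y\<in>carrier poly_alg. y \<oplus>\<^bsub>poly_alg\<^esub> x = \<zero>\<^bsub>poly_alg\<^esub>"
      by (metis UNIV_I poly_alg_def partial_object.select_convs(1))
  qed (simp_all add: poly_alg_def algebra_simps)
  show "comm_monoid (poly_alg :: ('f, 'f poly) module)"
    by (rule comm_monoidI) (auto simp: poly_alg_def)
qed (auto simp: poly_alg_def algebra_simps)

lemma PIdl_poly_alg: "PIdl\<^bsub>poly_alg\<^esub> q = {p. q dvd p}" for q :: "'f::field poly"
  by (auto simp: cgenideal_def poly_alg_def dvd_def mult.commute)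

lemma coset_poly_alg: "{p. q dvd p} +>\<^bsub>poly_alg\<^esub> b = {p. q dvd p - b}" for q :: "'f::field poly"
proof (intro Set.set_eqI iffI)
  fix p assume "p \<in> {p. q dvd p - b}"
  moreover have "p = (p - b) + b" by simp
  ultimately show "p \<in> {p. q dvd p} +>\<^bsub>poly_alg\<^esub> b"
    unfolding a_r_coset_def r_coset_def by (simp add: poly_alg_def) (metis diff_add_cancel)
qed (auto simp: a_r_coset_def r_coset_def poly_alg_def)

lemma coset_poly_alg_eq_iff:
  "{p. q dvd p} +>\<^bsub>poly_alg\<^esub> b = {p. q dvd p} +>\<^bsub>poly_alg\<^esub> c \<longleftrightarrow> q dvd b - c"
  for q :: "'f::field poly"
proof
  assume "{p. q dvd p} +>\<^bsub>poly_alg\<^esub> b = {p. q dvd p} +>\<^bsub>poly_alg\<^esub> c"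
  moreover have "b \<in> {p. q dvd p - b}" by simp
  ultimately have "b \<in> {p. q dvd p - c}" unfolding coset_poly_alg by (rule subst)
  then show "q dvd b - c" by simp
next
  assume a: "q dvd b - c"
  have "q dvd p - b \<longleftrightarrow> q dvd p - c" for p
  proof -
    have "(p - b) + (b - c) = p - c" "(p - c) - (b - c) = p - b" by simp_all
    then show ?thesis using dvd_add [OF _ a] dvd_diff [OF _ a] by metis
  qed
  then show "{p. q dvd p} +>\<^bsub>poly_alg\<^esub> b = {p. q dvd p} +>\<^bsub>poly_alg\<^esub> c"
    by (simp only: coset_poly_alg)
qed

lemma truncated_poly_alg_simps:
  fixes m :: nat
  defines "I \<equiv> {p :: 'f::field poly. monom 1 m dvd p}"
  shows "carrier (truncated_poly_alg m) = range (\<lambda>p. I +>\<^bsub>poly_alg\<^esub> p)"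
    and "(I +>\<^bsub>poly_alg\<^esub> p) \<otimes>\<^bsub>truncated_poly_alg m\<^esub> (I +>\<^bsub>poly_alg\<^esub> q) = I +>\<^bsub>poly_alg\<^esub> (p * q)"
    and "(I +>\<^bsub>poly_alg\<^esub> p) \<oplus>\<^bsub>truncated_poly_alg m\<^esub> (I +>\<^bsub>poly_alg\<^esub> q) = I +>\<^bsub>poly_alg\<^esub> (p + q)"
    and "\<one>\<^bsub>truncated_poly_alg m\<^esub> = I +>\<^bsub>poly_alg\<^esub> 1"
    and "c \<odot>\<^bsub>truncated_poly_alg m\<^esub> (I +>\<^bsub>poly_alg\<^esub> p) = I +>\<^bsub>poly_alg\<^esub> (Polynomial.smult c p)"
proof -
  interpret cring "poly_alg :: ('f, 'f poly) module" by (rule cring_poly_alg)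
  have I: "I = PIdl\<^bsub>poly_alg\<^esub> (monom 1 m)" by (simp add: I_def PIdl_poly_alg)
  interpret ideal I "poly_alg :: ('f, 'f poly) module"
    unfolding I by (rule cgenideal_ideal) (simp add: poly_alg_def)
  have car: "carrier (poly_alg :: ('f, 'f poly) module) = UNIV"
    and mul: "x \<otimes>\<^bsub>poly_alg\<^esub> y = x * y" and ad: "x \<oplus>\<^bsub>poly_alg\<^esub> y = x + y"
    and on: "\<one>\<^bsub>poly_alg\<^esub> = (1 :: 'f poly)" for x y :: "'f poly"
    by (simp_all add: poly_alg_def)
  note simps = truncated_poly_alg_def quot_alg_def ring.defs module.defs monoid.defs FactRing_def
    I [symmetric]
  show "carrier (truncated_poly_alg m) = range (\<lambda>p. I +>\<^bsub>poly_alg\<^esub> p)"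
    by (auto simp: simps A_RCOSETS_def RCOSETS_def car a_r_coset_def)
  show "(I +>\<^bsub>poly_alg\<^esub> p) \<otimes>\<^bsub>truncated_poly_alg m\<^esub> (I +>\<^bsub>poly_alg\<^esub> q) = I +>\<^bsub>poly_alg\<^esub> (p * q)"
    using rcoset_mult_add [of p q] by (simp add: simps car mul)
  show "(I +>\<^bsub>poly_alg\<^esub> p) \<oplus>\<^bsub>truncated_poly_alg m\<^esub> (I +>\<^bsub>poly_alg\<^esub> q) = I +>\<^bsub>poly_alg\<^esub> (p + q)"
    using a_rcos_sum [of p q] by (simp add: simps car ad)
  show "\<one>\<^bsub>truncated_poly_alg m\<^esub> = I +>\<^bsub>poly_alg\<^esub> 1"
    by (simp add: simps on)
  \<comment> \<open>\<open>quot_alg\<close> scales a coset by a union over its elements; they all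
    give the same coset, so the union collapses.\<close>
  have "I +>\<^bsub>poly_alg\<^esub> Polynomial.smult c x = I +>\<^bsub>poly_alg\<^esub> Polynomial.smult c p"
    if "x \<in> I +>\<^bsub>poly_alg\<^esub> p" for x
  proof -
    have "monom 1 m dvd x - p" using that unfolding I_def coset_poly_alg by auto
    then have "monom 1 m dvd Polynomial.smult c (x - p)" by (rule dvd_smult)
    then show ?thesis unfolding I_def coset_poly_alg_eq_iff by (simp add: smult_diff_right)
  qed
  moreover have "p \<in> I +>\<^bsub>poly_alg\<^esub> p" unfolding I_def coset_poly_alg by auto
  ultimately have "(\<Union>a\<in>I +>\<^bsub>poly_alg\<^esub> p. I +>\<^bsub>poly_alg\<^esub> Polynomial.smult c a)
      = I +>\<^bsub>poly_alg\<^esub> Polynomial.smult c p" by blast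
  then show "c \<odot>\<^bsub>truncated_poly_alg m\<^esub> (I +>\<^bsub>poly_alg\<^esub> p) = I +>\<^bsub>poly_alg\<^esub> (Polynomial.smult c p)"
    by (simp add: simps) (simp add: poly_alg_def)
qed

section \<open>Blocks of an algebra generated by one element\<close>

text \<open>This is \<open>F[x]\<close> modulo a product of powers of distinct linear factors, with
  \<open>h\<close> as the quotient map. Everything about ideals of \<open>A\<close> is read off from
  divisibility of polynomials; endomorphisms enter only in the final theorem.\<close>

locale poly_image = ring A for A :: "('f::field, 'a) module" (structure) +
  fixes h :: "'f poly \<Rightarrow> 'a" and R :: "'f set" and m :: "'f \<Rightarrow> nat"
  assumes range_h: "range h = carrier A"
    and h_add: "h (p + q) = h p \<oplus> h q"
    and h_mult: "h (p * q) = h p \<otimes> h q"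
    and h_one: "h 1 = \<one>"
    and h_smult: "h (Polynomial.smult c p) = c \<odot>\<^bsub>A\<^esub> h p"
    and h_eq_zero_iff_dvd: "h p = \<zero> \<longleftrightarrow> (\<Prod>r\<in>R. [:-r, 1:] ^ m r) dvd p"
    and finite_R: "finite R"
    and m_pos: "r \<in> R \<Longrightarrow> m r > 0"
begin

abbreviation P :: "'f \<Rightarrow> 'f poly" where "P r \<equiv> [:-r, 1:] ^ m r"

text \<open>The factor at \<open>r\<close> of the Chinese remainder decomposition, realised as an
  ideal rather than as a quotient.\<close>

definition blk :: "'f \<Rightarrow> 'a set" where "blk r = h ` {p. \<forall>s\<in>R - {r}. P s dvd p}"

lemma h_closed [simp]: "h p \<in> carrier A"
  using range_h by blast

lemma h_zero: "h 0 = \<zero>"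
  by (simp add: h_eq_zero_iff_dvd)

lemma h_eq_zero_iff: "h p = \<zero> \<longleftrightarrow> (\<forall>r\<in>R. P r dvd p)"
proof
  assume "h p = \<zero>"
  then have "(\<Prod>r\<in>R. P r) dvd p" by (simp add: h_eq_zero_iff_dvd)
  moreover have "P r dvd (\<Prod>r\<in>R. P r)" if "r \<in> R" for r
    using finite_R that by (rule dvd_prodI)
  ultimately show "\<forall>r\<in>R. P r dvd p" by (blast intro: dvd_trans)
next
  assume "\<forall>r\<in>R. P r dvd p"
  then have "(\<Prod>r\<in>R. P r) dvd p" using prod_linear_powers_dvd [OF finite_R] by blast
  then show "h p = \<zero>" by (simp add: h_eq_zero_iff_dvd)
qed

lemma h_uminus: "h (- p) = \<ominus> h p"
proof -
  have "h (- p) \<oplus> h p = \<zero>" using h_add [of "- p" p] h_zero by simp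
  then show ?thesis by (simp add: minus_equality)
qed

lemma h_diff: "h (p - q) = h p \<ominus> h q"
  using h_add [of p "- q"] by (simp add: h_uminus a_minus_def)

lemma h_eq_iff: "h p = h q \<longleftrightarrow> (\<forall>r\<in>R. P r dvd p - q)"
proof -
  have "h p = h q" if "h (p - q) = \<zero>"
    using h_add [of "p - q" q] that by simp
  moreover have "h (p - q) = \<zero>" if "h p = h q"
    using that by (simp add: h_diff a_minus_def r_neg)
  ultimately have "h p = h q \<longleftrightarrow> h (p - q) = \<zero>" by blast
  then show ?thesis by (simp add: h_eq_zero_iff)
qed

text \<open>Membership does not depend on the representative, since the kernel of \<open>h\<close>
  consists of multiples of every \<open>P s\<close> with \<open>s\<close> in
  \<open>R\<close>.\<close>

lemma h_in_blk_iff: "h p \<in> blk r \<longleftrightarrow> (\<forall>s\<in>R - {r}. P s dvd p)"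
proof
  assume "h p \<in> blk r"
  then obtain q where q: "h p = h q" "\<forall>s\<in>R - {r}. P s dvd q" by (auto simp: blk_def)
  show "\<forall>s\<in>R - {r}. P s dvd p"
  proof
    fix s assume s: "s \<in> R - {r}"
    have "P s dvd p - q" using q(1) s by (simp add: h_eq_iff)
    moreover have "P s dvd q" using q(2) s by blast
    ultimately have "P s dvd (p - q) + q" by (rule dvd_add)
    then show "P s dvd p" by simp
  qed
qed (auto simp: blk_def)

lemma ideal_image:
  assumes "0 \<in> J" "\<And>p q. p \<in> J \<Longrightarrow> q \<in> J \<Longrightarrow> p + q \<in> J" "\<And>p q. p \<in> J \<Longrightarrow> q * p \<in> J"
  shows "ideal (h ` J) A"
proof (rule idealI)
  show "ring A" by (rule ring_axioms)
  show "subgroup (h ` J) (add_monoid A)"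
  proof
    show "\<one>\<^bsub>add_monoid A\<^esub> \<in> h ` J" using assms(1) h_zero by (metis imageI monoid.select_convs(2))
    fix x y assume "x \<in> h ` J" "y \<in> h ` J"
    then obtain p q where "x = h p" "y = h q" "p \<in> J" "q \<in> J" by blast
    then show "x \<otimes>\<^bsub>add_monoid A\<^esub> y \<in> h ` J"
      using assms(2) by (simp flip: h_add)
  next
    fix x assume "x \<in> h ` J"
    then obtain p where p: "x = h p" "p \<in> J" by blast
    have "h (- p) \<in> h ` J" using assms(3) [OF p(2), of "- 1"] by simp
    then show "inv\<^bsub>add_monoid A\<^esub> x \<in> h ` J"
      using p by (simp add: h_uminus a_inv_def)
  qed auto
next
  fix a x assume "a \<in> h ` J" "x \<in> carrier A"
  then obtain p q where pq: "a = h p" "x = h q" "p \<in> J" using range_h by blast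
  then show "x \<otimes> a \<in> h ` J" using assms(3) by (auto simp flip: h_mult)
  have "q * p \<in> J" using assms(3) pq by blast
  then show "a \<otimes> x \<in> h ` J" using pq by (auto simp flip: h_mult simp: mult.commute)
qed

lemma ideal_blk: "ideal (blk r) A"
  unfolding blk_def by (rule ideal_image) auto

lemma ideal_coblk: "ideal (h ` {p. P r dvd p}) A"
  by (rule ideal_image) auto

lemma mult_comm: "x \<in> carrier A \<Longrightarrow> y \<in> carrier A \<Longrightarrow> x \<otimes> y = y \<otimes> x"
  using range_h h_mult mult.commute by (metis rangeE)

text \<open>A polynomial representing the Chinese remainder idempotent of \<open>blk r\<close>. It
  is determined only modulo the factors, and its image under \<open>h\<close> does not depend on the
  choice.\<close>

definition idem :: "'f \<Rightarrow> 'f poly" where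
  "idem r = (SOME e. (\<forall>s\<in>R - {r}. P s dvd e) \<and> P r dvd 1 - e)"

lemma idem:
  shows "s \<in> R - {r} \<Longrightarrow> P s dvd idem r" and "P r dvd 1 - idem r"
proof -
  have "poly (\<Prod>s\<in>R - {r}. P s) r \<noteq> 0"
    using finite_R by (simp add: poly_prod poly_power)
  then obtain u v where uv: "u * (\<Prod>s\<in>R - {r}. P s) + v * P r = 1"
    using bezout_linear_power by blast
  have "P s dvd u * (\<Prod>s\<in>R - {r}. P s)" if "s \<in> R - {r}" for s
    using that finite_R by (intro dvd_mult dvd_prodI) auto
  moreover have "1 - u * (\<Prod>s\<in>R - {r}. P s) = v * P r"
    using uv by (simp add: algebra_simps)
  then have "P r dvd 1 - u * (\<Prod>s\<in>R - {r}. P s)" by simp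
  ultimately have "\<exists>e. (\<forall>s\<in>R - {r}. P s dvd e) \<and> P r dvd 1 - e" by blast
  from someI_ex [OF this]
  show "s \<in> R - {r} \<Longrightarrow> P s dvd idem r" "P r dvd 1 - idem r" unfolding idem_def by blast+
qed

lemma h_idem_in_blk: "h (idem r) \<in> blk r"
  by (simp add: h_in_blk_iff idem)

lemma h_idem_mult:
  assumes "b \<in> blk r"
  shows "h (idem r) \<otimes> b = b"
proof -
  obtain p where p: "b = h p" "\<forall>s\<in>R - {r}. P s dvd p" using assms by (auto simp: blk_def)
  have "P s dvd idem r * p - p" if "s \<in> R" for s
  proof (cases "s = r")
    case True
    have "idem r * p - p = - ((1 - idem r) * p)" by (simp add: algebra_simps)
    then show ?thesis using idem(2) [of r] True by (simp only: dvd_minus_iff dvd_mult2)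
  next
    case False
    then show ?thesis using that p(2) by (intro dvd_diff dvd_mult) auto
  qed
  then show ?thesis using p(1) by (simp add: h_eq_iff flip: h_mult)
qed

lemma blk_subset: "blk r \<subseteq> carrier A"
  by (auto simp: blk_def)

lemma block_one: "(THE e. e \<in> blk r \<and> (\<forall>b\<in>blk r. e \<otimes> b = b \<and> b \<otimes> e = b)) = h (idem r)"
proof (rule the_equality)
  have "b \<otimes> h (idem r) = h (idem r) \<otimes> b" if "b \<in> blk r" for b
    using that blk_subset by (intro mult_comm) auto
  then show "h (idem r) \<in> blk r \<and>
      (\<forall>b\<in>blk r. h (idem r) \<otimes> b = b \<and> b \<otimes> h (idem r) = b)"
    using h_idem_in_blk h_idem_mult by simp
next
  fix e assume e: "e \<in> blk r \<and> (\<forall>b\<in>blk r. e \<otimes> b = b \<and> b \<otimes> e = b)"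
  then have "h (idem r) \<otimes> e = h (idem r)" using h_idem_in_blk by blast
  then show "e = h (idem r)" using e h_idem_mult by metis
qed

text \<open>Corresponds to \<open>x ^ (m - 1)\<close> in the ring of polynomials modulo
  \<open>x ^ m\<close>, which spans the unique minimal ideal there.\<close>

definition socle_gen :: "'f \<Rightarrow> 'f poly" where
  "socle_gen r = idem r * [:-r, 1:] ^ (m r - 1)"

lemma socle_gen_in_blk: "h (socle_gen r) \<in> blk r"
  by (auto simp: h_in_blk_iff socle_gen_def idem intro!: dvd_mult2)

lemma not_dvd_socle_gen:
  assumes "r \<in> R"
  shows "\<not> P r dvd socle_gen r"
proof
  assume "P r dvd socle_gen r"
  moreover have "P r = [:-r, 1:] ^ (m r - 1) * [:-r, 1:]"
    using m_pos [OF assms] by (metis Suc_diff_1 power_Suc2)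
  ultimately have "[:-r, 1:] ^ (m r - 1) * [:-r, 1:] dvd [:-r, 1:] ^ (m r - 1) * idem r"
    by (simp only: socle_gen_def mult.commute)
  then have "[:-r, 1:] dvd idem r" by (subst (asm) dvd_mult_cancel_left) simp
  moreover have "[:-r, 1:] dvd 1 - idem r"
    using idem(2) [of r] dvd_power [of "m r" "[:-r, 1:]"] m_pos [OF assms] dvd_trans by blast
  ultimately show False by (simp flip: poly_eq_0_iff_dvd)
qed

lemma socle_gen_nonzero: "r \<in> R \<Longrightarrow> h (socle_gen r) \<noteq> \<zero>"
  using not_dvd_socle_gen h_eq_zero_iff by blast

text \<open>A nonzero class in \<open>blk r\<close> is \<open>(x - r) ^ j\<close>, with
  \<open>j < m r\<close>, times a polynomial that does not vanish at \<open>r\<close>, and can be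
  multiplied up into the socle. Hence any two nonzero ideals inside \<open>blk r\<close> meet, which
  makes it indecomposable.\<close>

lemma ideal_contains_socle_gen:
  assumes "ideal I A" "I \<subseteq> blk r" "I \<noteq> {\<zero>}" "r \<in> R"
  shows "h (socle_gen r) \<in> I"
proof -
  interpret I: ideal I A by fact
  obtain a where a: "a \<in> I" "a \<noteq> \<zero>" using assms(3) I.zero_closed by blast
  then obtain p where p: "a = h p" "\<forall>s\<in>R - {r}. P s dvd p"
    using assms(2) by (auto simp: blk_def)
  have np: "\<not> P r dvd p" using a(2) p by (auto simp: h_eq_zero_iff)
  then have "p \<noteq> 0" by auto
  then obtain u where u: "p = [:-r, 1:] ^ Polynomial.order r p * u" "\<not> [:-r, 1:] dvd u"
    using order_decomp by blast
  define j where "j = Polynomial.order r p"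
  have p_eq: "p = [:-r, 1:] ^ j * u" using u(1) unfolding j_def .
  have j: "j < m r"
  proof (rule ccontr)
    assume "\<not> j < m r"
    then have "P r dvd [:-r, 1:] ^ j" by (intro le_imp_power_dvd) simp
    then have "P r dvd [:-r, 1:] ^ j * u" by (rule dvd_mult2)
    then show False using np unfolding p_eq by (rule notE [rotated])
  qed
  obtain w v where wv: "w * u + v * [:-r, 1:] ^ 1 = 1"
    using bezout_linear_power [of u r 1] u(2) unfolding poly_eq_0_iff_dvd by blast
  \<comment> \<open>Inverting \<open>u\<close> modulo \<open>x - r\<close> alone suffices, because
    the error is multiplied by \<open>(x - r) ^ (m r - 1)\<close>; the factor \<open>idem r\<close>
    removes the other components.\<close>
  define g where "g = idem r * [:-r, 1:] ^ (m r - 1 - j) * w"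
  have pw: "[:-r, 1:] ^ (m r - 1 - j) * [:-r, 1:] ^ j = [:-r, 1:] ^ (m r - 1)"
    using j by (simp flip: power_add)
  have "g * p - socle_gen r = idem r * ([:-r, 1:] ^ (m r - 1 - j) * [:-r, 1:] ^ j) * (w * u)
      - idem r * [:-r, 1:] ^ (m r - 1)"
    unfolding g_def socle_gen_def by (subst p_eq) (simp only: mult_ac)
  also have "\<dots> = idem r * [:-r, 1:] ^ (m r - 1) * (w * u - 1)"
    unfolding pw by (simp only: right_diff_distrib mult_1_right)
  also have "w * u - 1 = - (v * [:-r, 1:])"
    unfolding wv [symmetric] by simp
  finally have gp: "g * p - socle_gen r = idem r * [:-r, 1:] ^ (m r - 1) * - (v * [:-r, 1:])" .
  have "P s dvd g * p - socle_gen r" if "s \<in> R" for s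
  proof (cases "s = r")
    case True
    have "P r = [:-r, 1:] ^ (m r - 1) * [:-r, 1:]"
      using m_pos [OF assms(4)] by (metis Suc_diff_1 power_Suc2)
    moreover have "g * p - socle_gen r = - (idem r * v) * ([:-r, 1:] ^ (m r - 1) * [:-r, 1:])"
      unfolding gp by (simp only: mult_minus_left mult_minus_right mult_ac)
    ultimately show ?thesis unfolding True by (simp only: dvd_triv_right)
  next
    case False
    then show ?thesis using that idem(1) [of s r] unfolding gp
      by (intro dvd_mult2) simp
  qed
  then have "h (g * p) = h (socle_gen r)" unfolding h_eq_iff by blast
  then have "h (socle_gen r) = h (g * p)" by (rule sym)
  also have "\<dots> = h g \<otimes> a" by (simp add: h_mult p(1))
  finally show ?thesis using I.I_l_closed [OF a(1), of "h g"] by simp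
qed

lemma set_addE:
  assumes "x \<in> H <+>\<^bsub>A\<^esub> K"
  obtains a b where "a \<in> H" "b \<in> K" "x = a \<oplus> b"
  using assms by (auto simp: set_add_def')

lemma ideal_subset_sum:
  assumes "ideal I A" "ideal J A"
  shows "I \<subseteq> I <+>\<^bsub>A\<^esub> J" "J \<subseteq> I <+>\<^bsub>A\<^esub> J"
proof -
  interpret I: ideal I A by fact
  interpret J: ideal J A by fact
  show "I \<subseteq> I <+>\<^bsub>A\<^esub> J"
  proof
    fix x assume x: "x \<in> I"
    then have "x = x \<oplus> \<zero>" using I.a_subset by auto
    then show "x \<in> I <+>\<^bsub>A\<^esub> J" unfolding set_add_def' using x J.zero_closed by blast
  qed
  show "J \<subseteq> I <+>\<^bsub>A\<^esub> J"
  proof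
    fix x assume x: "x \<in> J"
    then have "x = \<zero> \<oplus> x" using J.a_subset by auto
    then show "x \<in> I <+>\<^bsub>A\<^esub> J" unfolding set_add_def' using x I.zero_closed by blast
  qed
qed

lemma blk_inter_coblk: "blk r \<inter> h ` {p. P r dvd p} \<subseteq> {\<zero>}"
proof
  fix x assume "x \<in> blk r \<inter> h ` {p. P r dvd p}"
  then obtain p where p: "x = h p" "P r dvd p" "h p \<in> blk r" by blast
  then have "\<forall>s\<in>R. P s dvd p" unfolding h_in_blk_iff by blast
  then show "x \<in> {\<zero>}" using p(1) h_eq_zero_iff by simp
qed

lemma blk_direct_summand: "ideal_direct_summand (blk r) A"
  unfolding ideal_direct_summand_def
proof (intro conjI exI)
  interpret B: ideal "blk r" A by (rule ideal_blk)
  interpret C: ideal "h ` {p. P r dvd p}" A by (rule ideal_coblk)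
  show "blk r <+>\<^bsub>A\<^esub> h ` {p. P r dvd p} = carrier A"
  proof
    show "blk r <+>\<^bsub>A\<^esub> h ` {p. P r dvd p} \<subseteq> carrier A"
      using blk_subset by (auto simp: set_add_def')
    show "carrier A \<subseteq> blk r <+>\<^bsub>A\<^esub> h ` {p. P r dvd p}"
    proof
      fix a assume "a \<in> carrier A"
      then obtain p where p: "a = h p" using range_h by blast
      have "idem r * p + (1 - idem r) * p = p" by (simp add: algebra_simps)
      then have "a = h (idem r * p) \<oplus> h ((1 - idem r) * p)"
        unfolding h_add [symmetric] using p by simp
      moreover have "h (idem r * p) \<in> blk r" using idem(1) by (simp add: h_in_blk_iff)
      moreover have "P r dvd (1 - idem r) * p" using idem(2) by (rule dvd_mult2)
      ultimately show "a \<in> blk r <+>\<^bsub>A\<^esub> h ` {p. P r dvd p}" unfolding set_add_def' by blast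
    qed
  qed
  show "blk r \<inter> h ` {p. P r dvd p} = {\<zero>}"
    using blk_inter_coblk B.zero_closed C.zero_closed by blast
qed (rule ideal_blk ideal_coblk)+

lemma blk_indecomposable:
  assumes "r \<in> R"
  shows "indecomposable_ideal (blk r) A"
  unfolding indecomposable_ideal_def
proof (intro conjI allI impI)
  show "ideal (blk r) A" by (rule ideal_blk)
  show "blk r \<noteq> {\<zero>}" using socle_gen_in_blk socle_gen_nonzero [OF assms] by blast
  fix I J assume IJ: "ideal I A \<and> ideal J A \<and> I <+>\<^bsub>A\<^esub> J = blk r \<and> I \<inter> J = {\<zero>}"
  then have "I \<subseteq> blk r" "J \<subseteq> blk r" using ideal_subset_sum by blast+
  then show "I = {\<zero>} \<or> J = {\<zero>}"
    using ideal_contains_socle_gen [of I r] ideal_contains_socle_gen [of J r] IJ assms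
      socle_gen_nonzero [OF assms] by blast
qed

text \<open>A nonzero element of \<open>B\<close> has a nonzero component at some \<open>r\<close>.
  Cutting \<open>B\<close> along \<open>blk r\<close> and its complement, indecomposability puts
  \<open>B\<close> inside \<open>blk r\<close>. Now \<open>B\<close> contains the socle generator,
  so the complement \<open>D\<close> of \<open>B\<close> meets \<open>blk r\<close> in zero only and
  is killed by the idempotent; multiplying \<open>B + D\<close> by the idempotent gives
  \<open>blk r\<close> inside \<open>B\<close>.\<close>

lemma block_is_blk:
  assumes "B \<in> blocks A"
  shows "B \<in> blk ` R"
proof -
  from assms obtain D where B: "ideal B A" and D: "ideal D A" and BD: "B <+>\<^bsub>A\<^esub> D = carrier A"
    and BD0: "B \<inter> D = {\<zero>}" and indec: "indecomposable_ideal B A"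
    by (auto simp: blocks_def ideal_direct_summand_def)
  interpret B: ideal B A by fact
  interpret D: ideal D A by fact
  have "B \<noteq> {\<zero>}" using indec by (simp add: indecomposable_ideal_def)
  then obtain b where b: "b \<in> B" "b \<noteq> \<zero>" using B.zero_closed by blast
  then obtain p where p: "b = h p" using range_h B.a_subset by blast
  then obtain r where r: "r \<in> R" "\<not> P r dvd p" using b by (auto simp: h_eq_zero_iff)
  let ?e = "h (idem r)"
  let ?C = "h ` {p. P r dvd p}"
  interpret E: ideal "blk r" A by (rule ideal_blk)
  interpret C: ideal ?C A by (rule ideal_coblk)
  have eb: "?e \<otimes> b \<in> B" "?e \<otimes> b \<in> blk r"
    using b h_idem_in_blk p by (simp_all add: B.I_l_closed E.I_r_closed)
  have "\<not> P r dvd idem r * p"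
  proof
    assume "P r dvd idem r * p"
    then have "P r dvd idem r * p + (1 - idem r) * p"
      using dvd_mult2 [OF idem(2)] by (rule dvd_add)
    moreover have "idem r * p + (1 - idem r) * p = p" by (simp add: algebra_simps)
    ultimately show False using r by simp
  qed
  then have eb0: "?e \<otimes> b \<noteq> \<zero>" using r p by (auto simp: h_eq_zero_iff simp flip: h_mult)
  have split: "x = ?e \<otimes> x \<oplus> h (1 - idem r) \<otimes> x" if "x \<in> carrier A" for x
  proof -
    obtain q where "x = h q" using \<open>x \<in> carrier A\<close> range_h by blast
    have "idem r * q + (1 - idem r) * q = q" by (simp add: algebra_simps)
    then have "h q = h (idem r * q + (1 - idem r) * q)" by (rule arg_cong [OF sym])
    also have "\<dots> = ?e \<otimes> h q \<oplus> h (1 - idem r) \<otimes> h q" by (simp only: h_add h_mult)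
    finally show ?thesis using \<open>x = h q\<close> by simp
  qed
  have C: "h (1 - idem r) \<otimes> x \<in> ?C" if "x \<in> carrier A" for x
    using idem(2) [of r] that by (intro C.I_r_closed) auto
  have "(B \<inter> blk r) <+>\<^bsub>A\<^esub> (B \<inter> ?C) = B"
  proof
    show "(B \<inter> blk r) <+>\<^bsub>A\<^esub> (B \<inter> ?C) \<subseteq> B"
      using B.a_closed by (auto simp: set_add_def')
    show "B \<subseteq> (B \<inter> blk r) <+>\<^bsub>A\<^esub> (B \<inter> ?C)"
    proof
      fix x assume x: "x \<in> B"
      then have "x \<in> carrier A" using B.a_subset by blast
      then have "?e \<otimes> x \<in> B \<inter> blk r" "h (1 - idem r) \<otimes> x \<in> B \<inter> ?C"
        using x B.I_l_closed C h_idem_in_blk E.I_r_closed by auto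
      then show "x \<in> (B \<inter> blk r) <+>\<^bsub>A\<^esub> (B \<inter> ?C)"
        using split [OF \<open>x \<in> carrier A\<close>] unfolding set_add_def' by blast
    qed
  qed
  moreover have "ideal (B \<inter> blk r) A" "ideal (B \<inter> ?C) A"
    using i_intersect ideal_blk ideal_coblk B by blast+
  moreover have "(B \<inter> blk r) \<inter> (B \<inter> ?C) = {\<zero>}"
  proof -
    show ?thesis using blk_inter_coblk B.zero_closed E.zero_closed C.zero_closed by blast
  qed
  ultimately have "B \<inter> blk r = {\<zero>} \<or> B \<inter> ?C = {\<zero>}"
    using indec unfolding indecomposable_ideal_def by blast
  then have BC: "B \<inter> ?C = {\<zero>}" using eb eb0 by blast
  have 1: "B \<subseteq> blk r"
  proof
    fix x assume x: "x \<in> B"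
    then have xc: "x \<in> carrier A" using B.a_subset by blast
    have "h (1 - idem r) \<otimes> x \<in> B \<inter> ?C" using C [OF xc] B.I_l_closed x by simp
    then have "h (1 - idem r) \<otimes> x = \<zero>" using BC by blast
    then have "x = ?e \<otimes> x" using split [OF xc] xc by simp
    then show "x \<in> blk r" using E.I_r_closed [OF h_idem_in_blk xc] by simp
  qed
  have "h (socle_gen r) \<in> blk r \<inter> B"
    using eb eb0 r(1) B by (intro ideal_contains_socle_gen i_intersect ideal_blk) auto
  then have "h (socle_gen r) \<notin> blk r \<inter> D" using BD0 socle_gen_nonzero [OF r(1)] by blast
  then have rD: "blk r \<inter> D = {\<zero>}"
    using ideal_contains_socle_gen [of "blk r \<inter> D" r] i_intersect [OF ideal_blk D] r(1) by blast
  have "blk r \<subseteq> B"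
  proof
    fix x assume x: "x \<in> blk r"
    then have "x \<in> B <+>\<^bsub>A\<^esub> D" using blk_subset BD by blast
    then obtain y z where yz: "y \<in> B" "z \<in> D" "x = y \<oplus> z" by (rule set_addE)
    have car: "y \<in> carrier A" "z \<in> carrier A" using yz B.a_subset D.a_subset by auto
    have "?e \<otimes> z \<in> blk r \<inter> D" using yz(2) car E.I_r_closed h_idem_in_blk D.I_l_closed by auto
    then have "?e \<otimes> z = \<zero>" using rD by blast
    moreover have "x = ?e \<otimes> y \<oplus> ?e \<otimes> z"
      using h_idem_mult [OF x] yz(3) car by (simp add: r_distr)
    ultimately have "x = ?e \<otimes> y" using car by simp
    then show "x \<in> B" using B.I_l_closed yz(1) by simp
  qed
  then show ?thesis using 1 r(1) by blast
qed

lemma bij_betw_blk: "bij_betw blk R (blocks A)"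
  unfolding bij_betw_def
proof
  show "inj_on blk R"
  proof (rule inj_onI, rule ccontr)
    fix r s assume rs: "r \<in> R" "s \<in> R" "blk r = blk s" "r \<noteq> s"
    then have "h (socle_gen r) \<in> blk s" using socle_gen_in_blk by blast
    then have "P r dvd socle_gen r" using rs unfolding h_in_blk_iff by blast
    then show False using rs not_dvd_socle_gen by blast
  qed
  show "blk ` R = blocks A"
    using block_is_blk blk_direct_summand blk_indecomposable by (auto simp: blocks_def)
qed

lemma finsum_h:
  assumes "finite K"
  shows "(\<Oplus>r\<in>K. h (p r)) = h (\<Sum>r\<in>K. p r)"
  using assms
  by (induction K rule: finite_induct) (simp_all add: h_zero h_add)

text \<open>Every verification is a congruence modulo one \<open>P s\<close> at a time, where by
  \<open>loc\<close> the sum of the representatives is congruent to its summand at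
  \<open>s\<close>.\<close>

lemma sum_iso_prod_alg:
  "(\<lambda>x. \<Oplus>r\<in>R. x r) \<in> alg_iso (prod_alg R (\<lambda>r. block_alg A (blk r))) A"
proof -
  let ?\<Pi> = "prod_alg R (\<lambda>r. block_alg A (blk r))"
  let ?S = "\<lambda>x. \<Oplus>r\<in>R. x r"
  have car: "carrier ?\<Pi> = (\<Pi>\<^sub>E r\<in>R. blk r)"
    by (simp add: prod_alg_def block_alg_def)
  have rep: "\<exists>p. (\<forall>r\<in>R. x r = h (p r) \<and> (\<forall>s\<in>R - {r}. P s dvd p r))" if "x \<in> carrier ?\<Pi>" for x
  proof -
    have "\<exists>p. x r = h p \<and> (\<forall>s\<in>R - {r}. P s dvd p)" if "r \<in> R" for r
    proof -
      have "x r \<in> blk r" using \<open>x \<in> carrier ?\<Pi>\<close> that unfolding car by (rule PiE_mem)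
      then show ?thesis by (auto simp: blk_def)
    qed
    then show ?thesis by (intro bchoice ballI)
  qed
  have S: "?S x = h (\<Sum>r\<in>R. p r)" if "\<forall>r\<in>R. x r = h (p r)" for x p
  proof -
    have "?S x = (\<Oplus>r\<in>R. h (p r))" using that by (intro finsum_cong') auto
    then show ?thesis by (simp add: finsum_h finite_R)
  qed
  have loc: "P s dvd (\<Sum>r\<in>R. p r) - p s"
    if "\<forall>r\<in>R. \<forall>s\<in>R - {r}. P s dvd p r" "s \<in> R" for p s
  proof -
    have "(\<Sum>r\<in>R. p r) - p s = (\<Sum>r\<in>R - {s}. p r)"
      using that finite_R by (simp add: sum_diff1)
    moreover have "P s dvd (\<Sum>r\<in>R - {s}. p r)" using that by (intro dvd_sum) auto
    ultimately show ?thesis by simp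
  qed
  have "?S \<in> ring_hom ?\<Pi> A"
  proof (rule ring_hom_memI)
    fix x assume "x \<in> carrier ?\<Pi>"
    from rep [OF this] obtain p where "\<forall>r\<in>R. x r = h (p r)" by blast
    from S [OF this] show "?S x \<in> carrier A" by simp
  next
    fix x y assume xy: "x \<in> carrier ?\<Pi>" "y \<in> carrier ?\<Pi>"
    obtain p where p: "\<forall>r\<in>R. x r = h (p r)" "\<forall>r\<in>R. \<forall>s\<in>R - {r}. P s dvd p r"
      using rep [OF xy(1)] by blast
    obtain q where q: "\<forall>r\<in>R. y r = h (q r)" "\<forall>r\<in>R. \<forall>s\<in>R - {r}. P s dvd q r"
      using rep [OF xy(2)] by blast
    have "\<forall>r\<in>R. (x \<otimes>\<^bsub>?\<Pi>\<^esub> y) r = h (p r * q r)"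
      using p(1) q(1) by (simp add: prod_alg_def block_alg_def h_mult)
    then have "?S (x \<otimes>\<^bsub>?\<Pi>\<^esub> y) = h (\<Sum>r\<in>R. p r * q r)" by (rule S)
    moreover have "h ((\<Sum>r\<in>R. p r) * (\<Sum>r\<in>R. q r)) = h (\<Sum>r\<in>R. p r * q r)"
      unfolding h_eq_iff
    proof
      fix s assume s: "s \<in> R"
      have "P s dvd (\<Sum>r\<in>R. p r * q r) - p s * q s"
        using p(2) q(2) s by (intro loc) (auto intro: dvd_mult)
      moreover have "P s dvd ((\<Sum>r\<in>R. p r) - p s) * (\<Sum>r\<in>R. q r)"
        using loc [OF p(2) s] by (rule dvd_mult2)
      moreover have "P s dvd p s * ((\<Sum>r\<in>R. q r) - q s)"
        using loc [OF q(2) s] by (rule dvd_mult)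
      ultimately have "P s dvd ((\<Sum>r\<in>R. p r) - p s) * (\<Sum>r\<in>R. q r)
          + p s * ((\<Sum>r\<in>R. q r) - q s) - ((\<Sum>r\<in>R. p r * q r) - p s * q s)"
        by (rule dvd_diff [OF dvd_add, rotated 2])
      also have "\<dots> = (\<Sum>r\<in>R. p r) * (\<Sum>r\<in>R. q r) - (\<Sum>r\<in>R. p r * q r)"
        by (simp only: left_diff_distrib right_diff_distrib) simp
      finally show "P s dvd (\<Sum>r\<in>R. p r) * (\<Sum>r\<in>R. q r) - (\<Sum>r\<in>R. p r * q r)" .
    qed
    ultimately show "?S (x \<otimes>\<^bsub>?\<Pi>\<^esub> y) = ?S x \<otimes> ?S y"
      using S [OF p(1)] S [OF q(1)] by (simp add: h_mult)
    have "\<forall>r\<in>R. (x \<oplus>\<^bsub>?\<Pi>\<^esub> y) r = h (p r + q r)"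
      using p(1) q(1) by (simp add: prod_alg_def block_alg_def h_add)
    then have "?S (x \<oplus>\<^bsub>?\<Pi>\<^esub> y) = h (\<Sum>r\<in>R. p r + q r)" by (rule S)
    then show "?S (x \<oplus>\<^bsub>?\<Pi>\<^esub> y) = ?S x \<oplus> ?S y"
      using S [OF p(1)] S [OF q(1)] by (simp add: h_add sum.distrib)
  next
    have "\<forall>r\<in>R. \<one>\<^bsub>?\<Pi>\<^esub> r = h (idem r)"
      by (simp add: prod_alg_def block_alg_def block_one)
    then have "?S \<one>\<^bsub>?\<Pi>\<^esub> = h (\<Sum>r\<in>R. idem r)" by (rule S)
    also have "\<dots> = h 1"
      unfolding h_eq_iff
    proof
      fix s assume s: "s \<in> R"
      have "P s dvd (\<Sum>r\<in>R. idem r) - idem s" using s idem by (intro loc) auto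
      then have "P s dvd (\<Sum>r\<in>R. idem r) - idem s - (1 - idem s)"
        using idem(2) by (rule dvd_diff)
      then show "P s dvd (\<Sum>r\<in>R. idem r) - 1" by simp
    qed
    finally show "?S \<one>\<^bsub>?\<Pi>\<^esub> = \<one>" by (simp add: h_one)
  qed
  moreover have "bij_betw ?S (carrier ?\<Pi>) (carrier A)"
  proof (rule bij_betw_imageI)
    show "inj_on ?S (carrier ?\<Pi>)"
    proof (rule inj_onI)
      fix x y assume xy: "x \<in> carrier ?\<Pi>" "y \<in> carrier ?\<Pi>" and eq: "?S x = ?S y"
      obtain p where p: "\<forall>r\<in>R. x r = h (p r)" "\<forall>r\<in>R. \<forall>s\<in>R - {r}. P s dvd p r"
        using rep [OF xy(1)] by blast
      obtain q where q: "\<forall>r\<in>R. y r = h (q r)" "\<forall>r\<in>R. \<forall>s\<in>R - {r}. P s dvd q r"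
        using rep [OF xy(2)] by blast
      have jm_endo: "h (\<Sum>r\<in>R. p r) = h (\<Sum>r\<in>R. q r)" using eq S [OF p(1)] S [OF q(1)] by simp
      have "h (p r) = h (q r)" if r: "r \<in> R" for r
        unfolding h_eq_iff
      proof
        fix s assume s: "s \<in> R"
        show "P s dvd p r - q r"
        proof (cases "s = r")
          case True
          have "P r dvd ((\<Sum>r\<in>R. p r) - (\<Sum>r\<in>R. q r)) - ((\<Sum>r\<in>R. p r) - p r)
              + ((\<Sum>r\<in>R. q r) - q r)"
            using jm_endo r loc [OF p(2) r] loc [OF q(2) r] unfolding h_eq_iff
            by (intro dvd_add [OF dvd_diff]) blast+
          then show ?thesis unfolding True by simp
        next
          case False
          then show ?thesis using p(2) q(2) r s by (intro dvd_diff) auto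
        qed
      qed
      then have "x r = y r" if "r \<in> R" for r using that p(1) q(1) by simp
      then show "x = y" using xy unfolding car by (intro PiE_ext)
    qed
    show "?S ` carrier ?\<Pi> = carrier A"
    proof
      show "?S ` carrier ?\<Pi> \<subseteq> carrier A"
        using rep S by fastforce
      show "carrier A \<subseteq> ?S ` carrier ?\<Pi>"
      proof
        fix a assume "a \<in> carrier A"
        then obtain p where p: "a = h p" using range_h by blast
        define x where "x = (\<lambda>r\<in>R. h (idem r * p))"
        have "x \<in> carrier ?\<Pi>"
          unfolding car x_def using idem(1) by (intro restrict_PiE_iff [THEN iffD2])
            (simp add: h_in_blk_iff)
        moreover have "?S x = h (\<Sum>r\<in>R. idem r * p)" by (rule S) (simp add: x_def)
        moreover have "h (\<Sum>r\<in>R. idem r * p) = h p"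
          unfolding h_eq_iff
        proof
          fix s assume s: "s \<in> R"
          have "P s dvd (\<Sum>r\<in>R. idem r * p) - idem s * p"
            using s idem(1) by (intro loc ballI dvd_mult2)
          moreover have "P s dvd (1 - idem s) * p" using idem(2) by (rule dvd_mult2)
          ultimately have "P s dvd ((\<Sum>r\<in>R. idem r * p) - idem s * p) - (1 - idem s) * p"
            by (rule dvd_diff)
          then show "P s dvd (\<Sum>r\<in>R. idem r * p) - p" by (simp add: left_diff_distrib)
        qed
        ultimately show "a \<in> ?S ` carrier ?\<Pi>" using p by (metis imageI)
      qed
    qed
  qed
  moreover have "?S (c \<odot>\<^bsub>?\<Pi>\<^esub> x) = c \<odot>\<^bsub>A\<^esub> ?S x" if x: "x \<in> carrier ?\<Pi>" for c x
  proof -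
    obtain p where p: "\<forall>r\<in>R. x r = h (p r)" using rep [OF x] by blast
    then have "\<forall>r\<in>R. (c \<odot>\<^bsub>?\<Pi>\<^esub> x) r = h (Polynomial.smult c (p r))"
      by (simp add: prod_alg_def block_alg_def h_smult)
    then have "?S (c \<odot>\<^bsub>?\<Pi>\<^esub> x) = h (\<Sum>r\<in>R. Polynomial.smult c (p r))" by (rule S)
    also have "(\<Sum>r\<in>R. Polynomial.smult c (p r)) = Polynomial.smult c (\<Sum>r\<in>R. p r)"
      by (simp add: poly_eq_iff coeff_sum sum_distrib_left)
    finally show ?thesis using S [OF p] by (simp add: h_smult)
  qed
  ultimately show ?thesis by (simp add: alg_iso_def ring_iso_def)
qed

text \<open>A representative is recentred at \<open>r\<close> and reduced modulo
  \<open>x ^ m r\<close>. On \<open>blk r\<close> this loses nothing, as the other components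
  vanish; it is onto because a polynomial may be multiplied by \<open>idem r\<close> first.\<close>

lemma block_alg_isomorphic_truncated:
  assumes r: "r \<in> R"
  shows "alg_isomorphic (block_alg A (blk r)) (truncated_poly_alg (m r))"
proof -
  let ?B = "block_alg A (blk r)"
  let ?T = "truncated_poly_alg (m r) :: ('f, 'f poly set) module"
  let ?I = "{p :: 'f poly. monom 1 (m r) dvd p}"
  define cl where "cl p = ?I +>\<^bsub>poly_alg\<^esub> pcompose p [:r, 1:]" for p :: "'f poly"
  have cl_eq_iff: "cl p = cl q \<longleftrightarrow> P r dvd p - q" for p q
    unfolding cl_def coset_poly_alg_eq_iff
    by (simp add: monom_dvd_pcompose_iff flip: pcompose_diff)
  note T = truncated_poly_alg_simps [where 'f = 'f and m = "m r"]
  define \<phi> where "\<phi> a = cl (SOME p. h p = a)" for a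
  have \<phi>: "\<phi> (h p) = cl p" for p
  proof -
    have "h (SOME q. h q = h p) = h p" by (rule someI) (rule refl)
    then have "P r dvd (SOME q. h q = h p) - p" using r unfolding h_eq_iff by blast
    then show ?thesis unfolding \<phi>_def cl_eq_iff .
  qed
  have car: "carrier ?B = blk r" by (simp add: block_alg_def)
  have rep: "\<exists>p. a = h p" if "a \<in> carrier ?B" for a
    using that unfolding car by (auto simp: blk_def)
  have "\<phi> \<in> ring_hom ?B ?T"
  proof (rule ring_hom_memI)
    fix a assume "a \<in> carrier ?B"
    then obtain p where "a = h p" using rep by blast
    then show "\<phi> a \<in> carrier ?T" by (simp add: \<phi> cl_def T)
  next
    fix a b assume "a \<in> carrier ?B" "b \<in> carrier ?B"
    then obtain p q where pq: "a = h p" "b = h q" using rep by metis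
    have "\<phi> (a \<otimes>\<^bsub>?B\<^esub> b) = \<phi> (h (p * q))" by (simp add: block_alg_def pq h_mult)
    also have "\<dots> = \<phi> a \<otimes>\<^bsub>?T\<^esub> \<phi> b"
      unfolding \<phi> pq by (simp add: cl_def T pcompose_mult)
    finally show "\<phi> (a \<otimes>\<^bsub>?B\<^esub> b) = \<phi> a \<otimes>\<^bsub>?T\<^esub> \<phi> b" .
    have "\<phi> (a \<oplus>\<^bsub>?B\<^esub> b) = \<phi> (h (p + q))" by (simp add: block_alg_def pq h_add)
    also have "\<dots> = \<phi> a \<oplus>\<^bsub>?T\<^esub> \<phi> b"
      unfolding \<phi> pq by (simp add: cl_def T pcompose_add)
    finally show "\<phi> (a \<oplus>\<^bsub>?B\<^esub> b) = \<phi> a \<oplus>\<^bsub>?T\<^esub> \<phi> b" .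
  next
    have "\<one>\<^bsub>?B\<^esub> = h (idem r)" by (simp add: block_alg_def block_one)
    moreover have "P r dvd idem r - 1"
      using idem(2) [of r] by (subst (asm) dvd_diff_commute)
    then have "cl (idem r) = cl 1" by (simp only: cl_eq_iff)
    ultimately show "\<phi> \<one>\<^bsub>?B\<^esub> = \<one>\<^bsub>?T\<^esub>" by (simp add: \<phi> T) (simp add: cl_def pcompose_1)
  qed
  moreover have "bij_betw \<phi> (carrier ?B) (carrier ?T)"
  proof (rule bij_betw_imageI)
    show "inj_on \<phi> (carrier ?B)"
    proof (rule inj_onI)
      fix a b assume "a \<in> carrier ?B" "b \<in> carrier ?B" and eq: "\<phi> a = \<phi> b"
      then have "a \<in> blk r" "b \<in> blk r" by (simp_all add: car)
      then obtain p q where p: "a = h p" "\<forall>s\<in>R - {r}. P s dvd p"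
        and q: "b = h q" "\<forall>s\<in>R - {r}. P s dvd q"
        unfolding blk_def by blast
      have 1: "P r dvd p - q" using eq unfolding p q \<phi> cl_eq_iff .
      show "a = b" unfolding p(1) q(1) h_eq_iff
      proof
        fix s assume "s \<in> R"
        then show "P s dvd p - q" using 1 p(2) q(2) by (cases "s = r") (auto intro: dvd_diff)
      qed
    qed
    show "\<phi> ` carrier ?B = carrier ?T"
    proof
      show "\<phi> ` carrier ?B \<subseteq> carrier ?T"
      proof
        fix x assume "x \<in> \<phi> ` carrier ?B"
        then obtain p where "x = cl p" using rep \<phi> by blast
        then show "x \<in> carrier ?T" by (simp add: cl_def T)
      qed
      show "carrier ?T \<subseteq> \<phi> ` carrier ?B"
      proof
        fix x assume "x \<in> carrier ?T"
        then obtain q where q: "x = ?I +>\<^bsub>poly_alg\<^esub> q" by (auto simp: T)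
        define p where "p = pcompose q [:-r, 1:]"
        have "pcompose p [:r, 1:] = q"
          unfolding p_def by (simp flip: pcompose_assoc) (simp add: pcompose_pCons)
        then have x: "x = cl p" by (simp add: cl_def q)
        have "P r dvd (idem r - 1) * p"
          using idem(2) [of r] by (subst (asm) dvd_diff_commute) (rule dvd_mult2)
        then have "cl (idem r * p) = cl p" by (simp only: cl_eq_iff left_diff_distrib mult_1)
        moreover have "h (idem r * p) \<in> carrier ?B"
          unfolding car h_in_blk_iff using idem(1) by (intro ballI dvd_mult2)
        ultimately show "x \<in> \<phi> ` carrier ?B" using x \<phi> by (metis imageI)
      qed
    qed
  qed
  moreover have "\<phi> (c \<odot>\<^bsub>?B\<^esub> a) = c \<odot>\<^bsub>?T\<^esub> \<phi> a" if "a \<in> carrier ?B" for c a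
  proof -
    from rep [OF \<open>a \<in> carrier ?B\<close>] obtain p where p: "a = h p" by blast
    have "\<phi> (c \<odot>\<^bsub>?B\<^esub> a) = \<phi> (h (Polynomial.smult c p))" by (simp add: block_alg_def p h_smult)
    also have "\<dots> = c \<odot>\<^bsub>?T\<^esub> \<phi> a"
      unfolding \<phi> p by (simp add: cl_def T pcompose_smult)
    finally show ?thesis .
  qed
  ultimately have "\<phi> \<in> alg_iso ?B ?T" by (simp add: alg_iso_def ring_iso_def)
  then show ?thesis unfolding alg_isomorphic_def by blast
qed

end

text \<open>Outside the locale, since a dimension needs a vector space structure on the whole type.
  The powers of \<open>x - r\<close> below \<open>m r\<close>, times \<open>idem r\<close>, give a
  basis; the coordinates are Taylor coefficients at \<open>r\<close>.\<close>

lemma dim_blk: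
  fixes A :: "('f::field, 'a::ab_group_add) module"
  assumes "poly_image A h R m" and "vector_space sc"
    and sc: "\<And>c a. c \<odot>\<^bsub>A\<^esub> a = sc c a" and add: "\<And>a b. a \<oplus>\<^bsub>A\<^esub> b = a + b"
    and zero: "\<zero>\<^bsub>A\<^esub> = 0" and r: "r \<in> R"
  shows "vector_space.dim sc (poly_image.blk h R m r) = m r"
proof -
  interpret poly_image A h R m by fact
  interpret V: vector_space sc by fact
  define b where "b i = h (idem r * [:-r, 1:] ^ i)" for i
  have b_eq_iff: "h (idem r * p) = h (idem r * q) \<longleftrightarrow>
      (\<forall>i<m r. coeff (pcompose p [:r, 1:]) i = coeff (pcompose q [:r, 1:]) i)" for p q
  proof -
    have "h (idem r * p) = h (idem r * q) \<longleftrightarrow> P r dvd idem r * p - idem r * q"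
      unfolding h_eq_iff
    proof (intro iffI ballI)
      fix s assume "P r dvd idem r * p - idem r * q" "s \<in> R"
      then show "P s dvd idem r * p - idem r * q"
        using idem(1) [of s r] by (cases "s = r") (auto intro: dvd_diff)
    qed (use r in blast)
    also have "\<dots> \<longleftrightarrow> P r dvd p - q"
    proof -
      have 1: "P r dvd (1 - idem r) * (p - q)" using idem(2) by (rule dvd_mult2)
      have 2: "(idem r * p - idem r * q) + (1 - idem r) * (p - q) = p - q"
        and 3: "(p - q) - (1 - idem r) * (p - q) = idem r * p - idem r * q"
        by (simp_all add: algebra_simps)
      show ?thesis using dvd_add [OF _ 1] dvd_diff [OF _ 1] 2 3 by metis
    qed
    also have "\<dots> \<longleftrightarrow> monom 1 (m r) dvd pcompose (p - q) [:r, 1:]"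
      by (simp add: monom_dvd_pcompose_iff)
    finally show ?thesis by (simp add: monom_1_dvd_iff' pcompose_diff)
  qed
  have pc: "pcompose ([:-r, 1:] ^ i) [:r, 1:] = monom 1 i" for i
    by (simp add: pcompose_power pcompose_pCons monom_altdef)
  have pcs: "coeff (pcompose (\<Sum>i<m r. Polynomial.smult (c i) ([:-r, 1:] ^ i)) [:r, 1:]) j = c j"
    if "j < m r" for c j
    using that by (simp add: pcompose_sum pcompose_smult pc coeff_sum if_distrib [where f = "(*) x" for x] cong: if_cong)
  have lin: "(\<Sum>i<m r. sc (c i) (b i)) = h (idem r * (\<Sum>i<m r. Polynomial.smult (c i) ([:-r, 1:] ^ i)))"
    for c
  proof -
    have hs: "h (\<Sum>i\<in>K. p i) = (\<Sum>i\<in>K. h (p i))" if "finite K" for K :: "nat set" and p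
      using that by (induction K rule: finite_induct) (simp_all add: h_zero zero h_add add)
    show ?thesis
      by (simp add: sum_distrib_left hs b_def h_smult sc)
  qed
  have inj: "inj_on b {..<m r}"
  proof (rule inj_onI)
    fix i j assume ij: "i \<in> {..<m r}" "j \<in> {..<m r}" "b i = b j"
    then have "coeff (monom (1 :: 'f) i) i = coeff (monom (1 :: 'f) j) i"
      unfolding b_def b_eq_iff pc by blast
    then show "i = j" by (simp split: if_splits)
  qed
  have "V.independent (b ` {..<m r})"
  proof (rule V.independent_if_scalars_zero)
    fix f x assume 0: "(\<Sum>x\<in>b ` {..<m r}. sc (f x) x) = 0" and x: "x \<in> b ` {..<m r}"
    then obtain j where j: "x = b j" "j < m r" by blast
    have "(\<Sum>i<m r. sc (f (b i)) (b i)) = 0" using 0 inj by (simp add: sum.reindex)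
    then have "h (idem r * (\<Sum>i<m r. Polynomial.smult (f (b i)) ([:-r, 1:] ^ i))) = h (idem r * 0)"
      unfolding lin by (simp add: h_zero zero)
    then have "f (b j) = 0" unfolding b_eq_iff using j(2) pcs [of j "\<lambda>i. f (b i)"] by simp
    then show "f x = 0" using j(1) by simp
  qed simp
  moreover have "V.span (b ` {..<m r}) = V.span (blk r)"
  proof (rule antisym)
    have "b ` {..<m r} \<subseteq> blk r"
      by (auto simp: b_def h_in_blk_iff intro!: dvd_mult2 idem(1))
    then show "V.span (b ` {..<m r}) \<subseteq> V.span (blk r)" by (rule V.span_mono)
    have "blk r \<subseteq> V.span (b ` {..<m r})"
    proof
      fix a assume a: "a \<in> blk r"
      then obtain p where p: "a = h p" by (auto simp: blk_def)
      define c where "c i = coeff (pcompose p [:r, 1:]) i" for i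
      have "a = h (idem r * p)" using h_idem_mult [OF a] by (simp add: h_mult p)
      also have "\<dots> = h (idem r * (\<Sum>i<m r. Polynomial.smult (c i) ([:-r, 1:] ^ i)))"
        unfolding b_eq_iff by (simp add: pcs c_def)
      also have "\<dots> = (\<Sum>i<m r. sc (c i) (b i))" by (rule lin [symmetric])
      also have "\<dots> \<in> V.span (b ` {..<m r})"
        by (intro V.span_sum V.span_scale V.span_base) simp
      finally show "a \<in> V.span (b ` {..<m r})" .
    qed
    then show "V.span (blk r) \<subseteq> V.span (b ` {..<m r})"
      using V.span_minimal V.subspace_span by blast
  qed
  ultimately have "V.dim (blk r) = card (b ` {..<m r})"
    by (intro V.dim_eq_card)
  then show ?thesis using inj by (simp add: card_image)
qed

section \<open>Preliminaries on transpositions, sums of functions and permutations\<close>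

abbreviation tp :: "nat \<Rightarrow> nat \<Rightarrow> nat \<Rightarrow> nat" where
  "tp \<equiv> Transposition.transpose"

lemma sum_fun_apply: "(\<Sum>x\<in>A. f x) y = (\<Sum>x\<in>A. f x y)"
  for f :: "'a \<Rightarrow> 'b \<Rightarrow> 'c::comm_monoid_add"
  by (induction A rule: infinite_finite_induct) (simp_all add: zero_fun_def plus_fun_def)

lemma two_neq_zero:
  assumes "CHAR('f::field) \<noteq> 2"
  shows "(2 :: 'f) \<noteq> 0"
proof
  assume "(2 :: 'f) = 0"
  then have "of_nat 2 = (0 :: 'f)" by simp
  then have "CHAR('f) dvd 2" unfolding of_nat_eq_0_iff_char_dvd .
  then have "CHAR('f) \<le> 2" by (rule dvd_imp_le) simp
  moreover have "CHAR('f) \<noteq> 0"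
  proof
    assume "CHAR('f) = 0"
    then show False using \<open>CHAR('f) dvd 2\<close> by simp
  qed
  moreover have "CHAR('f) \<noteq> 1"
  proof
    assume "CHAR('f) = 1"
    then have "of_nat 1 = (0 :: 'f)" using of_nat_CHAR [where 'a = 'f] by simp
    then show False by simp
  qed
  ultimately show False using assms by linarith
qed

lemma transpose_conj:
  assumes "inj \<pi>"
  shows "tp (\<pi> x) (\<pi> y) \<circ> \<pi> = \<pi> \<circ> tp x y"
  using injD [OF assms] by (auto simp: fun_eq_iff Transposition.transpose_def)

text \<open>An injective self-map of a finite fibre is onto. This turns the setwise conditions
  defining row and column stabilizers into conditions on single entries.\<close>

lemma permutes_fibers_iff:
  assumes "\<pi> permutes S" "finite S"
  shows "(\<forall>i. \<pi> ` {y \<in> S. g y = i} = {y \<in> S. g y = i}) \<longleftrightarrow> (\<forall>y\<in>S. g (\<pi> y) = g y)"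
proof
  assume *: "\<forall>i. \<pi> ` {y \<in> S. g y = i} = {y \<in> S. g y = i}"
  show "\<forall>y\<in>S. g (\<pi> y) = g y"
  proof
    fix y assume "y \<in> S"
    then have "\<pi> y \<in> \<pi> ` {z \<in> S. g z = g y}" by blast
    then show "g (\<pi> y) = g y" unfolding * [rule_format] by blast
  qed
next
  assume *: "\<forall>y\<in>S. g (\<pi> y) = g y"
  show "\<forall>i. \<pi> ` {y \<in> S. g y = i} = {y \<in> S. g y = i}"
  proof (intro allI endo_inj_surj)
    fix i
    show "finite {y \<in> S. g y = i}" using assms by simp
    show "\<pi> ` {y \<in> S. g y = i} \<subseteq> {y \<in> S. g y = i}"
      using * permutes_in_image [OF assms(1)] by auto
    show "inj_on \<pi> {y \<in> S. g y = i}" using permutes_inj [OF assms(1)] by (rule inj_on_subset) simp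
  qed
qed

section \<open>The shape and the lengths of its rows and columns\<close>

locale specht_shape =
  fixes lam :: "nat list" and n :: nat
  assumes partition: "partition_of (Suc n) lam"
begin

abbreviation D :: "(nat \<times> nat) set" where "D \<equiv> young_diagram lam"
definition S :: "nat set" where "S = {1..Suc n}"
abbreviation T :: "tableau set" where "T \<equiv> tableaux lam"

definition row_len :: "nat \<Rightarrow> nat" where "row_len i = (if i < length lam then lam ! i else 0)"
definition col_len :: "nat \<Rightarrow> nat" where "col_len j = card {i. j < row_len i}"

lemma sum_lam: "sum_list lam = Suc n"
  using partition by (simp add: partition_of_def)

lemma S_eq: "{1..sum_list lam} = S"
  by (simp add: S_def sum_lam)

lemma finite_S [simp]: "finite S"
  by (simp add: S_def)

lemma last_in_S [simp]: "Suc n \<in> S"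
  by (simp add: S_def)

lemma zero_notin_S [simp]: "0 \<notin> S"
  by (simp add: S_def)

lemma in_D_iff: "(i, j) \<in> D \<longleftrightarrow> j < row_len i"
  by (auto simp: young_diagram_def row_len_def)

lemma row_len_mono: "i \<le> i' \<Longrightarrow> row_len i' \<le> row_len i"
  using partition unfolding partition_of_def row_len_def sorted_wrt_iff_nth_less
  by (cases "i = i'") auto

text \<open>The rows that meet column \<open>j\<close> form an initial segment, which is determined
  by its cardinality.\<close>

lemma in_D_iff_col: "(i, j) \<in> D \<longleftrightarrow> i < col_len j"
proof -
  let ?A = "{i. j < row_len i}"
  have "?A \<subseteq> {..<length lam}" by (auto simp: row_len_def split: if_splits)
  then have fin: "finite ?A" by (rule finite_subset) simp
  have down: "i \<in> ?A \<Longrightarrow> i' \<le> i \<Longrightarrow> i' \<in> ?A" for i i'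
    using row_len_mono [of i' i] by simp
  have "?A = {..<card ?A}"
  proof (rule card_subset_eq [symmetric])
    show "finite ?A" by (rule fin)
    show "{..<card ?A} \<subseteq> ?A"
    proof
      fix i assume i: "i \<in> {..<card ?A}"
      show "i \<in> ?A"
      proof (rule ccontr)
        assume "i \<notin> ?A"
        then have "?A \<subseteq> {..<i}" using down by (metis lessThan_iff not_less subsetI)
        then have "card ?A \<le> i" using card_mono [of "{..<i}" ?A] by simp
        then show False using i by simp
      qed
    qed
  qed simp
  then show ?thesis unfolding in_D_iff col_len_def by blast
qed

lemma less_row_len_iff: "j < row_len i \<longleftrightarrow> i < col_len j"
  using in_D_iff in_D_iff_col by blast

lemma col_len_mono: "j \<le> j' \<Longrightarrow> col_len j' \<le> col_len j"
  by (metis less_row_len_iff le_less_trans not_less order_refl)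

lemma D_Sigma: "D = Sigma {..<length lam} (\<lambda>i. {..<row_len i})"
  by (auto simp: young_diagram_def row_len_def)

lemma finite_D: "finite D"
  unfolding D_Sigma by simp

lemma card_D: "card D = Suc n"
proof -
  have "card D = (\<Sum>i<length lam. row_len i)" unfolding D_Sigma by simp
  also have "\<dots> = sum_list lam" by (simp add: sum_list_sum_nth row_len_def atLeast0LessThan)
  finally show ?thesis by (simp add: sum_lam)
qed

section \<open>Tableaux\<close>

text \<open>A tableau is inverted and described by the row and column of each entry. Tabloids then
  depend on \<open>rw\<close> alone and column stabilizers on \<open>cl\<close> alone, which is why
  these functions largely replace the tableaux below.\<close>

definition cell :: "tableau \<Rightarrow> nat \<Rightarrow> nat \<times> nat" where "cell t = inv_into D t"
definition rw :: "tableau \<Rightarrow> nat \<Rightarrow> nat" where "rw t x = fst (cell t x)"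
definition cl :: "tableau \<Rightarrow> nat \<Rightarrow> nat" where "cl t x = snd (cell t x)"

lemma tableau_bij: "t \<in> T \<Longrightarrow> bij_betw t D S"
  unfolding tableaux_def S_eq by blast

lemma tableau_off: "t \<in> T \<Longrightarrow> c \<notin> D \<Longrightarrow> t c = 0"
  unfolding tableaux_def by blast

lemma cell_bij: "t \<in> T \<Longrightarrow> bij_betw (cell t) S D"
  unfolding cell_def by (rule bij_betw_inv_into [OF tableau_bij])

lemma cell_eq: "cell t x = (rw t x, cl t x)"
  by (simp add: rw_def cl_def)

lemma cell_tab: "t \<in> T \<Longrightarrow> c \<in> D \<Longrightarrow> cell t (t c) = c"
  unfolding cell_def using tableau_bij bij_betw_inv_into_left by metis

lemma tab_cell: "t \<in> T \<Longrightarrow> x \<in> S \<Longrightarrow> t (cell t x) = x"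
  unfolding cell_def using tableau_bij bij_betw_inv_into_right by metis

lemma cell_in_D: "t \<in> T \<Longrightarrow> x \<in> S \<Longrightarrow> (rw t x, cl t x) \<in> D"
  using cell_bij bij_betwE cell_eq by metis

lemma cl_less: "t \<in> T \<Longrightarrow> x \<in> S \<Longrightarrow> cl t x < row_len (rw t x)"
  using cell_in_D in_D_iff by blast

lemma tableau_ext:
  assumes "t \<in> T" "s \<in> T" "\<And>x. x \<in> S \<Longrightarrow> rw t x = rw s x" "\<And>x. x \<in> S \<Longrightarrow> cl t x = cl s x"
  shows "t = s"
proof
  fix c show "t c = s c"
  proof (cases "c \<in> D")
    case True
    then have "t c \<in> S" using assms(1) tableau_bij bij_betwE by blast
    then have "cell s (t c) = cell t (t c)" using assms(3,4) cell_eq by simp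
    also have "\<dots> = c" using cell_tab assms(1) True by blast
    finally have "s (cell s (t c)) = s c" by simp
    then show ?thesis using tab_cell [OF assms(2) \<open>t c \<in> S\<close>] by simp
  qed (use tableau_off [OF assms(1)] tableau_off [OF assms(2)] in simp)
qed

lemma tableau_of_cells:
  assumes "bij_betw q S D"
  obtains t where "t \<in> T" "\<And>x. x \<in> S \<Longrightarrow> (rw t x, cl t x) = q x"
proof -
  define t where "t c = (if c \<in> D then inv_into S q c else 0)" for c
  have "bij_betw (inv_into S q) D S" using assms by (rule bij_betw_inv_into)
  then have "bij_betw t D S"
    using bij_betw_cong [of D t "inv_into S q" S] by (simp add: t_def)
  then have t: "t \<in> T" unfolding tableaux_def S_eq by (simp add: t_def)
  have "cell t x = q x" if "x \<in> S" for x
  proof -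
    have "q x \<in> D" using assms that bij_betwE by blast
    then have "t (q x) = x" using assms that by (simp add: t_def bij_betw_inv_into_left)
    then show ?thesis using cell_tab [OF t \<open>q x \<in> D\<close>] by simp
  qed
  then show thesis using that t cell_eq by metis
qed

lemma tableaux_nonempty: "T \<noteq> {}"
proof -
  have "\<exists>q. bij_betw q S D"
    by (rule finite_same_card_bij) (simp_all add: finite_D card_D S_def)
  then obtain q where "bij_betw q S D" by blast
  then show ?thesis by (rule tableau_of_cells) auto
qed

lemma perm_tableau:
  assumes "\<pi> permutes S" "t \<in> T"
  shows "\<pi> \<circ> t \<in> T"
proof -
  have "bij_betw (\<pi> \<circ> t) D S"
    using tableau_bij [OF assms(2)] permutes_imp_bij [OF assms(1)] by (rule bij_betw_trans)
  moreover have "\<pi> 0 = 0" using assms(1) by (simp add: permutes_def)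
  ultimately show ?thesis using tableau_off [OF assms(2)] unfolding tableaux_def S_eq by simp
qed

lemma cell_perm:
  assumes "\<pi> permutes S" "t \<in> T" "x \<in> S"
  shows "cell (\<pi> \<circ> t) (\<pi> x) = cell t x"
proof -
  have "cell t x \<in> D" using assms cell_bij bij_betwE by blast
  then have "cell (\<pi> \<circ> t) ((\<pi> \<circ> t) (cell t x)) = cell t x"
    using cell_tab [OF perm_tableau [OF assms(1,2)]] by blast
  then show ?thesis using tab_cell [OF assms(2,3)] by simp
qed

lemma rw_perm: "\<pi> permutes S \<Longrightarrow> t \<in> T \<Longrightarrow> x \<in> S \<Longrightarrow> rw (\<pi> \<circ> t) (\<pi> x) = rw t x"
  and cl_perm: "\<pi> permutes S \<Longrightarrow> t \<in> T \<Longrightarrow> x \<in> S \<Longrightarrow> cl (\<pi> \<circ> t) (\<pi> x) = cl t x"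
  by (simp_all add: rw_def cl_def cell_perm)

lemma tp_permutes: "x \<in> S \<Longrightarrow> y \<in> S \<Longrightarrow> tp x y permutes S"
  by (rule permutes_swap_id)

lemma tp_tableau: "x \<in> S \<Longrightarrow> y \<in> S \<Longrightarrow> t \<in> T \<Longrightarrow> tp x y \<circ> t \<in> T"
  by (rule perm_tableau [OF tp_permutes])

lemma tp_in_S: "x \<in> S \<Longrightarrow> y \<in> S \<Longrightarrow> z \<in> S \<Longrightarrow> tp x y z \<in> S"
  using permutes_in_image [OF tp_permutes] by blast

lemma rw_tp:
  assumes "x \<in> S" "y \<in> S" "t \<in> T" "z \<in> S"
  shows "rw (tp x y \<circ> t) z = rw t (tp x y z)"
  using rw_perm [OF tp_permutes [OF assms(1,2)] assms(3) tp_in_S [OF assms(1,2,4)]] by simp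

lemma cl_tp:
  assumes "x \<in> S" "y \<in> S" "t \<in> T" "z \<in> S"
  shows "cl (tp x y \<circ> t) z = cl t (tp x y z)"
  using cl_perm [OF tp_permutes [OF assms(1,2)] assms(3) tp_in_S [OF assms(1,2,4)]] by simp

lemma tp_tp: "tp x y \<circ> (tp x y \<circ> t) = t"
  by (simp add: fun_eq_iff)

lemma perm_between:
  assumes "t \<in> T" "s \<in> T"
  obtains \<pi> where "\<pi> permutes S" "s = \<pi> \<circ> t"
proof -
  define \<pi> where "\<pi> x = (if x \<in> S then s (cell t x) else x)" for x
  have "bij_betw (s \<circ> cell t) S S"
    using cell_bij [OF assms(1)] tableau_bij [OF assms(2)] by (rule bij_betw_trans)
  then have "bij_betw \<pi> S S"
    using bij_betw_cong [of S \<pi> "s \<circ> cell t" S] by (simp add: \<pi>_def)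
  then have "\<pi> permutes S" by (rule bij_imp_permutes) (simp add: \<pi>_def)
  moreover have "s = \<pi> \<circ> t"
  proof
    fix c show "s c = (\<pi> \<circ> t) c"
    proof (cases "c \<in> D")
      case True
      then have "t c \<in> S" using assms(1) tableau_bij bij_betwE by blast
      then show ?thesis using cell_tab [OF assms(1) True] by (simp add: \<pi>_def)
    qed (use tableau_off [OF assms(1)] tableau_off [OF assms(2)] in \<open>simp add: \<pi>_def\<close>)
  qed
  ultimately show thesis by (rule that)
qed

section \<open>Stabilizers and tabloids in terms of coordinates\<close>

lemma tab_image_fibre:
  assumes "t \<in> T"
  shows "t ` {x \<in> D. g x = i} = {y \<in> S. g (cell t y) = i}"
proof
  show "t ` {x \<in> D. g x = i} \<subseteq> {y \<in> S. g (cell t y) = i}"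
  proof
    fix y assume "y \<in> t ` {x \<in> D. g x = i}"
    then obtain x where x: "x \<in> D" "g x = i" "y = t x" by blast
    then have "y \<in> S" using tableau_bij [OF assms] bij_betwE by blast
    then show "y \<in> {y \<in> S. g (cell t y) = i}" using cell_tab [OF assms x(1)] x by simp
  qed
  show "{y \<in> S. g (cell t y) = i} \<subseteq> t ` {x \<in> D. g x = i}"
  proof
    fix y assume y: "y \<in> {y \<in> S. g (cell t y) = i}"
    then have "cell t y \<in> D" using cell_bij [OF assms] bij_betwE by blast
    moreover have "t (cell t y) = y" using y tab_cell [OF assms] by blast
    moreover have "g (cell t y) = i" using y by blast
    ultimately have "t (cell t y) \<in> t ` {x \<in> D. g x = i}" by blast
    then show "y \<in> t ` {x \<in> D. g x = i}" unfolding \<open>t (cell t y) = y\<close> .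
  qed
qed

lemma row_stabilizer_iff:
  assumes "t \<in> T"
  shows "\<pi> \<in> row_stabilizer lam t \<longleftrightarrow> \<pi> permutes S \<and> (\<forall>x\<in>S. rw t (\<pi> x) = rw t x)"
  unfolding row_stabilizer_def tab_image_fibre [OF assms, of fst] S_eq rw_def [symmetric]
  using permutes_fibers_iff [of \<pi> S "rw t"] by auto

lemma column_stabilizer_iff:
  assumes "t \<in> T"
  shows "\<pi> \<in> column_stabilizer lam t \<longleftrightarrow> \<pi> permutes S \<and> (\<forall>x\<in>S. cl t (\<pi> x) = cl t x)"
  unfolding column_stabilizer_def tab_image_fibre [OF assms, of snd] S_eq cl_def [symmetric]
  using permutes_fibers_iff [of \<pi> S "cl t"] by auto

lemma perm_stabilizes_iff:
  assumes "\<pi> permutes S" "t \<in> T"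
  shows "(\<forall>x\<in>S. rw t (\<pi> x) = rw t x) \<longleftrightarrow> (\<forall>x\<in>S. rw (\<pi> \<circ> t) x = rw t x)"
    and "(\<forall>x\<in>S. cl t (\<pi> x) = cl t x) \<longleftrightarrow> (\<forall>x\<in>S. cl (\<pi> \<circ> t) x = cl t x)"
proof -
  have im: "\<pi> ` S = S" using assms(1) by (rule permutes_image)
  have "(\<forall>x\<in>S. rw (\<pi> \<circ> t) x = rw t x) \<longleftrightarrow> (\<forall>x\<in>\<pi> ` S. rw (\<pi> \<circ> t) x = rw t x)"
    unfolding im ..
  then show "(\<forall>x\<in>S. rw t (\<pi> x) = rw t x) \<longleftrightarrow> (\<forall>x\<in>S. rw (\<pi> \<circ> t) x = rw t x)"
    by (auto simp: rw_perm [OF assms])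
  have "(\<forall>x\<in>S. cl (\<pi> \<circ> t) x = cl t x) \<longleftrightarrow> (\<forall>x\<in>\<pi> ` S. cl (\<pi> \<circ> t) x = cl t x)"
    unfolding im ..
  then show "(\<forall>x\<in>S. cl t (\<pi> x) = cl t x) \<longleftrightarrow> (\<forall>x\<in>S. cl (\<pi> \<circ> t) x = cl t x)"
    by (auto simp: cl_perm [OF assms])
qed

lemma tabloid_eq:
  assumes "s \<in> T"
  shows "tabloid lam s = {s' \<in> T. \<forall>x\<in>S. rw s' x = rw s x}"
proof
  show "tabloid lam s \<subseteq> {s' \<in> T. \<forall>x\<in>S. rw s' x = rw s x}"
    using row_stabilizer_iff [OF assms] perm_stabilizes_iff(1) [OF _ assms] perm_tableau [OF _ assms]
    by (auto simp: tabloid_def)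
  show "{s' \<in> T. \<forall>x\<in>S. rw s' x = rw s x} \<subseteq> tabloid lam s"
  proof
    fix s' assume s': "s' \<in> {s' \<in> T. \<forall>x\<in>S. rw s' x = rw s x}"
    then obtain \<pi> where \<pi>: "\<pi> permutes S" "s' = \<pi> \<circ> s" using perm_between [OF assms] by blast
    then have "\<pi> \<in> row_stabilizer lam s"
      using s' row_stabilizer_iff [OF assms] perm_stabilizes_iff(1) [OF \<pi>(1) assms] by blast
    then show "s' \<in> tabloid lam s" using \<pi> by (auto simp: tabloid_def)
  qed
qed

lemma tabloid_eq_iff:
  assumes "s \<in> T" "s' \<in> T"
  shows "tabloid lam s = tabloid lam s' \<longleftrightarrow> (\<forall>x\<in>S. rw s x = rw s' x)"
  unfolding tabloid_eq [OF assms(1)] tabloid_eq [OF assms(2)] using assms by auto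

lemma tabloid_perm_image:
  assumes "\<pi> permutes S" "s \<in> T"
  shows "(\<lambda>u. \<pi> \<circ> u) ` tabloid lam s = tabloid lam (\<pi> \<circ> s)"
proof
  have im: "\<pi> ` S = S" using assms(1) by (rule permutes_image)
  show "(\<lambda>u. \<pi> \<circ> u) ` tabloid lam s \<subseteq> tabloid lam (\<pi> \<circ> s)"
  proof
    fix u assume "u \<in> (\<lambda>u. \<pi> \<circ> u) ` tabloid lam s"
    then obtain v where v: "u = \<pi> \<circ> v" "v \<in> T" "\<forall>x\<in>S. rw v x = rw s x"
      unfolding tabloid_eq [OF assms(2)] by blast
    have "rw u y = rw (\<pi> \<circ> s) y" if "y \<in> S" for y
    proof -
      from that im obtain x where "x \<in> S" "y = \<pi> x" by blast
      then show ?thesis using v rw_perm [OF assms(1)] assms(2) by simp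
    qed
    then show "u \<in> tabloid lam (\<pi> \<circ> s)"
      unfolding tabloid_eq [OF perm_tableau [OF assms]] using v perm_tableau [OF assms(1)] by blast
  qed
  show "tabloid lam (\<pi> \<circ> s) \<subseteq> (\<lambda>u. \<pi> \<circ> u) ` tabloid lam s"
  proof
    fix u assume u: "u \<in> tabloid lam (\<pi> \<circ> s)"
    define v where "v = inv_into UNIV \<pi> \<circ> u"
    have uT: "u \<in> T" using u tabloid_eq [OF perm_tableau [OF assms]] by blast
    then have vT: "v \<in> T"
      unfolding v_def using permutes_inv [OF assms(1)] perm_tableau by blast
    have uv: "u = \<pi> \<circ> v" unfolding v_def using permutes_inverses(1) [OF assms(1)] by (simp add: fun_eq_iff)
    have "rw v x = rw s x" if "x \<in> S" for x
    proof -
      have "\<pi> x \<in> S" using im that by blast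
      then have "rw u (\<pi> x) = rw (\<pi> \<circ> s) (\<pi> x)"
        using u unfolding tabloid_eq [OF perm_tableau [OF assms]] by blast
      then show ?thesis using rw_perm [OF assms(1)] vT assms(2) that uv by simp
    qed
    then have "v \<in> tabloid lam s" unfolding tabloid_eq [OF assms(2)] using vT by blast
    then show "u \<in> (\<lambda>u. \<pi> \<circ> u) ` tabloid lam s" using uv by blast
  qed
qed

section \<open>Coefficients of polytabloids\<close>

lemma perm_act_tabloid:
  assumes "\<pi> permutes S" "s \<in> T"
  shows "perm_act \<pi> v (tabloid lam (\<pi> \<circ> s)) = v (tabloid lam s)"
proof -
  have "inv_into UNIV \<pi> \<circ> (\<pi> \<circ> s) = s"
    using permutes_inverses(2) [OF assms(1)] by (simp add: fun_eq_iff)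
  then show ?thesis
    using tabloid_perm_image [OF permutes_inv [OF assms(1)] perm_tableau [OF assms]]
    by (simp add: perm_act_def)
qed

lemma perm_act_tp_tabloid:
  assumes "x \<in> S" "y \<in> S" "s \<in> T"
  shows "perm_act (tp x y) v (tabloid lam s) = v (tabloid lam (tp x y \<circ> s))"
  using perm_act_tabloid [OF tp_permutes [OF assms(1,2)] tp_tableau [OF assms], of v]
  by (simp add: tp_tp)

lemma finite_column_stabilizer: "t \<in> T \<Longrightarrow> finite (column_stabilizer lam t)"
  by (rule finite_subset [of _ "{\<pi>. \<pi> permutes S}"])
    (auto simp: column_stabilizer_iff intro: finite_permutations)

lemma permutation_S: "\<pi> permutes S \<Longrightarrow> permutation \<pi>"
  using permutation_permutes finite_S by blast

lemma perm_act_sum: "perm_act \<pi> (\<Sum>x\<in>A. f x) = (\<Sum>x\<in>A. perm_act \<pi> (f x))"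
  by (simp add: fun_eq_iff sum_fun_apply perm_act_def)

lemma perm_act_add: "perm_act \<pi> (v + w) = perm_act \<pi> v + perm_act \<pi> w"
  by (simp add: fun_eq_iff perm_act_def)

lemma perm_act_vscale: "perm_act \<pi> (vscale c v) = vscale c (perm_act \<pi> v)"
  by (simp add: fun_eq_iff perm_act_def vscale_def)

lemma column_stabilizer_conj:
  assumes \<sigma>: "\<sigma> permutes S" and t: "t \<in> T" and \<pi>: "\<pi> \<in> column_stabilizer lam t"
  shows "\<sigma> \<circ> \<pi> \<circ> inv_into UNIV \<sigma> \<in> column_stabilizer lam (\<sigma> \<circ> t)"
proof -
  let ?i = "inv_into UNIV \<sigma>"
  have i1: "\<sigma> (?i x) = x" for x using permutes_inverses(1) [OF \<sigma>] .
  have ip: "?i permutes S" using \<sigma> by (rule permutes_inv)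
  have p: "\<pi> permutes S" "\<And>x. x \<in> S \<Longrightarrow> cl t (\<pi> x) = cl t x"
    using \<pi> unfolding column_stabilizer_iff [OF t] by auto
  have "cl (\<sigma> \<circ> t) ((\<sigma> \<circ> \<pi> \<circ> ?i) x) = cl (\<sigma> \<circ> t) x" if "x \<in> S" for x
  proof -
    have y: "?i x \<in> S" using permutes_in_image [OF ip] that by blast
    then have "cl (\<sigma> \<circ> t) (\<sigma> (\<pi> (?i x))) = cl t (\<pi> (?i x))"
      using cl_perm [OF \<sigma> t] permutes_in_image [OF p(1)] by blast
    also have "\<dots> = cl t (?i x)" using p(2) y by blast
    also have "\<dots> = cl (\<sigma> \<circ> t) (\<sigma> (?i x))" using cl_perm [OF \<sigma> t y] by simp
    finally show ?thesis by (simp add: i1)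
  qed
  moreover have "\<sigma> \<circ> \<pi> \<circ> ?i permutes S" using \<sigma> ip p(1) by (intro permutes_compose)
  ultimately show ?thesis unfolding column_stabilizer_iff [OF perm_tableau [OF \<sigma> t]] by blast
qed

text \<open>Conjugation by \<sigma> maps the column stabilizer of \<open>t\<close> onto that of
  \<open>\<sigma> \<circ> t\<close> and preserves signs.\<close>

lemma polytabloid_perm:
  assumes \<sigma>: "\<sigma> permutes S" and t: "t \<in> T"
  shows "perm_act \<sigma> (polytabloid lam t :: 'f::field tabvec) = polytabloid lam (\<sigma> \<circ> t)"
proof -
  let ?i = "inv_into UNIV \<sigma>"
  have i1: "\<sigma> (?i x) = x" and i2: "?i (\<sigma> x) = x" for x
    using permutes_inverses [OF \<sigma>] by auto
  have ip: "?i permutes S" using \<sigma> by (rule permutes_inv)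
  have in2: "?i \<circ> \<rho> \<circ> \<sigma> \<in> column_stabilizer lam t" if "\<rho> \<in> column_stabilizer lam (\<sigma> \<circ> t)" for \<rho>
  proof -
    have "?i \<circ> (\<sigma> \<circ> t) = t" by (simp add: fun_eq_iff i2)
    then show ?thesis
      using column_stabilizer_conj [OF ip perm_tableau [OF \<sigma> t] that]
      unfolding permutes_inv_inv [OF \<sigma>] by simp
  qed
  have sgn: "sign (\<sigma> \<circ> \<pi> \<circ> ?i) = sign \<pi>" if "\<pi> \<in> column_stabilizer lam t" for \<pi>
  proof -
    have "\<pi> permutes S" using that unfolding column_stabilizer_iff [OF t] by auto
    then have "sign (\<sigma> \<circ> \<pi> \<circ> ?i) = sign \<sigma> * sign \<pi> * sign ?i"
      using \<sigma> ip by (simp add: sign_compose permutation_S permutation_compose)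
    then show ?thesis using \<sigma> by (simp add: sign_inverse permutation_S)
  qed
  have "perm_act \<sigma> (polytabloid lam t :: 'f tabvec) = (\<Sum>\<pi>\<in>column_stabilizer lam t.
      vscale (of_int (sign \<pi>)) (basis_vec (tabloid lam (\<sigma> \<circ> (\<pi> \<circ> t)))))"
    unfolding polytabloid_def perm_act_sum perm_act_vscale perm_act_basis_vec [OF permutes_bij [OF \<sigma>]]
  proof (rule sum.cong [OF refl])
    fix \<pi> assume "\<pi> \<in> column_stabilizer lam t"
    then have "\<pi> \<circ> t \<in> T" using perm_tableau [OF _ t] unfolding column_stabilizer_iff [OF t] by blast
    then show "vscale (of_int (sign \<pi>)) (basis_vec ((\<lambda>s. \<sigma> \<circ> s) ` tabloid lam (\<pi> \<circ> t)))
        = (vscale (of_int (sign \<pi>)) (basis_vec (tabloid lam (\<sigma> \<circ> (\<pi> \<circ> t)))) :: 'f tabvec)"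
      using tabloid_perm_image [OF \<sigma>] by simp
  qed
  also have "\<dots> = polytabloid lam (\<sigma> \<circ> t)"
    unfolding polytabloid_def
  proof (rule sum.reindex_bij_witness [where j = "\<lambda>\<pi>. \<sigma> \<circ> \<pi> \<circ> ?i" and i = "\<lambda>\<rho>. ?i \<circ> \<rho> \<circ> \<sigma>"])
    fix \<pi> assume \<pi>: "\<pi> \<in> column_stabilizer lam t"
    show "?i \<circ> (\<sigma> \<circ> \<pi> \<circ> ?i) \<circ> \<sigma> = \<pi>" by (simp add: fun_eq_iff i1 i2)
    show "\<sigma> \<circ> \<pi> \<circ> ?i \<in> column_stabilizer lam (\<sigma> \<circ> t)" using \<sigma> t \<pi> by (rule column_stabilizer_conj)
    have "(\<sigma> \<circ> \<pi> \<circ> ?i) \<circ> (\<sigma> \<circ> t) = \<sigma> \<circ> (\<pi> \<circ> t)" by (simp add: fun_eq_iff i2)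
    then show "vscale (of_int (sign (\<sigma> \<circ> \<pi> \<circ> ?i))) (basis_vec (tabloid lam ((\<sigma> \<circ> \<pi> \<circ> ?i) \<circ> (\<sigma> \<circ> t))))
        = (vscale (of_int (sign \<pi>)) (basis_vec (tabloid lam (\<sigma> \<circ> (\<pi> \<circ> t)))) :: 'f tabvec)"
      using sgn [OF \<pi>] by simp
  next
    fix \<rho> assume \<rho>: "\<rho> \<in> column_stabilizer lam (\<sigma> \<circ> t)"
    show "\<sigma> \<circ> (?i \<circ> \<rho> \<circ> \<sigma>) \<circ> ?i = \<rho>" by (simp add: fun_eq_iff i1 i2)
    show "?i \<circ> \<rho> \<circ> \<sigma> \<in> column_stabilizer lam t" using \<rho> by (rule in2)
  qed
  finally show ?thesis .
qed

lemma column_stabilizer_cong: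
  assumes "t \<in> T" "t' \<in> T" "\<And>x. x \<in> S \<Longrightarrow> cl t x = cl t' x"
  shows "column_stabilizer lam t = column_stabilizer lam t'"
proof -
  have "\<pi> \<in> column_stabilizer lam t \<longleftrightarrow> \<pi> \<in> column_stabilizer lam t'" for \<pi>
    unfolding column_stabilizer_iff [OF assms(1)] column_stabilizer_iff [OF assms(2)]
    using assms(3) permutes_in_image [of \<pi> S] by auto
  then show ?thesis by blast
qed

text \<open>Right multiplication by \<sigma> permutes the column stabilizer and changes all signs by
  that of \<sigma>.\<close>

lemma polytabloid_col:
  assumes t: "t \<in> T" and \<sigma>: "\<sigma> \<in> column_stabilizer lam t"
  shows "polytabloid lam (\<sigma> \<circ> t) = (vscale (of_int (sign \<sigma>)) (polytabloid lam t) :: 'f::field tabvec)"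
proof -
  let ?i = "inv_into UNIV \<sigma>"
  have \<sigma>': "\<sigma> permutes S" "\<And>x. x \<in> S \<Longrightarrow> cl t (\<sigma> x) = cl t x"
    using \<sigma> unfolding column_stabilizer_iff [OF t] by auto
  have i1: "\<sigma> (?i x) = x" and i2: "?i (\<sigma> x) = x" for x
    using permutes_inverses [OF \<sigma>'(1)] by auto
  have ip: "?i permutes S" using \<sigma>'(1) by (rule permutes_inv)
  have st: "\<sigma> \<circ> t \<in> T" using \<sigma>'(1) t by (rule perm_tableau)
  have "cl (\<sigma> \<circ> t) x = cl t x" if "x \<in> S" for x
    using perm_stabilizes_iff(2) [OF \<sigma>'(1) t] \<sigma>'(2) that by blast
  then have cs: "column_stabilizer lam (\<sigma> \<circ> t) = column_stabilizer lam t"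
    using column_stabilizer_cong [OF st t] by blast
  have icol: "cl t (?i x) = cl t x" if "x \<in> S" for x
    using \<sigma>'(2) [of "?i x"] permutes_in_image [OF ip] that i1 by auto
  have "polytabloid lam (\<sigma> \<circ> t) = (\<Sum>\<pi>\<in>column_stabilizer lam t.
      vscale (of_int (sign \<sigma> * sign \<pi>)) (basis_vec (tabloid lam (\<pi> \<circ> t))) :: 'f tabvec)"
    unfolding polytabloid_def cs
  proof (rule sum.reindex_bij_witness [where j = "\<lambda>\<pi>. \<pi> \<circ> \<sigma>" and i = "\<lambda>\<rho>. \<rho> \<circ> ?i"])
    fix \<pi> assume "\<pi> \<in> column_stabilizer lam t"
    then have \<pi>: "\<pi> permutes S" "\<And>x. x \<in> S \<Longrightarrow> cl t (\<pi> x) = cl t x"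
      unfolding column_stabilizer_iff [OF t] by auto
    show "\<pi> \<circ> \<sigma> \<circ> ?i = \<pi>" by (simp add: fun_eq_iff i1)
    have "cl t ((\<pi> \<circ> \<sigma>) x) = cl t x" if "x \<in> S" for x
      using \<pi>(2) \<sigma>'(2) permutes_in_image [OF \<sigma>'(1)] that by simp
    then show "\<pi> \<circ> \<sigma> \<in> column_stabilizer lam t"
      unfolding column_stabilizer_iff [OF t] using permutes_compose [OF \<sigma>'(1) \<pi>(1)] by blast
    have "sign \<sigma> * sign (\<pi> \<circ> \<sigma>) = sign \<pi>"
      using \<pi>(1) \<sigma>'(1) by (simp add: sign_compose permutation_S)
    then show "vscale (of_int (sign \<sigma> * sign (\<pi> \<circ> \<sigma>))) (basis_vec (tabloid lam (\<pi> \<circ> \<sigma> \<circ> t)))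
        = (vscale (of_int (sign \<pi>)) (basis_vec (tabloid lam (\<pi> \<circ> (\<sigma> \<circ> t)))) :: 'f tabvec)"
      by (simp only: o_assoc)
  next
    fix \<rho> assume "\<rho> \<in> column_stabilizer lam t"
    then have \<rho>: "\<rho> permutes S" "\<And>x. x \<in> S \<Longrightarrow> cl t (\<rho> x) = cl t x"
      unfolding column_stabilizer_iff [OF t] by auto
    show "\<rho> \<circ> ?i \<circ> \<sigma> = \<rho>" by (simp add: fun_eq_iff i2)
    have "cl t ((\<rho> \<circ> ?i) x) = cl t x" if "x \<in> S" for x
      using \<rho>(2) icol permutes_in_image [OF ip] that by simp
    then show "\<rho> \<circ> ?i \<in> column_stabilizer lam t"
      unfolding column_stabilizer_iff [OF t] using permutes_compose [OF ip \<rho>(1)] by blast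
  qed
  also have "\<dots> = vscale (of_int (sign \<sigma>)) (polytabloid lam t)"
    unfolding polytabloid_def by (simp add: fun_eq_iff sum_fun_apply vscale_def sum_distrib_left mult.assoc)
  finally show ?thesis .
qed

lemma polytabloid_tp:
  assumes "t \<in> T" "x \<in> S" "y \<in> S" "cl t x = cl t y" "x \<noteq> y"
  shows "polytabloid lam (tp x y \<circ> t) = (- polytabloid lam t :: 'f::field tabvec)"
proof -
  have "cl t (tp x y z) = cl t z" for z
    using assms(4) by (cases "z = x"; cases "z = y") auto
  then have "tp x y \<in> column_stabilizer lam t"
    unfolding column_stabilizer_iff [OF assms(1)] using tp_permutes [OF assms(2,3)] by blast
  from polytabloid_col [OF assms(1) this] show ?thesis
    using assms(5) by (simp add: sign_swap_id vscale_def fun_eq_iff)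
qed

text \<open>The sign is left open on purpose: it is applied where only the vanishing of coefficients
  matters.\<close>

lemma polytabloid_same_columns:
  assumes "t \<in> T" "t' \<in> T" "\<And>x. x \<in> S \<Longrightarrow> cl t x = cl t' x"
  shows "polytabloid lam t' = (polytabloid lam t :: 'f::field tabvec) \<or>
    polytabloid lam t' = (- polytabloid lam t :: 'f tabvec)"
proof -
  obtain \<sigma> where \<sigma>: "\<sigma> permutes S" "t' = \<sigma> \<circ> t" using perm_between [OF assms(1,2)] by blast
  then have "\<sigma> \<in> column_stabilizer lam t"
    using assms perm_stabilizes_iff(2) [OF \<sigma>(1) assms(1)] unfolding column_stabilizer_iff [OF assms(1)]
    by metis
  from polytabloid_col [OF assms(1) this]
  have "polytabloid lam t' = (vscale (of_int (sign \<sigma>)) (polytabloid lam t) :: 'f tabvec)"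
    unfolding \<sigma>(2) .
  moreover have "sign \<sigma> = 1 \<or> sign \<sigma> = - 1" by (simp add: sign_def)
  moreover have "vscale 1 v = v" "vscale (- 1) v = - v" for v :: "'f tabvec"
    by (simp_all add: vscale_def fun_eq_iff)
  ultimately show ?thesis by (elim disjE) simp_all
qed

section \<open>When a polytabloid involves a tabloid\<close>

definition transversal :: "tableau \<Rightarrow> tableau \<Rightarrow> bool" where
  "transversal t s \<longleftrightarrow> inj_on (\<lambda>x. (rw s x, cl t x)) S"

lemma card_cells:
  assumes "t \<in> T"
  shows "card {x \<in> S. Q (cell t x)} = card {c \<in> D. Q c}"
proof (rule bij_betw_same_card [of "cell t"])
  show "bij_betw (cell t) {x \<in> S. Q (cell t x)} {c \<in> D. Q c}"
  proof (rule bij_betw_imageI)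
    show "inj_on (cell t) {x \<in> S. Q (cell t x)}"
      by (rule inj_on_subset [OF bij_betw_imp_inj_on [OF cell_bij [OF assms]]]) blast
    show "cell t ` {x \<in> S. Q (cell t x)} = {c \<in> D. Q c}"
      unfolding bij_betw_imp_surj_on [OF cell_bij [OF assms], symmetric] by auto
  qed
qed

lemma card_row: "s \<in> T \<Longrightarrow> card {x \<in> S. rw s x = i} = row_len i"
proof -
  assume "s \<in> T"
  then have "card {x \<in> S. rw s x = i} = card {c \<in> D. fst c = i}"
    unfolding rw_def by (rule card_cells)
  also have "{c \<in> D. fst c = i} = Pair i ` {..<row_len i}" by (auto simp: in_D_iff)
  finally show ?thesis by (simp add: card_image inj_on_def)
qed

lemma card_col: "t \<in> T \<Longrightarrow> card {x \<in> S. cl t x = j} = col_len j"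
proof -
  assume "t \<in> T"
  then have "card {x \<in> S. cl t x = j} = card {c \<in> D. snd c = j}"
    unfolding cl_def by (rule card_cells)
  also have "{c \<in> D. snd c = j} = (\<lambda>i. (i, j)) ` {..<col_len j}" by (auto simp: in_D_iff_col)
  finally show ?thesis by (simp add: card_image inj_on_def)
qed

text \<open>A 0-1 matrix with the row and column sums of a diagram is the diagram.\<close>

lemma transversal_in_D:
  assumes t: "t \<in> T" and s: "s \<in> T" and tr: "transversal t s" and x: "x \<in> S"
  shows "cl t x < row_len (rw s x)"
proof -
  \<comment> \<open>The entries in the first \<open>k\<close> columns of \<open>t\<close> are
    counted by the rows of \<open>s\<close> and by those of \<open>t\<close>. A row of
    \<open>s\<close> contributes at most what the same row of the diagram does, and the totals
    agree, so all contributions agree. The row of \<open>x\<close> has length \<open>k\<close>,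
    hence lies entirely in the first \<open>k\<close> columns.\<close>
  define k where "k = row_len (rw s x)"
  let ?I = "{..<length lam}"
  have rw_I: "rw s y \<in> ?I" if "y \<in> S" for y
    using cl_less [OF s that] by (auto simp: row_len_def split: if_splits)
  have split: "card {y \<in> S. cl u y < k} = (\<Sum>i\<in>?I. card {y \<in> S. rw v y = i \<and> cl u y < k})"
    if "v \<in> T" for u v
  proof -
    have rw_I: "rw v y \<in> ?I" if "y \<in> S" for y
      using cl_less [OF \<open>v \<in> T\<close> that] by (auto simp: row_len_def split: if_splits)
    have "{y \<in> S. cl u y < k} = (\<Union>i\<in>?I. {y \<in> S. rw v y = i \<and> cl u y < k})"
      using rw_I by blast
    moreover have "card (\<Union>i\<in>?I. {y \<in> S. rw v y = i \<and> cl u y < k}) =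
        (\<Sum>i\<in>?I. card {y \<in> S. rw v y = i \<and> cl u y < k})"
    proof (rule card_UN_disjoint)
      show "\<forall>i\<in>?I. finite {y \<in> S. rw v y = i \<and> cl u y < k}" by simp
      show "\<forall>i\<in>?I. \<forall>j\<in>?I. i \<noteq> j \<longrightarrow>
          {y \<in> S. rw v y = i \<and> cl u y < k} \<inter> {y \<in> S. rw v y = j \<and> cl u y < k} = {}"
        by blast
    qed simp
    ultimately show ?thesis by (rule trans [OF arg_cong])
  qed
  have le: "card {y \<in> S. rw s y = i \<and> cl t y < k} \<le> min (row_len i) k" for i
  proof -
    have "card {y \<in> S. rw s y = i \<and> cl t y < k} \<le> card {y \<in> S. rw s y = i}"
      by (intro card_mono) auto
    moreover have "card {y \<in> S. rw s y = i \<and> cl t y < k} \<le> card {..<k}"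
    proof (rule card_inj_on_le [of "cl t"])
      show "inj_on (cl t) {y \<in> S. rw s y = i \<and> cl t y < k}"
        using tr unfolding transversal_def inj_on_def by blast
    qed auto
    ultimately show ?thesis using card_row [OF s] by simp
  qed
  have "card {y \<in> S. rw t y = i \<and> cl t y < k} = min (row_len i) k" for i
  proof -
    have "card {y \<in> S. rw t y = i \<and> cl t y < k} = card {c \<in> D. fst c = i \<and> snd c < k}"
      unfolding rw_def cl_def by (rule card_cells [OF t])
    also have "{c \<in> D. fst c = i \<and> snd c < k} = Pair i ` {..<min (row_len i) k}"
      by (auto simp: in_D_iff)
    finally show ?thesis by (simp add: card_image inj_on_def)
  qed
  then have "(\<Sum>i\<in>?I. card {y \<in> S. rw s y = i \<and> cl t y < k}) = (\<Sum>i\<in>?I. min (row_len i) k)"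
    using split [OF s, of t] split [OF t, of t] by simp
  then have "card {y \<in> S. rw s y = rw s x \<and> cl t y < k} = min (row_len (rw s x)) k"
    by (rule sum_mono_inv) (use le rw_I x in auto)
  then have "card {y \<in> S. rw s y = rw s x \<and> cl t y < k} = card {y \<in> S. rw s y = rw s x}"
    using card_row [OF s] by (simp add: k_def)
  then have "{y \<in> S. rw s y = rw s x \<and> cl t y < k} = {y \<in> S. rw s y = rw s x}"
    by (intro card_subset_eq) auto
  then show ?thesis using x unfolding k_def by blast
qed

lemma transversal_bij:
  assumes "t \<in> T" "s \<in> T" "transversal t s"
  shows "bij_betw (\<lambda>x. (rw s x, cl t x)) S D"
proof -
  have "(\<lambda>x. (rw s x, cl t x)) ` S \<subseteq> D"
    using transversal_in_D [OF assms] by (auto simp: in_D_iff)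
  moreover have "card ((\<lambda>x. (rw s x, cl t x)) ` S) = card D"
    using assms(3) by (simp add: transversal_def card_image card_D) (simp add: S_def)
  ultimately have "(\<lambda>x. (rw s x, cl t x)) ` S = D"
    using finite_D by (intro card_subset_eq)
  then show ?thesis using assms(3) by (simp add: bij_betw_def transversal_def)
qed

lemma transversal_cell:
  assumes "t \<in> T" "s \<in> T" "transversal t s" "i < col_len j"
  obtains x where "x \<in> S" "rw s x = i" "cl t x = j"
proof -
  have "(i, j) \<in> (\<lambda>x. (rw s x, cl t x)) ` S"
    using transversal_bij [OF assms(1-3)] assms(4) by (simp add: bij_betw_def in_D_iff_col)
  then show thesis using that by blast
qed

abbreviation ecoeff :: "tableau \<Rightarrow> tableau \<Rightarrow> 'f::field" where
  "ecoeff t s \<equiv> polytabloid lam t (tabloid lam s)"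

lemma ecoeff_sum:
  assumes t: "t \<in> T" and s: "s \<in> T"
  shows "(ecoeff t s :: 'f::field) =
    (\<Sum>\<pi>\<in>{\<pi> \<in> column_stabilizer lam t. \<forall>x\<in>S. rw (\<pi> \<circ> t) x = rw s x}. of_int (sign \<pi>))"
proof -
  have "(ecoeff t s :: 'f) = (\<Sum>\<pi>\<in>column_stabilizer lam t.
      if \<forall>x\<in>S. rw (\<pi> \<circ> t) x = rw s x then of_int (sign \<pi>) else 0)"
    unfolding polytabloid_def sum_fun_apply
  proof (rule sum.cong [OF refl])
    fix \<pi> assume "\<pi> \<in> column_stabilizer lam t"
    then have "\<pi> \<circ> t \<in> T" using perm_tableau [OF _ t] unfolding column_stabilizer_iff [OF t] by blast
    then have "tabloid lam s = tabloid lam (\<pi> \<circ> t) \<longleftrightarrow> (\<forall>x\<in>S. rw (\<pi> \<circ> t) x = rw s x)"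
      using tabloid_eq_iff [OF s] by auto
    then show "vscale (of_int (sign \<pi>)) (basis_vec (tabloid lam (\<pi> \<circ> t))) (tabloid lam s)
        = (if \<forall>x\<in>S. rw (\<pi> \<circ> t) x = rw s x then of_int (sign \<pi>) else (0::'f))"
      by (simp add: vscale_def basis_vec_def)
  qed
  also have "\<dots> = (\<Sum>\<pi>\<in>{\<pi> \<in> column_stabilizer lam t. \<forall>x\<in>S. rw (\<pi> \<circ> t) x = rw s x}. of_int (sign \<pi>))"
    using finite_column_stabilizer [OF t] by (rule sum.inter_filter [symmetric])
  finally show ?thesis .
qed

text \<open>Exactly one tableau has the rows of \<open>s\<close> and the columns of
  \<open>t\<close>, so exactly one column permutation of \<open>t\<close> contributes.\<close>

lemma ecoeff_transversal:
  assumes t: "t \<in> T" and s: "s \<in> T" and "transversal t s"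
  shows "(ecoeff t s :: 'f::field) = 1 \<or> (ecoeff t s :: 'f) = - 1"
proof -
  let ?K = "{\<pi> \<in> column_stabilizer lam t. \<forall>x\<in>S. rw (\<pi> \<circ> t) x = rw s x}"
  obtain t' where t': "t' \<in> T" "\<And>x. x \<in> S \<Longrightarrow> (rw t' x, cl t' x) = (rw s x, cl t x)"
    using tableau_of_cells [OF transversal_bij [OF assms]] by blast
  obtain \<pi> where \<pi>: "\<pi> permutes S" "t' = \<pi> \<circ> t" using perm_between [OF t t'(1)] by blast
  have "\<forall>x\<in>S. cl (\<pi> \<circ> t) x = cl t x" "\<forall>x\<in>S. rw (\<pi> \<circ> t) x = rw s x"
    using t'(2) unfolding \<pi>(2) by simp_all
  then have "\<pi> \<in> ?K"
    using perm_stabilizes_iff(2) [OF \<pi>(1) t] \<pi>(1) unfolding column_stabilizer_iff [OF t] by blast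
  moreover have "\<rho> = \<pi>" if "\<rho> \<in> ?K" for \<rho>
  proof -
    have \<rho>: "\<rho> permutes S" "\<forall>x\<in>S. cl (\<rho> \<circ> t) x = cl t x" "\<forall>x\<in>S. rw (\<rho> \<circ> t) x = rw s x"
      using that perm_stabilizes_iff(2) [OF _ t] unfolding column_stabilizer_iff [OF t] by auto
    then have eq: "\<rho> \<circ> t = t'"
      using t'(2) by (intro tableau_ext perm_tableau t'(1) t) auto
    show "\<rho> = \<pi>"
    proof
      fix x show "\<rho> x = \<pi> x"
      proof (cases "x \<in> S")
        case True
        then have "(\<rho> \<circ> t) (cell t x) = (\<pi> \<circ> t) (cell t x)" using eq \<pi>(2) by simp
        then show ?thesis using tab_cell [OF t True] by simp
      next
        case False
        then show ?thesis using \<rho>(1) \<pi>(1) by (simp add: permutes_def)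
      qed
    qed
  qed
  ultimately have "?K = {\<pi>}" by blast
  then show ?thesis unfolding ecoeff_sum [OF t s] by (simp add: sign_def)
qed

text \<open>A contributing column permutation would make the pairs (row in \<open>s\<close>, column
  in \<open>t\<close>) the cells of a tableau, which are distinct.\<close>

lemma ecoeff_not_transversal:
  assumes t: "t \<in> T" and s: "s \<in> T" and "\<not> transversal t s"
  shows "(ecoeff t s :: 'f::field) = 0"
proof -
  have "transversal t s" if \<pi>: "\<pi> \<in> column_stabilizer lam t" "\<forall>x\<in>S. rw (\<pi> \<circ> t) x = rw s x" for \<pi>
  proof -
    have p: "\<pi> permutes S" using \<pi> unfolding column_stabilizer_iff [OF t] by blast
    then have "\<forall>x\<in>S. cl (\<pi> \<circ> t) x = cl t x"
      using \<pi> perm_stabilizes_iff(2) [OF p t] unfolding column_stabilizer_iff [OF t] by blast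
    moreover have "inj_on (cell (\<pi> \<circ> t)) S"
      using cell_bij [OF perm_tableau [OF p t]] by (rule bij_betw_imp_inj_on)
    ultimately show ?thesis
      using \<pi>(2) unfolding transversal_def inj_on_def cell_eq by simp
  qed
  then have "{\<pi> \<in> column_stabilizer lam t. \<forall>x\<in>S. rw (\<pi> \<circ> t) x = rw s x} = {}"
    using assms(3) by blast
  then show ?thesis unfolding ecoeff_sum [OF t s] by (simp only: sum.empty)
qed

lemma ecoeff_same_rows:
  assumes "s \<in> T" "s' \<in> T" "\<And>x. x \<in> S \<Longrightarrow> rw s x = rw s' x"
  shows "v (tabloid lam s) = v (tabloid lam s')"
  using tabloid_eq_iff [OF assms(1,2)] assms(3) by simp

lemma ecoeff_tp_left:
  assumes "t \<in> T" "s \<in> T" "x \<in> S" "y \<in> S"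
  shows "(ecoeff (tp x y \<circ> t) s :: 'f::field) = ecoeff t (tp x y \<circ> s)"
  unfolding polytabloid_perm [OF tp_permutes [OF assms(3,4)] assms(1), symmetric]
  by (rule perm_act_tp_tabloid [OF assms(3,4,2)])

lemma ecoeff_tp_col:
  assumes "t \<in> T" "s \<in> T" "x \<in> S" "y \<in> S" "cl t x = cl t y" "x \<noteq> y"
  shows "(ecoeff t (tp x y \<circ> s) :: 'f::field) = - ecoeff t s"
  unfolding ecoeff_tp_left [OF assms(1-4), symmetric] polytabloid_tp [OF assms(1,3-6)] by simp

lemma not_transversalI:
  assumes "x \<in> S" "y \<in> S" "x \<noteq> y" "rw s x = rw s y" "cl t x = cl t y"
  shows "\<not> transversal t s"
  using assms unfolding transversal_def inj_on_def by blast

text \<open>If the left-hand side is nonzero, exactly one summand survives; otherwise none do, or two that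
  cancel. The kernel relation below works in the same way.\<close>

lemma ecoeff_garnir:
  assumes t: "t \<in> T" and s: "s \<in> T" and x: "x \<in> S" and c': "c' \<noteq> cl t x"
    and len: "col_len (cl t x) \<le> col_len c'"
  shows "(ecoeff t s :: 'f::field) = (\<Sum>y\<in>{y \<in> S. cl t y = c'}. ecoeff t (tp x y \<circ> s))"
proof -
  let ?Y = "{y \<in> S. cl t y = c'}"
  have Y: "y \<in> S" "cl t y = c'" "y \<noteq> x" if "y \<in> ?Y" for y using that c' by auto
  have sT: "tp x y \<circ> s \<in> T" if "y \<in> ?Y" for y using tp_tableau [OF x Y(1) [OF that] s] .
  have rws: "rw (tp x y \<circ> s) z = rw s (tp x y z)" if "y \<in> ?Y" "z \<in> S" for y z
    using rw_tp [OF x Y(1) [OF that(1)] s that(2)] .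
  have zero: "(ecoeff t (tp x y \<circ> s) :: 'f) = 0"
    if y: "y \<in> ?Y" "y1 \<in> ?Y" "y2 \<in> ?Y" "y1 \<noteq> y2" "y \<noteq> y1" "y \<noteq> y2" "rw s y1 = rw s y2" for y y1 y2
  proof (rule ecoeff_not_transversal [OF t sT [OF y(1)]])
    have "tp x y y1 = y1" "tp x y y2 = y2" using Y(3) [OF y(2)] Y(3) [OF y(3)] y(5,6) by simp_all
    then have "rw (tp x y \<circ> s) y1 = rw (tp x y \<circ> s) y2"
      using rws [OF y(1) Y(1) [OF y(2)]] rws [OF y(1) Y(1) [OF y(3)]] y(7) by simp
    then show "\<not> transversal t (tp x y \<circ> s)"
      using Y(1,2) [OF y(2)] Y(1,2) [OF y(3)] y(4) by (intro not_transversalI [of y1 y2]) simp_all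
  qed
  show ?thesis
  proof (cases "transversal t s")
    case True
    \<comment> \<open>By the length condition the row of \<open>x\<close> also meets column
      \<open>c'\<close>, in an entry \<open>y\<close>. Exchanging \<open>x\<close> with
      \<open>y\<close> keeps all rows; any other exchange puts two entries of column
      \<open>c'\<close> into one row.\<close>
    have "rw s x < col_len c'"
      using transversal_in_D [OF t s True x] len unfolding less_row_len_iff by simp
    then obtain y where y: "y \<in> S" "rw s y = rw s x" "cl t y = c'"
      by (rule transversal_cell [OF t s True])
    then have yY: "y \<in> ?Y" by blast
    have "(ecoeff t (tp x z \<circ> s) :: 'f) = 0" if z: "z \<in> ?Y - {y}" for z
    proof (rule ecoeff_not_transversal [OF t sT])
      show zY: "z \<in> ?Y" using z by blast
      have "rw (tp x z \<circ> s) z = rw s x" using rws [OF zY Y(1) [OF zY]] by simp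
      moreover have "rw (tp x z \<circ> s) y = rw s y"
        using rws [OF zY y(1)] z Y(3) [OF yY] by simp
      ultimately show "\<not> transversal t (tp x z \<circ> s)"
        using z y by (intro not_transversalI [of z y]) auto
    qed
    then have "(\<Sum>z\<in>?Y. ecoeff t (tp x z \<circ> s) :: 'f) = (\<Sum>z\<in>{y}. ecoeff t (tp x z \<circ> s))"
      using yY by (intro sum.mono_neutral_right ballI) simp_all
    also have "\<dots> = ecoeff t (tp x y \<circ> s)" by simp
    also have "\<dots> = ecoeff t s"
    proof (rule ecoeff_same_rows [OF sT [OF yY] s])
      fix z assume "z \<in> S"
      then have "rw (tp x y \<circ> s) z = rw s (tp x y z)" using rws yY by blast
      also have "\<dots> = rw s z" using y(2) by (cases "z = x"; cases "z = y") auto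
      finally show "rw (tp x y \<circ> s) z = rw s z" .
    qed
    finally show ?thesis by simp
  next
    case False
    then have 0: "(ecoeff t s :: 'f) = 0" using ecoeff_not_transversal t s by blast
    show ?thesis
    proof (cases "\<exists>y\<in>?Y. transversal t (tp x y \<circ> s)")
      case True
      then obtain y where yY: "y \<in> ?Y" and tr: "transversal t (tp x y \<circ> s)" by blast
      let ?s = "tp x y \<circ> s"
      \<comment> \<open>After the exchange with \<open>y\<close> there is an entry \<open>y'\<close>
        of column \<open>c'\<close> in the new row of \<open>x\<close>. The exchange with
        \<open>y'\<close> differs from the one with \<open>y\<close> by a swap of \<open>y\<close>
        and \<open>y'\<close> inside a column of \<open>t\<close>, so the two terms cancel.\<close>
      have "rw ?s x < col_len c'"
        using transversal_in_D [OF t sT [OF yY] tr x] len unfolding less_row_len_iff by simp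
      then obtain y' where y': "y' \<in> S" "rw ?s y' = rw ?s x" "cl t y' = c'"
        by (rule transversal_cell [OF t sT [OF yY] tr])
      then have yY': "y' \<in> ?Y" by blast
      have sx: "rw ?s x = rw s y" using rws [OF yY x] by simp
      have "y' \<noteq> y"
      proof
        assume "y' = y"
        then have "rw s (tp x y y) = rw s (tp x y x)"
          using y'(2) unfolding rws [OF yY Y(1) [OF yY]] rws [OF yY x] by (simp only: rws [OF yY Y(1) [OF yY]])
        then have eq: "rw s x = rw s y" by simp
        have "rw ?s z = rw s z" if "z \<in> S" for z
          unfolding rws [OF yY that] using eq by (simp add: Transposition.transpose_def)
        then have "transversal t s"
          using tr inj_on_cong [of S "\<lambda>z. (rw ?s z, cl t z)" "\<lambda>z. (rw s z, cl t z)"]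
          unfolding transversal_def by blast
        then show False using False by blast
      qed
      have sy': "rw s y' = rw s y"
        using rws [OF yY y'(1)] y'(2) sx \<open>y' \<noteq> y\<close> Y(3) [OF yY'] by simp
      have "ecoeff t (tp x y' \<circ> s) = (ecoeff t (tp y y' \<circ> ?s) :: 'f)"
      proof (rule ecoeff_same_rows [OF sT [OF yY'] tp_tableau])
        fix z assume z: "z \<in> S"
        have "rw (tp y y' \<circ> ?s) z = rw ?s (tp y y' z)"
          using rw_tp [OF Y(1) [OF yY] y'(1) sT [OF yY] z] .
        also have "\<dots> = rw s (tp x y (tp y y' z))"
          using rws [OF yY] tp_in_S [OF Y(1) [OF yY] y'(1) z] by blast
        also have "\<dots> = rw s (tp x y' z)"
          using sy' \<open>y' \<noteq> y\<close> Y(3) [OF yY] Y(3) [OF yY']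
          by (simp add: Transposition.transpose_def)
        finally show "rw (tp x y' \<circ> s) z = rw (tp y y' \<circ> ?s) z"
          using rws [OF yY' z] by simp
      qed (rule Y(1) [OF yY] y'(1) sT [OF yY])+
      also have "\<dots> = - ecoeff t ?s"
        using y' Y(2) [OF yY] \<open>y' \<noteq> y\<close> by (intro ecoeff_tp_col t sT Y(1) yY) simp_all
      finally have neg: "ecoeff t (tp x y' \<circ> s) = (- ecoeff t ?s :: 'f)" .
      have "(ecoeff t (tp x z \<circ> s) :: 'f) = 0" if "z \<in> ?Y - {y, y'}" for z
        using that sy' \<open>y' \<noteq> y\<close> by (intro zero [OF _ yY yY']) auto
      then have "(\<Sum>z\<in>?Y. ecoeff t (tp x z \<circ> s) :: 'f) = (\<Sum>z\<in>{y, y'}. ecoeff t (tp x z \<circ> s))"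
        using yY yY' by (intro sum.mono_neutral_right ballI) simp_all
      also have "\<dots> = ecoeff t ?s + ecoeff t (tp x y' \<circ> s)" using \<open>y' \<noteq> y\<close> by simp
      finally show ?thesis using neg 0 by simp
    next
      case False
      then have "\<forall>y\<in>?Y. (ecoeff t (tp x y \<circ> s) :: 'f) = 0"
        using ecoeff_not_transversal [OF t sT] by blast
      then show ?thesis using 0 by (simp add: sum.neutral)
    qed
  qed
qed

lemma ecoeff_kernel:
  assumes t: "t \<in> T" and s: "s \<in> T" and z: "z \<in> S" and b: "b \<noteq> rw s z"
    and len: "row_len (rw s z) \<le> row_len b"
  shows "(ecoeff t s :: 'f::field) + (\<Sum>y\<in>{y \<in> S. rw s y = b}. ecoeff t (tp y z \<circ> s)) = 0"
proof -
  let ?Y = "{y \<in> S. rw s y = b}"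
  \<comment> \<open>With \<open>z\<close> moved to row \<open>b\<close>, that row consists of
    \<open>W\<close> and is one entry too long; the relation sums over the entry sent back to the
    row of \<open>z\<close>. The term for \<open>z\<close> itself is the coefficient at
    \<open>s\<close>, because \<open>tp z z\<close> is the identity.\<close>
  define W where "W = insert z ?Y"
  let ?s = "\<lambda>y. tp y z \<circ> s"
  have W: "y \<in> S" if "y \<in> W" for y using that z by (auto simp: W_def)
  have sT: "?s y \<in> T" if "y \<in> W" for y using tp_tableau [OF W [OF that] z s] .
  have rws: "rw (?s y) w = (if w = y then rw s z else if w \<in> W then b else rw s w)"
    if "y \<in> W" "w \<in> S" for y w
    using rw_tp [OF W [OF that(1)] z s that(2)] that
    by (cases "w = y"; cases "w = z") (auto simp: W_def)
  have "(ecoeff t s :: 'f) + (\<Sum>y\<in>?Y. ecoeff t (?s y)) = (\<Sum>y\<in>W. ecoeff t (?s y))"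
    using b by (simp add: W_def)
  also have "\<dots> = 0"
  proof (cases "\<exists>y\<in>W. transversal t (?s y)")
    case True
    then obtain y where y: "y \<in> W" and tr: "transversal t (?s y)" by blast
    \<comment> \<open>The length condition gives an entry \<open>y'\<close> of row \<open>b\<close>
      in the column of \<open>y\<close>. Sending back \<open>y'\<close> instead of \<open>y\<close>
      flips the sign; sending back any other entry leaves both in row \<open>b\<close>.\<close>
    have "cl t y < row_len b"
      using transversal_in_D [OF t sT [OF y] tr W [OF y]] rws [OF y W [OF y]] len by simp
    then obtain y' where y': "y' \<in> S" "rw (?s y) y' = b" "cl t y' = cl t y"
      unfolding less_row_len_iff by (rule transversal_cell [OF t sT [OF y] tr])
    have ne: "y' \<noteq> y" using y'(2) rws [OF y W [OF y]] b by auto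
    have W': "y' \<in> W"
      using y' rws [OF y y'(1)] ne by (auto simp: W_def split: if_splits)
    have "ecoeff t (?s y') = (ecoeff t (tp y y' \<circ> ?s y) :: 'f)"
    proof (rule ecoeff_same_rows [OF sT [OF W'] tp_tableau])
      fix w assume w: "w \<in> S"
      have "rw (tp y y' \<circ> ?s y) w = rw (?s y) (tp y y' w)"
        using rw_tp [OF W [OF y] y'(1) sT [OF y] w] .
      also have "\<dots> = (if tp y y' w = y then rw s z else if tp y y' w \<in> W then b else rw s (tp y y' w))"
        using rws [OF y] tp_in_S [OF W [OF y] y'(1) w] by blast
      finally show "rw (?s y') w = rw (tp y y' \<circ> ?s y) w"
        unfolding rws [OF W' w] using ne y W'
        by (cases "w = y"; cases "w = y'") auto
    qed (rule W [OF y] y'(1) sT [OF y])+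
    also have "\<dots> = - ecoeff t (?s y)"
      using y' ne by (intro ecoeff_tp_col t sT W y W') simp_all
    finally have neg: "ecoeff t (?s y') = (- ecoeff t (?s y) :: 'f)" .
    have "(ecoeff t (?s w) :: 'f) = 0" if w: "w \<in> W - {y, y'}" for w
    proof (rule ecoeff_not_transversal [OF t sT])
      have "rw (?s w) y = b" "rw (?s w) y' = b"
        using rws [of w y] rws [of w y'] w y W' W y' by (auto split: if_splits)
      then show "\<not> transversal t (?s w)"
        using y' ne W [OF y] by (intro not_transversalI [of y y']) auto
    qed (use w in blast)
    then have "(\<Sum>w\<in>W. ecoeff t (?s w) :: 'f) = (\<Sum>w\<in>{y, y'}. ecoeff t (?s w))"
      using y W' by (intro sum.mono_neutral_right) (auto simp: W_def)
    also have "\<dots> = ecoeff t (?s y) + ecoeff t (?s y')" using ne by simp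
    finally show ?thesis using neg by simp
  next
    case False
    then show ?thesis using ecoeff_not_transversal [OF t sT] by (intro sum.neutral) blast
  qed
  finally show ?thesis .
qed

section \<open>The Specht module as a space of functions on tabloids\<close>

lemma polytabloid_in_specht: "t \<in> T \<Longrightarrow> polytabloid lam t \<in> specht lam"
  unfolding specht_def by (intro tabvec.span_base imageI)

lemma specht_subspace: "tabvec.subspace (specht lam :: 'f::field tabvec set)"
  unfolding specht_def by (rule tabvec.subspace_span)

lemma specht_induct [consumes 1, case_names zero add scale base]:
  assumes "v \<in> (specht lam :: 'f::field tabvec set)"
    and "Q 0" "\<And>v w. Q v \<Longrightarrow> Q w \<Longrightarrow> Q (v + w)" "\<And>c v. Q v \<Longrightarrow> Q (vscale c v)"
    and "\<And>t. t \<in> T \<Longrightarrow> Q (polytabloid lam t)"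
  shows "Q v"
proof (rule tabvec.span_induct [OF assms(1) [unfolded specht_def]])
  show "tabvec.subspace (Collect Q)"
    using assms(2-4) by (simp add: tabvec.subspace_def)
qed (use assms(5) in blast)

lemma specht_support:
  assumes "v \<in> (specht lam :: 'f::field tabvec set)" "Q \<notin> tabloid lam ` T"
  shows "v Q = 0"
  using assms(1)
proof (induction rule: specht_induct)
  case (base t)
  have "basis_vec (tabloid lam (\<pi> \<circ> t)) Q = (0 :: 'f)" if "\<pi> \<in> column_stabilizer lam t" for \<pi>
  proof -
    have "\<pi> \<circ> t \<in> T"
      using that perm_tableau [OF _ base] unfolding column_stabilizer_iff [OF base] by blast
    then show ?thesis using assms(2) by (auto simp: basis_vec_def)
  qed
  then show ?case by (simp add: polytabloid_def sum_fun_apply vscale_def)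
qed (simp_all add: vscale_def)

lemma specht_eqI:
  assumes "v \<in> (specht lam :: 'f::field tabvec set)" "w \<in> specht lam"
    "\<And>s. s \<in> T \<Longrightarrow> v (tabloid lam s) = w (tabloid lam s)"
  shows "v = w"
proof
  fix Q show "v Q = w Q"
    using assms(3) specht_support [OF assms(1), of Q] specht_support [OF assms(2), of Q]
    by (cases "Q \<in> tabloid lam ` T") auto
qed

lemma specht_perm_act:
  assumes "v \<in> (specht lam :: 'f::field tabvec set)" "\<pi> permutes S"
  shows "perm_act \<pi> v \<in> specht lam"
  using assms(1)
proof (induction rule: specht_induct)
  case zero
  have "perm_act \<pi> (0 :: 'f tabvec) = 0" by (simp add: perm_act_def fun_eq_iff)
  then show "perm_act \<pi> (0 :: 'f tabvec) \<in> specht lam"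
    using tabvec.subspace_0 [OF specht_subspace] by simp
next
  case (add v w)
  then show ?case unfolding perm_act_add by (rule tabvec.subspace_add [OF specht_subspace])
next
  case (scale c v)
  then show ?case unfolding perm_act_vscale by (rule tabvec.subspace_scale [OF specht_subspace])
next
  case (base t)
  then show ?case unfolding polytabloid_perm [OF assms(2) base]
    using perm_tableau [OF assms(2)] by (intro polytabloid_in_specht)
qed

text \<open>A version of the easy inclusion in James's kernel intersection theorem, for a single
  moved entry; both sides are linear, so polytabloids suffice.\<close>

lemma specht_kernel:
  assumes v: "v \<in> (specht lam :: 'f::field tabvec set)" and s: "s \<in> T" and z: "z \<in> S"
    and b: "b \<noteq> rw s z" and len: "row_len (rw s z) \<le> row_len b"
  shows "v (tabloid lam s) + (\<Sum>y\<in>{y \<in> S. rw s y = b}. v (tabloid lam (tp y z \<circ> s))) = 0"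
proof -
  define F where "F v = v (tabloid lam s) + (\<Sum>y\<in>{y \<in> S. rw s y = b}. v (tabloid lam (tp y z \<circ> s)))"
    for v :: "'f tabvec"
  have add: "F (v + w) = F v + F w" for v w by (simp add: F_def sum.distrib)
  have scale: "F (vscale c v) = c * F v" for c v
    by (simp add: F_def vscale_def sum_distrib_left distrib_left)
  have zero: "F 0 = 0" by (simp add: F_def)
  have base: "F (polytabloid lam t) = 0" if "t \<in> T" for t
    unfolding F_def by (rule ecoeff_kernel [OF that s z b len])
  have "F v = 0"
    by (rule specht_induct [OF v, of "\<lambda>v. F v = 0"]) (simp_all add: add scale zero base)
  then show ?thesis unfolding F_def .
qed

text \<open>The Garnir relation of the single entry \<open>x\<close> and all of column
  \<open>c'\<close>: together they are more entries than either of the two columns can hold.\<close>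

lemma polytabloid_garnir:
  assumes t: "t \<in> T" and x: "x \<in> S" and c': "c' \<noteq> cl t x"
    and len: "col_len (cl t x) \<le> col_len c'"
  shows "(polytabloid lam t :: 'f::field tabvec) = (\<Sum>y\<in>{y \<in> S. cl t y = c'}. polytabloid lam (tp x y \<circ> t))"
proof (rule specht_eqI)
  show "polytabloid lam t \<in> (specht lam :: 'f tabvec set)" using t by (rule polytabloid_in_specht)
  show "(\<Sum>y\<in>{y \<in> S. cl t y = c'}. polytabloid lam (tp x y \<circ> t)) \<in> (specht lam :: 'f tabvec set)"
    using t x by (intro tabvec.subspace_sum [OF specht_subspace] polytabloid_in_specht tp_tableau) auto
  fix s assume s: "s \<in> T"
  have "(ecoeff t s :: 'f) = (\<Sum>y\<in>{y \<in> S. cl t y = c'}. ecoeff t (tp x y \<circ> s))"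
    by (rule ecoeff_garnir [OF t s x c' len])
  also have "\<dots> = (\<Sum>y\<in>{y \<in> S. cl t y = c'}. ecoeff (tp x y \<circ> t) s)"
    by (intro sum.cong refl ecoeff_tp_left [OF t s x, symmetric]) simp
  finally show "ecoeff t s = (\<Sum>y\<in>{y \<in> S. cl t y = c'}. polytabloid lam (tp x y \<circ> t) :: 'f tabvec) (tabloid lam s)"
    by (simp only: sum_fun_apply)
qed

section \<open>Corners\<close>

text \<open>The \<open>k\<close>-th corner from the bottom is \<open>(crow k, ccol (Suc k) - 1)\<close>; the columns from
  \<open>ccol k\<close> to \<open>ccol (Suc k) - 1\<close> are those of length \<open>Suc (crow k)\<close>.\<close>

primrec ccol :: "nat \<Rightarrow> nat" where
  "ccol 0 = 0"
| "ccol (Suc k) = row_len (col_len (ccol k) - 1)"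

definition crow :: "nat \<Rightarrow> nat" where "crow k = col_len (ccol k) - 1"

text \<open>From this index on \<open>ccol\<close> is constant with value \<open>row_len 0\<close>,
  thanks to truncated subtraction; so it counts the distinct lengths of nonempty columns.\<close>

definition ncorners :: nat where "ncorners = (LEAST k. row_len 0 \<le> ccol k)"

lemma ccol_Suc: "ccol (Suc k) = row_len (crow k)"
  by (simp add: crow_def)

declare ccol.simps(2) [simp del]

lemma row_len_0_pos: "row_len 0 > 0"
proof (rule ccontr)
  assume "\<not> row_len 0 > 0"
  then have "D = {}" using row_len_mono [of 0] by (fastforce simp: in_D_iff)
  then show False using card_D by simp
qed

lemma ccol_step:
  assumes "ccol k < row_len 0"
  shows "ccol k < ccol (Suc k)" "ccol (Suc k) \<le> row_len 0" "col_len (ccol k) = Suc (crow k)"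
proof -
  have "0 < col_len (ccol k)" using assms unfolding less_row_len_iff .
  then show len: "col_len (ccol k) = Suc (crow k)" by (simp add: crow_def)
  then have "crow k < col_len (ccol k)" by simp
  then show "ccol k < ccol (Suc k)" unfolding ccol_Suc less_row_len_iff .
  show "ccol (Suc k) \<le> row_len 0" unfolding ccol_Suc by (rule row_len_mono) simp
qed

lemma row_len_0_le_ccol_ncorners: "row_len 0 \<le> ccol ncorners"
proof -
  have "\<exists>k. row_len 0 \<le> ccol k"
  proof (rule ccontr)
    assume "\<not> ?thesis"
    then have lt: "ccol k < row_len 0" for k by (simp add: not_le)
    \<comment> \<open>The sequence increases strictly as long as it stays below
      \<open>row_len 0\<close>, so it cannot stay below forever.\<close>
    have "k \<le> ccol k" for k
      by (induction k) (use ccol_step(1) [OF lt] in \<open>auto intro: Suc_leI le_less_trans\<close>)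
    then show False using lt [of "row_len 0"] by (simp add: not_le [symmetric])
  qed
  then show ?thesis unfolding ncorners_def by (rule LeastI_ex)
qed

lemma ccol_less: "k < ncorners \<Longrightarrow> ccol k < row_len 0"
  unfolding ncorners_def using not_less_Least [of k "\<lambda>k. row_len 0 \<le> ccol k"] by simp

lemma ncorners_pos: "ncorners > 0"
  using row_len_0_le_ccol_ncorners row_len_0_pos by (cases ncorners) auto

lemma ccol_ncorners: "ccol ncorners = row_len 0"
proof -
  obtain k where k: "ncorners = Suc k" using ncorners_pos gr0_implies_Suc by blast
  then have "ccol (Suc k) \<le> row_len 0" using ccol_step(2) ccol_less by simp
  then show ?thesis using row_len_0_le_ccol_ncorners k by simp
qed

lemma ccol_strict: "i < j \<Longrightarrow> j \<le> ncorners \<Longrightarrow> ccol i < ccol j"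
proof (induction j)
  case (Suc j)
  then have "ccol j < ccol (Suc j)" using ccol_step(1) [OF ccol_less] by simp
  moreover have "i < j \<Longrightarrow> ccol i < ccol j" using Suc by simp
  ultimately show ?case using Suc.prems(1) by (cases "i = j") auto
qed simp

lemma ccol_mono: "i \<le> j \<Longrightarrow> j \<le> ncorners \<Longrightarrow> ccol i \<le> ccol j"
  using ccol_strict [of i j] by (cases "i = j") auto

lemma ccol_inj: "i \<le> ncorners \<Longrightarrow> j \<le> ncorners \<Longrightarrow> ccol i = ccol j \<Longrightarrow> i = j"
  using ccol_strict [of i j] ccol_strict [of j i] by (cases i j rule: linorder_cases) auto

lemma col_len_block:
  assumes "k < ncorners" "ccol k \<le> c" "c < ccol (Suc k)"
  shows "col_len c = Suc (crow k)"
proof -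
  have "crow k < col_len c" using assms(3) unfolding ccol_Suc less_row_len_iff .
  moreover have "col_len c \<le> Suc (crow k)"
    using col_len_mono [OF assms(2)] ccol_step(3) [OF ccol_less [OF assms(1)]] by simp
  ultimately show ?thesis by simp
qed

lemma crow_strict:
  assumes "j < k" "k < ncorners"
  shows "crow k < crow j"
proof -
  have "ccol (Suc j) \<le> ccol k" using assms by (intro ccol_mono) auto
  then have "\<not> ccol k < row_len (crow j)" unfolding ccol_Suc by simp
  then have "\<not> crow j < col_len (ccol k)" unfolding less_row_len_iff .
  then show ?thesis using ccol_step(3) [OF ccol_less [OF assms(2)]] by simp
qed

lemma block_exists:
  assumes "c < row_len 0"
  obtains k where "k < ncorners" "ccol k \<le> c" "c < ccol (Suc k)"
proof -
  have ex: "\<exists>k. c < ccol k" using assms ccol_ncorners by metis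
  define k where "k = (LEAST k. c < ccol k)"
  have k: "c < ccol k" unfolding k_def using ex by (rule LeastI_ex)
  have "k \<noteq> 0"
  proof
    assume "k = 0"
    then show False using k by simp
  qed
  then obtain j where j: "k = Suc j" using not0_implies_Suc by blast
  have "ccol j \<le> c" using not_less_Least [of j "\<lambda>k. c < ccol k"] j unfolding k_def by auto
  moreover have "k \<le> ncorners" unfolding k_def using assms ccol_ncorners by (intro Least_le) simp
  ultimately show thesis using that [of j] k j by simp
qed

section \<open>Zigzag states\<close>

definition S0 :: "nat set" where "S0 = S - {Suc n}"

lemma S0_iff: "x \<in> S0 \<longleftrightarrow> x \<in> S \<and> x \<noteq> Suc n"
  by (simp add: S0_def)

lemma S0_S: "x \<in> S0 \<Longrightarrow> x \<in> S"
  by (simp add: S0_def)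

text \<open>The support of the matrix counting entries by row of \<open>s\<close> and column of
  \<open>t\<close>; under \<open>sparse\<close> the support determines the matrix.\<close>

definition occ :: "tableau \<Rightarrow> tableau \<Rightarrow> nat \<Rightarrow> nat \<Rightarrow> bool" where
  "occ t s i j \<longleftrightarrow> (\<exists>x\<in>S0. rw s x = i \<and> cl t x = j)"

definition sparse :: "tableau \<Rightarrow> tableau \<Rightarrow> bool" where
  "sparse t s \<longleftrightarrow> inj_on (\<lambda>x. (rw s x, cl t x)) S0"

text \<open>Positions are compared with those in a full diagram whose last entry sits in column 0:
  \<open>prefix\<close> prescribes holes at \<open>(crow j, ccol j)\<close> and extra entries at \<open>(crow j, ccol (Suc j))\<close>,
  and \<open>state\<close> closes the zigzag by a hole in the row of the last entry.\<close>

definition prefix :: "nat \<Rightarrow> tableau \<Rightarrow> tableau \<Rightarrow> bool" where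
  "prefix k t s \<longleftrightarrow> t \<in> T \<and> s \<in> T \<and> cl t (Suc n) = 0 \<and>
    (\<forall>j<k. \<not> occ t s (crow j) (ccol j) \<and> occ t s (crow j) (ccol (Suc j)))"

definition state :: "nat \<Rightarrow> tableau \<Rightarrow> tableau \<Rightarrow> bool" where
  "state k t s \<longleftrightarrow> prefix k t s \<and> sparse t s \<and> \<not> occ t s (rw s (Suc n)) (ccol k)"

lemma occI: "x \<in> S0 \<Longrightarrow> rw s x = i \<Longrightarrow> cl t x = j \<Longrightarrow> occ t s i j"
  by (auto simp: occ_def)

lemma occE:
  assumes "occ t s i j"
  obtains x where "x \<in> S0" "rw s x = i" "cl t x = j"
  using assms by (auto simp: occ_def)

lemma sparseD: "sparse t s \<Longrightarrow> x \<in> S0 \<Longrightarrow> y \<in> S0 \<Longrightarrow> rw s x = rw s y \<Longrightarrow> cl t x = cl t y \<Longrightarrow> x = y"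
  unfolding sparse_def inj_on_def by blast

lemma rw_tp_last:
  assumes "s \<in> T" "x \<in> S0"
  shows "rw (tp x (Suc n) \<circ> s) (Suc n) = rw s x" "rw (tp x (Suc n) \<circ> s) x = rw s (Suc n)"
    "y \<in> S0 \<Longrightarrow> y \<noteq> x \<Longrightarrow> rw (tp x (Suc n) \<circ> s) y = rw s y"
  using rw_tp [OF S0_S [OF assms(2)] last_in_S assms(1)] assms(2) by (simp_all add: S0_iff)

text \<open>The swap changes the matrix in one column only: \<open>x\<close> moves there to the row
  of the last entry, where the hypothesis keeps its place free.\<close>

lemma sparse_tp_last:
  assumes s: "s \<in> T" and sp: "sparse t s" and x: "x \<in> S0"
    and hole: "\<not> occ t s (rw s (Suc n)) (cl t x)"
  shows "sparse t (tp x (Suc n) \<circ> s)"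
  unfolding sparse_def
proof (rule inj_onI)
  let ?s = "tp x (Suc n) \<circ> s"
  note rws = rw_tp_last [OF s x]
  have aux: "y = x" if y: "y \<in> S0" "rw ?s y = rw ?s x" "cl t y = cl t x" for y
  proof (rule ccontr)
    assume "y \<noteq> x"
    then have "rw s y = rw s (Suc n)" using rws(3) [OF y(1)] rws(2) y(2) by simp
    then show False using hole occI [OF y(1) _ y(3)] by blast
  qed
  fix y z assume yz: "y \<in> S0" "z \<in> S0" "(rw ?s y, cl t y) = (rw ?s z, cl t z)"
  show "y = z"
  proof (cases "y = x \<or> z = x")
    case True
    then show ?thesis using aux [OF yz(1)] aux [OF yz(2)] yz(3) by auto
  next
    case False
    then have "rw s y = rw s z" using rws(3) [OF yz(1)] rws(3) [OF yz(2)] yz(3) by simp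
    then show ?thesis using sparseD [OF sp yz(1,2)] yz(3) by simp
  qed
qed

lemma state_0_transversal:
  assumes "state 0 t s"
  shows "transversal t s"
proof -
  have *: "sparse t s" "\<not> occ t s (rw s (Suc n)) 0" "cl t (Suc n) = 0"
    using assms by (simp_all add: state_def prefix_def)
  have "x = y" if "x \<in> S" "y \<in> S" "rw s x = rw s y" "cl t x = cl t y" for x y
    using sparseD [OF *(1), of x y] *(2,3) that occI [of x s _ t 0] occI [of y s _ t 0]
    unfolding S0_iff by metis
  then show ?thesis unfolding transversal_def inj_on_def by blast
qed

text \<open>The last extra entry \<open>x\<close> fills the closing hole. The last entry moves to
  row \<open>crow k\<close>, so that the hole at \<open>(crow k, ccol k)\<close> becomes the closing
  one. Repeated, this leads to a transversal pair.\<close>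

lemma state_down:
  assumes st: "state (Suc k) t s" and k: "Suc k < ncorners"
    and x: "x \<in> S0" "rw s x = crow k" "cl t x = ccol (Suc k)"
  shows "state k t (tp x (Suc n) \<circ> s)"
proof -
  let ?s = "tp x (Suc n) \<circ> s"
  have pre: "t \<in> T" "s \<in> T" "cl t (Suc n) = 0" "sparse t s"
    "\<not> occ t s (rw s (Suc n)) (ccol (Suc k))"
    and holes: "\<And>j. j < Suc k \<Longrightarrow> \<not> occ t s (crow j) (ccol j)"
    and extras: "\<And>j. j < Suc k \<Longrightarrow> occ t s (crow j) (ccol (Suc j))"
    using st by (simp_all add: state_def prefix_def)
  note rws = rw_tp_last [OF pre(2) x(1)]
  have ne: "ccol j \<noteq> ccol (Suc k)" if "j < Suc k" for j using ccol_strict [of j "Suc k"] that k by simp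
  have hole: "\<not> occ t ?s (crow j) (ccol j)" if j: "j < Suc k" for j
  proof
    assume "occ t ?s (crow j) (ccol j)"
    then obtain y where y: "y \<in> S0" "rw ?s y = crow j" "cl t y = ccol j" by (rule occE)
    then have "y \<noteq> x" using ne [OF j] x(3) by auto
    then have "rw s y = crow j" using rws(3) [OF y(1)] y(2) by simp
    then show False using holes [OF j] y occI by blast
  qed
  have extra: "occ t ?s (crow j) (ccol (Suc j))" if j: "j < k" for j
  proof -
    obtain y where y: "y \<in> S0" "rw s y = crow j" "cl t y = ccol (Suc j)"
      using extras [of j] j by (auto elim: occE)
    then have "y \<noteq> x" using ne [of "Suc j"] j x(3) by auto
    then show ?thesis using rws(3) [OF y(1)] y occI by metis
  qed
  have "sparse t ?s" using pre(5) by (intro sparse_tp_last pre x(1)) (simp add: x(3))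
  moreover have "\<not> occ t ?s (rw ?s (Suc n)) (ccol k)" using hole [of k] rws(1) x(2) by simp
  moreover have "?s \<in> T" using tp_tableau [OF S0_S [OF x(1)] last_in_S pre(2)] .
  ultimately show ?thesis using hole extra pre by (simp add: state_def prefix_def)
qed

text \<open>Both matrices are the diagram, so the entries can be matched cell by cell.\<close>

lemma transversal_match:
  assumes "t \<in> T" "s \<in> T" "transversal t s" "t' \<in> T" "s' \<in> T" "transversal t' s'"
  obtains \<pi> where "\<pi> permutes S" "\<And>x. x \<in> S \<Longrightarrow> rw s' (\<pi> x) = rw s x"
    "\<And>x. x \<in> S \<Longrightarrow> cl t' (\<pi> x) = cl t x"
proof -
  obtain u where u: "u \<in> T" "\<And>x. x \<in> S \<Longrightarrow> (rw u x, cl u x) = (rw s x, cl t x)"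
    using tableau_of_cells [OF transversal_bij [OF assms(1-3)]] by blast
  obtain u' where u': "u' \<in> T" "\<And>x. x \<in> S \<Longrightarrow> (rw u' x, cl u' x) = (rw s' x, cl t' x)"
    using tableau_of_cells [OF transversal_bij [OF assms(4-6)]] by blast
  obtain \<pi> where \<pi>: "\<pi> permutes S" "u' = \<pi> \<circ> u" using perm_between [OF u(1) u'(1)] by blast
  have "(rw s' (\<pi> x), cl t' (\<pi> x)) = (rw s x, cl t x)" if x: "x \<in> S" for x
  proof -
    have "\<pi> x \<in> S" using permutes_in_image [OF \<pi>(1)] x by blast
    then show ?thesis
      using u(2) [OF x] u'(2) rw_perm [OF \<pi>(1) u(1) x] cl_perm [OF \<pi>(1) u(1) x]
      unfolding \<pi>(2) by simp
  qed
  then show thesis using that [OF \<pi>(1)] by simp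
qed

text \<open>\<open>state_down\<close> reduces this to transversal pairs. As \<pi> fixes the last
  entry, an endomorphism has the same coefficient up to sign at all \<open>k\<close>-states with the
  last entry in a given row: one parameter for each \<open>k\<close>.\<close>

lemma state_match:
  assumes "k < ncorners" "state k t s" "state k t' s'" "rw s (Suc n) = rw s' (Suc n)"
  shows "\<exists>\<pi>. \<pi> permutes S \<and> \<pi> (Suc n) = Suc n \<and>
    (\<forall>x\<in>S. rw s' (\<pi> x) = rw s x \<and> cl t' (\<pi> x) = cl t x)"
  using assms
proof (induction k arbitrary: s s')
  case 0
  have T: "t \<in> T" "s \<in> T" "t' \<in> T" "s' \<in> T" "cl t (Suc n) = 0" "cl t' (Suc n) = 0"
    using 0 by (simp_all add: state_def prefix_def)
  have tr: "transversal t s" "transversal t' s'" using 0 state_0_transversal by blast+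
  obtain \<pi> where \<pi>: "\<pi> permutes S" "\<And>x. x \<in> S \<Longrightarrow> rw s' (\<pi> x) = rw s x"
    "\<And>x. x \<in> S \<Longrightarrow> cl t' (\<pi> x) = cl t x"
    using transversal_match [OF T(1,2) tr(1) T(3,4) tr(2)] by blast
  have "rw s' (\<pi> (Suc n)) = rw s' (Suc n)" "cl t' (\<pi> (Suc n)) = cl t' (Suc n)"
    using \<pi>(2,3) [OF last_in_S] T 0 by simp_all
  moreover have "\<pi> (Suc n) \<in> S" using permutes_in_image [OF \<pi>(1)] by simp
  ultimately have "\<pi> (Suc n) = Suc n" using tr(2) unfolding transversal_def inj_on_def by simp
  then show ?case using \<pi> by blast
next
  case (Suc k)
  have T: "s \<in> T" "s' \<in> T" "sparse t' s'" using Suc.prems by (simp_all add: state_def prefix_def)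
  have "occ t s (crow k) (ccol (Suc k))" "occ t' s' (crow k) (ccol (Suc k))"
    using Suc.prems by (simp_all add: state_def prefix_def)
  then obtain x x' where x: "x \<in> S0" "rw s x = crow k" "cl t x = ccol (Suc k)"
    and x': "x' \<in> S0" "rw s' x' = crow k" "cl t' x' = ccol (Suc k)" by (auto elim!: occE)
  let ?s = "tp x (Suc n) \<circ> s" and ?s' = "tp x' (Suc n) \<circ> s'"
  have st: "state k t ?s" "state k t' ?s'"
    using state_down Suc.prems x x' by blast+
  note rws = rw_tp_last [OF T(1) x(1)] and rws' = rw_tp_last [OF T(2) x'(1)]
  have "k < ncorners" using Suc.prems(1) by simp
  moreover have "rw ?s (Suc n) = rw ?s' (Suc n)" unfolding rws(1) rws'(1) x(2) x'(2) ..
  ultimately have "\<exists>\<pi>. \<pi> permutes S \<and> \<pi> (Suc n) = Suc n \<and>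
      (\<forall>y\<in>S. rw ?s' (\<pi> y) = rw ?s y \<and> cl t' (\<pi> y) = cl t y)"
    by (intro Suc.IH st)
  then obtain \<pi> where \<pi>: "\<pi> permutes S" "\<pi> (Suc n) = Suc n"
    "\<And>y. y \<in> S \<Longrightarrow> rw ?s' (\<pi> y) = rw ?s y" "\<And>y. y \<in> S \<Longrightarrow> cl t' (\<pi> y) = cl t y"
    by blast
  have in0: "\<pi> y \<in> S0" if "y \<in> S0" for y
    using that permutes_in_image [OF \<pi>(1)] permutes_inj [OF \<pi>(1)] \<pi>(2) unfolding S0_iff
    by (metis injD)
  \<comment> \<open>After the swaps \<open>x\<close> and \<open>x'\<close> occupy corresponding
    cells, and by sparseness nothing else does; hence \<pi> still matches the entries when the swaps
    are undone.\<close>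
  have px: "\<pi> x = x'"
  proof (rule sparseD)
    show "sparse t' ?s'" using st(2) by (simp add: state_def)
    show "rw ?s' (\<pi> x) = rw ?s' x'"
      using \<pi>(3) [OF S0_S [OF x(1)]] rws(2) rws'(2) Suc.prems(4) by simp
    show "cl t' (\<pi> x) = cl t' x'" using \<pi>(4) [OF S0_S [OF x(1)]] x(3) x'(3) by simp
  qed (use in0 x x' in auto)
  have "rw s' (\<pi> y) = rw s y" if y: "y \<in> S" for y
  proof -
    consider "y = Suc n" | "y = x" | "y \<in> S0" "y \<noteq> x" using y S0_iff by blast
    then show ?thesis
    proof cases
      case 1
      then show ?thesis using \<pi>(2) Suc.prems(4) by simp
    next
      case 2
      then show ?thesis using px x(2) x'(2) by simp
    next
      case 3
      then have "\<pi> y \<noteq> x'" using px permutes_inj [OF \<pi>(1)] by (metis injD)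
      then show ?thesis
        using rws'(3) [OF in0 [OF 3(1)]] rws(3) [OF 3] \<pi>(3) [OF y] by simp
    qed
  qed
  then show ?case using \<pi> by blast
qed

section \<open>Endomorphisms of the restricted Specht module\<close>

definition endo :: "('f::field tabvec \<Rightarrow> 'f tabvec) \<Rightarrow> bool" where
  "endo f \<longleftrightarrow> f \<in> carrier (End_alg (Sym n) (specht lam))"

lemma endo_iff: "endo f \<longleftrightarrow> (\<forall>v\<in>specht lam. f v \<in> specht lam) \<and> (\<forall>v. v \<notin> specht lam \<longrightarrow> f v = 0) \<and>
    (\<forall>v\<in>specht lam. \<forall>w\<in>specht lam. f (v + w) = f v + f w) \<and>
    (\<forall>c. \<forall>v\<in>specht lam. f (vscale c v) = vscale c (f v)) \<and>
    (\<forall>\<pi>\<in>Sym n. \<forall>v\<in>specht lam. f (perm_act \<pi> v) = perm_act \<pi> (f v))"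
  by (simp add: endo_def End_alg_def)

lemma endo_in: "endo f \<Longrightarrow> v \<in> specht lam \<Longrightarrow> f v \<in> specht lam"
  and endo_off: "endo f \<Longrightarrow> v \<notin> specht lam \<Longrightarrow> f v = 0"
  and endo_add: "endo f \<Longrightarrow> v \<in> specht lam \<Longrightarrow> w \<in> specht lam \<Longrightarrow> f (v + w) = f v + f w"
  and endo_scale: "endo f \<Longrightarrow> v \<in> specht lam \<Longrightarrow> f (vscale c v) = vscale c (f v)"
  unfolding endo_iff by blast+

lemma Sym_iff: "\<pi> \<in> Sym n \<longleftrightarrow> \<pi> permutes S \<and> \<pi> (Suc n) = Suc n"
proof
  assume "\<pi> \<in> Sym n"
  then have p: "\<pi> permutes {1..n}" by (simp add: Sym_def)
  then have "\<pi> permutes S" by (rule permutes_subset) (auto simp: S_def)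
  moreover have "\<pi> (Suc n) = Suc n" using p by (rule permutes_not_in) simp
  ultimately show "\<pi> permutes S \<and> \<pi> (Suc n) = Suc n" by blast
next
  assume p: "\<pi> permutes S \<and> \<pi> (Suc n) = Suc n"
  have "\<pi> permutes {1..n}"
  proof (rule permutes_superset)
    show "\<pi> permutes S" using p by blast
    fix x assume "x \<in> S - {1..n}"
    then have "x = Suc n" by (auto simp: S_def)
    then show "\<pi> x = x" using p by simp
  qed
  then show "\<pi> \<in> Sym n" by (simp add: Sym_def)
qed

lemma endo_perm:
  assumes "endo f" "\<pi> permutes S" "\<pi> (Suc n) = Suc n" "v \<in> specht lam"
  shows "f (perm_act \<pi> v) = perm_act \<pi> (f v)"
proof -
  have "\<forall>\<pi>\<in>Sym n. \<forall>v\<in>specht lam. f (perm_act \<pi> v) = perm_act \<pi> (f v)"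
    using assms(1) unfolding endo_iff by (elim conjE)
  moreover have "\<pi> \<in> Sym n" using assms(2,3) unfolding Sym_iff by (rule conjI)
  ultimately have "\<forall>v\<in>specht lam. f (perm_act \<pi> v) = perm_act \<pi> (f v)" by (rule bspec)
  then show ?thesis using assms(4) by (rule bspec)
qed

lemma endo_zero: "endo f \<Longrightarrow> f 0 = 0"
  using endo_scale [of f 0 0] tabvec.subspace_0 [OF specht_subspace] by simp

lemma endo_uminus: "endo f \<Longrightarrow> v \<in> specht lam \<Longrightarrow> f (- v) = - f v"
  using endo_scale [of f v "- 1"] by simp

lemma endo_sum:
  assumes "endo f" "\<And>x. x \<in> A \<Longrightarrow> g x \<in> specht lam"
  shows "f (\<Sum>x\<in>A. g x) = (\<Sum>x\<in>A. f (g x))"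
  using assms(2)
proof (induction A rule: infinite_finite_induct)
  case (insert x A)
  then have "(\<Sum>x\<in>A. g x) \<in> specht lam" by (intro tabvec.subspace_sum [OF specht_subspace]) auto
  then have "f (g x + (\<Sum>x\<in>A. g x)) = f (g x) + f (\<Sum>x\<in>A. g x)"
    using insert.prems by (intro endo_add [OF assms(1)]) auto
  also have "f (\<Sum>x\<in>A. g x) = (\<Sum>x\<in>A. f (g x))"
    using insert.prems by (intro insert.IH) auto
  finally show "f (\<Sum>x\<in>insert x A. g x) = (\<Sum>x\<in>insert x A. f (g x))"
    by (simp only: sum.insert [OF insert.hyps])
qed (simp_all add: endo_zero [OF assms(1)])

section \<open>Matrix coefficients of an endomorphism and their relations\<close>

definition fcoeff :: "('f::field tabvec \<Rightarrow> 'f tabvec) \<Rightarrow> tableau \<Rightarrow> tableau \<Rightarrow> 'f" where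
  "fcoeff f t s = f (polytabloid lam t) (tabloid lam s)"

lemma fcoeff_perm:
  assumes "endo f" "\<pi> permutes S" "\<pi> (Suc n) = Suc n" "t \<in> T" "s \<in> T"
  shows "fcoeff f (\<pi> \<circ> t) (\<pi> \<circ> s) = fcoeff f t s"
  unfolding fcoeff_def polytabloid_perm [OF assms(2,4), symmetric]
  using endo_perm [OF assms(1-3) polytabloid_in_specht [OF assms(4)]] perm_act_tabloid [OF assms(2,5)]
  by simp

text \<open>Restricted to entries other than the last, since \<open>f\<close> commutes only with
  permutations fixing it. The Garnir and kernel relations hold in the module itself and may move the
  last entry too.\<close>

lemma fcoeff_tp:
  assumes "endo f" "x \<in> S0" "y \<in> S0" "t \<in> T" "s \<in> T"
  shows "fcoeff f (tp x y \<circ> t) s = fcoeff f t (tp x y \<circ> s)"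
proof -
  have xy: "x \<in> S" "y \<in> S" "tp x y (Suc n) = Suc n" using assms(2,3) by (simp_all add: S0_iff)
  show ?thesis
    using fcoeff_perm [OF assms(1) tp_permutes [OF xy(1,2)] xy(3) assms(4) tp_tableau [OF xy(1,2) assms(5)]]
    unfolding tp_tp .
qed

lemma fcoeff_rows:
  assumes "s \<in> T" "s' \<in> T" "\<And>x. x \<in> S \<Longrightarrow> rw s x = rw s' x"
  shows "fcoeff f t s = fcoeff f t s'"
  unfolding fcoeff_def using assms by (rule ecoeff_same_rows)

lemma fcoeff_cols:
  assumes "endo f" "t \<in> T" "t' \<in> T" "\<And>x. x \<in> S \<Longrightarrow> cl t x = cl t' x"
  shows "fcoeff f t s = 0 \<longleftrightarrow> fcoeff f t' s = 0"
  using polytabloid_same_columns [OF assms(2-4), where 'f = 'a]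
  unfolding fcoeff_def
  by (auto simp: endo_uminus [OF assms(1) polytabloid_in_specht [OF assms(2)]])

text \<open>Renaming by \<pi> preserves the coefficient. What remains is a rearrangement within rows
  of \<open>s\<close>, which is harmless, and within columns of \<open>t\<close>, which costs a
  sign.\<close>

lemma fcoeff_match:
  assumes f: "endo f" and \<pi>: "\<pi> permutes S" "\<pi> (Suc n) = Suc n"
    and T: "t \<in> T" "s \<in> T" "t' \<in> T" "s' \<in> T"
    and eq: "\<forall>x\<in>S. rw s' (\<pi> x) = rw s x \<and> cl t' (\<pi> x) = cl t x"
  shows "fcoeff f t s = 0 \<longleftrightarrow> fcoeff f t' s' = 0"
proof -
  have im: "\<pi> ` S = S" using \<pi>(1) by (rule permutes_image)
  have r: "rw (\<pi> \<circ> s) y = rw s' y" and c: "cl (\<pi> \<circ> t) y = cl t' y" if y: "y \<in> S" for y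
  proof -
    obtain x where x: "x \<in> S" "y = \<pi> x" using y im by blast
    show "rw (\<pi> \<circ> s) y = rw s' y" using rw_perm [OF \<pi>(1) T(2) x(1)] eq x by simp
    show "cl (\<pi> \<circ> t) y = cl t' y" using cl_perm [OF \<pi>(1) T(1) x(1)] eq x by simp
  qed
  have "fcoeff f t s = fcoeff f (\<pi> \<circ> t) (\<pi> \<circ> s)" using fcoeff_perm [OF f \<pi> T(1,2)] by simp
  also have "\<dots> = fcoeff f (\<pi> \<circ> t) s'"
    by (rule fcoeff_rows [OF perm_tableau [OF \<pi>(1) T(2)] T(4) r])
  finally show ?thesis
    using fcoeff_cols [OF f perm_tableau [OF \<pi>(1) T(1)] T(3) c, of s'] by simp
qed

text \<open>Exchanging two entries that share a row of \<open>s\<close> and a column of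
  \<open>t\<close> both preserves and negates the coefficient. This is the step that needs
  characteristic different from 2.\<close>

lemma fcoeff_not_sparse:
  assumes "CHAR('f::field) \<noteq> 2" and f: "endo (f :: 'f tabvec \<Rightarrow> 'f tabvec)"
    and T: "t \<in> T" "s \<in> T" and "\<not> sparse t s"
  shows "fcoeff f t s = 0"
proof -
  obtain x y where xy: "x \<in> S0" "y \<in> S0" "x \<noteq> y" "rw s x = rw s y" "cl t x = cl t y"
    using assms(5) unfolding sparse_def inj_on_def by blast
  note xyS = S0_S [OF xy(1)] S0_S [OF xy(2)]
  have "fcoeff f (tp x y \<circ> t) s = fcoeff f t (tp x y \<circ> s)" by (rule fcoeff_tp [OF f xy(1,2) T])
  also have "\<dots> = fcoeff f t s"
  proof (rule fcoeff_rows [OF tp_tableau [OF xyS T(2)] T(2)])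
    fix z assume "z \<in> S"
    then show "rw (tp x y \<circ> s) z = rw s z"
      unfolding rw_tp [OF xyS T(2) \<open>z \<in> S\<close>] using xy(4) by (simp add: Transposition.transpose_def)
  qed
  finally have "fcoeff f (tp x y \<circ> t) s = fcoeff f t s" .
  moreover have "fcoeff f (tp x y \<circ> t) s = - fcoeff f t s"
    unfolding fcoeff_def polytabloid_tp [OF T(1) xyS xy(5,3)]
    using endo_uminus [OF f polytabloid_in_specht [OF T(1)]] by simp
  ultimately have "fcoeff f t s = - fcoeff f t s" by (rule trans [OF sym])
  then have "2 * fcoeff f t s = 0" unfolding eq_neg_iff_add_eq_0 mult_2 .
  then show ?thesis using two_neq_zero [OF assms(1)] by simp
qed

lemma fcoeff_garnir:
  assumes f: "endo f" and t: "t \<in> T" and x: "x \<in> S" and c': "c' \<noteq> cl t x"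
    and len: "col_len (cl t x) \<le> col_len c'"
  shows "fcoeff f t s = (\<Sum>y\<in>{y \<in> S. cl t y = c'}. fcoeff f (tp x y \<circ> t) s)"
proof -
  have "f (polytabloid lam t) = (\<Sum>y\<in>{y \<in> S. cl t y = c'}. f (polytabloid lam (tp x y \<circ> t)))"
    unfolding polytabloid_garnir [OF t x c' len]
    by (rule endo_sum [OF f]) (use t x in \<open>auto intro!: polytabloid_in_specht tp_tableau\<close>)
  then show ?thesis unfolding fcoeff_def by (simp only: sum_fun_apply)
qed

lemma fcoeff_kernel:
  assumes f: "endo f" and t: "t \<in> T" and s: "s \<in> T" and z: "z \<in> S"
    and b: "b \<noteq> rw s z" and len: "row_len (rw s z) \<le> row_len b"
  shows "fcoeff f t s + (\<Sum>y\<in>{y \<in> S. rw s y = b}. fcoeff f t (tp y z \<circ> s)) = 0"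
  unfolding fcoeff_def
  by (rule specht_kernel [OF endo_in [OF f polytabloid_in_specht [OF t]] s z b len])

section \<open>Endomorphisms are determined by their coefficients at states\<close>

lemma prefix_tableaux: "prefix k t s \<Longrightarrow> t \<in> T \<and> s \<in> T \<and> cl t (Suc n) = 0"
  by (simp add: prefix_def)

text \<open>If \<open>crow k\<close> is row 0, the hole closes the zigzag and a sparse pair is a
  state. Otherwise row \<open>crow k\<close> does not contain the last entry, so its hole forces an
  entry in some column from \<open>ccol (Suc k)\<close> on. The Garnir relation brings this entry to
  column \<open>ccol (Suc k)\<close>, which is at least as long as its own, and the prefix grows by
  one.\<close>

lemma fcoeff_hole_zero:
  assumes char: "CHAR('f::field) \<noteq> 2" and f: "endo (f :: 'f tabvec \<Rightarrow> 'f tabvec)" and k: "k < ncorners"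
    and st: "\<And>t s. state k t s \<Longrightarrow> rw s (Suc n) = 0 \<Longrightarrow> fcoeff f t s = 0"
    and IH: "\<And>t s. Suc k < ncorners \<Longrightarrow> prefix (Suc k) t s \<Longrightarrow> rw s (Suc n) = 0 \<Longrightarrow> fcoeff f t s = 0"
    and pre: "prefix k t s" and N: "rw s (Suc n) = 0" and hole: "\<not> occ t s (crow k) (ccol k)"
  shows "fcoeff f t s = 0"
proof (cases "sparse t s \<and> crow k \<noteq> 0")
  case False
  have T: "t \<in> T" "s \<in> T" using prefix_tableaux [OF pre] by blast+
  consider "\<not> sparse t s" | "sparse t s" "crow k = 0" using False by blast
  then show ?thesis
  proof cases
    case 1
    then show ?thesis by (rule fcoeff_not_sparse [OF char f T])
  next
    case 2
    then have "state k t s" using pre hole N by (simp add: state_def)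
    then show ?thesis using N by (rule st)
  qed
next
  case True
  then have sp: "sparse t s" and R0: "crow k \<noteq> 0" by blast+
  have T: "t \<in> T" "s \<in> T" "cl t (Suc n) = 0" using prefix_tableaux [OF pre] by blast+
  have Ck: "ccol k < ccol (Suc k)" using ccol_step(1) [OF ccol_less [OF k]] .
  let ?X = "{x \<in> S. rw s x = crow k}"
  have X0: "x \<in> S0" if "x \<in> ?X" for x using that N R0 by (auto simp: S0_iff)
  have "\<exists>x\<in>?X. ccol (Suc k) \<le> cl t x"
  proof (rule ccontr)
    assume neg: "\<not> ?thesis"
    have "cl t ` ?X \<subseteq> {..<ccol (Suc k)} - {ccol k}"
    proof
      fix c assume "c \<in> cl t ` ?X"
      then obtain x where x: "x \<in> ?X" "c = cl t x" by blast
      have "c \<noteq> ccol k"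
      proof
        assume "c = ccol k"
        then have "occ t s (crow k) (ccol k)" using x by (intro occI [OF X0 [OF x(1)]]) simp_all
        then show False using hole by blast
      qed
      moreover have "cl t x < ccol (Suc k)" using neg x(1) unfolding not_le [symmetric] by blast
      ultimately show "c \<in> {..<ccol (Suc k)} - {ccol k}" using x(2) by simp
    qed
    then have "card (cl t ` ?X) \<le> card ({..<ccol (Suc k)} - {ccol k})" by (intro card_mono) auto
    also have "\<dots> < ccol (Suc k)" using Ck by (simp add: card_Diff_singleton)
    also have "\<dots> = card ?X" using card_row [OF T(2)] by (simp add: ccol_Suc)
    also have "card ?X = card (cl t ` ?X)"
    proof (rule card_image [symmetric], rule inj_onI)
      fix x y assume "x \<in> ?X" "y \<in> ?X" "cl t x = cl t y"
      then show "x = y" using sparseD [OF sp X0 [of x] X0 [of y]] by simp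
    qed
    finally show False by simp
  qed
  then obtain x where x: "x \<in> S" "rw s x = crow k" "ccol (Suc k) \<le> cl t x" by blast
  have x0: "x \<in> S0" using X0 [of x] x(1,2) by simp
  have "cl t x < row_len 0"
    using cl_less [OF T(1) x(1)] row_len_mono [of 0 "rw t x"] by simp
  then have "Suc k \<noteq> ncorners" using x(3) ccol_ncorners by auto
  then have k': "Suc k < ncorners" using k by simp
  have pre': "\<And>j. j < k \<Longrightarrow> \<not> occ t s (crow j) (ccol j)" "\<And>j. j < k \<Longrightarrow> occ t s (crow j) (ccol (Suc j))"
    using pre by (simp_all add: prefix_def)
  show ?thesis
  proof (cases "occ t s (crow k) (ccol (Suc k))")
    case True
    have "\<not> occ t s (crow j) (ccol j) \<and> occ t s (crow j) (ccol (Suc j))" if "j < Suc k" for j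
      using pre' [of j] hole True that by (cases "j = k") simp_all
    then have "prefix (Suc k) t s" using T unfolding prefix_def by blast
    then show ?thesis by (rule IH [OF k' _ N])
  next
    case False
    then have clx: "cl t x \<noteq> ccol (Suc k)" using occI [OF x0 x(2)] by blast
    have len: "col_len (cl t x) \<le> col_len (ccol (Suc k))" using x(3) by (rule col_len_mono)
    have "fcoeff f (tp x y \<circ> t) s = 0" if y: "y \<in> S" "cl t y = ccol (Suc k)" for y
    proof -
      let ?t = "tp x y \<circ> t"
      have y0: "y \<in> S0" using y T(3) Ck by (auto simp: S0_iff)
      have xy: "x \<noteq> y" using y clx by auto
      have T': "?t \<in> T" using tp_tableau [OF x(1) y(1) T(1)] .
      have cx: "cl ?t x = ccol (Suc k)" and cy: "cl ?t y = cl t x"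
        using cl_tp [OF x(1) y(1) T(1)] x(1) y by simp_all
      have co: "cl ?t z = cl t z" if "z \<in> S" "z \<noteq> x" "z \<noteq> y" for z
        using cl_tp [OF x(1) y(1) T(1) that(1)] that by simp
      have cN: "cl ?t (Suc n) = 0" using co [of "Suc n"] x0 y0 T(3) by (auto simp: S0_iff)
      have less: "ccol j < ccol (Suc k)" if "j \<le> k" for j using ccol_strict [of j "Suc k"] that k' by simp
      \<comment> \<open>The exchange touches only columns from \<open>ccol (Suc k)\<close> on; the
        holes and extra entries of the old prefix lie further left.\<close>
      have "occ ?t s i j \<longleftrightarrow> occ t s i j" if "j < ccol (Suc k)" for i j
      proof -
        have "cl ?t z = j \<longleftrightarrow> cl t z = j" if "z \<in> S0" for z
          using cx cy co [OF S0_S [OF that]] \<open>j < ccol (Suc k)\<close> x(3) y(2)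
          by (cases "z = x"; cases "z = y") auto
        then show ?thesis unfolding occ_def by blast
      qed
      then have occ: "occ ?t s i (ccol j) \<longleftrightarrow> occ t s i (ccol j)" if "j \<le> k" for i j
        using less [OF that] by blast
      have "\<not> occ ?t s (crow j) (ccol j) \<and> occ ?t s (crow j) (ccol (Suc j))" if j: "j < Suc k" for j
      proof (cases "j = k")
        case True
        then show ?thesis using occ [of k] hole occI [OF x0 x(2) cx] by simp
      next
        case False
        then show ?thesis using occ [of j] occ [of "Suc j"] pre' [of j] j by simp
      qed
      then have "prefix (Suc k) ?t s" using T' T(2) cN unfolding prefix_def by blast
      then show ?thesis by (rule IH [OF k' _ N])
    qed
    then show ?thesis
      unfolding fcoeff_garnir [OF f T(1) x(1) clx [symmetric] len] by (intro sum.neutral) blast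
  qed
qed

text \<open>Column \<open>ccol k\<close> of \<open>t\<close> has \<open>Suc (crow k)\<close>
  entries, one of which is the last entry or lies in a row below \<open>crow k\<close>. So it has a
  hole in some row \<open>b\<close> up to \<open>crow k\<close>. If \<open>b\<close> is 0, a sparse
  pair is a state; if the hole is higher than \<open>crow k\<close>, the kernel relation exchanges
  the occupant of \<open>(crow k, ccol k)\<close> with entries of row \<open>b\<close>, which moves
  the hole to row \<open>crow k\<close>.\<close>

lemma fcoeff_prefix_step:
  assumes char: "CHAR('f::field) \<noteq> 2" and f: "endo (f :: 'f tabvec \<Rightarrow> 'f tabvec)" and k: "k < ncorners"
    and st: "\<And>t s. state k t s \<Longrightarrow> rw s (Suc n) = 0 \<Longrightarrow> fcoeff f t s = 0"
    and IH: "\<And>t s. Suc k < ncorners \<Longrightarrow> prefix (Suc k) t s \<Longrightarrow> rw s (Suc n) = 0 \<Longrightarrow> fcoeff f t s = 0"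
    and pre: "prefix k t s" and N: "rw s (Suc n) = 0"
  shows "fcoeff f t s = 0"
proof (cases "sparse t s \<and> occ t s (crow k) (ccol k)")
  case False
  then consider "\<not> sparse t s" | "\<not> occ t s (crow k) (ccol k)" by blast
  then show ?thesis
  proof cases
    case 1
    then show ?thesis using fcoeff_not_sparse [OF char f] prefix_tableaux [OF pre] by blast
  next
    case 2
    show ?thesis by (rule fcoeff_hole_zero [OF char f k _ _ pre N 2]) (use st IH in blast)+
  qed
next
  case True
  then have sp: "sparse t s" and "occ t s (crow k) (ccol k)" by blast+
  then obtain z where z: "z \<in> S0" "rw s z = crow k" "cl t z = ccol k" by (auto elim: occE)
  have T: "t \<in> T" "s \<in> T" "cl t (Suc n) = 0" using prefix_tableaux [OF pre] by blast+
  have pre': "\<And>j. j < k \<Longrightarrow> \<not> occ t s (crow j) (ccol j)" "\<And>j. j < k \<Longrightarrow> occ t s (crow j) (ccol (Suc j))"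
    using pre by (simp_all add: prefix_def)
  have "\<exists>b\<le>crow k. \<not> occ t s b (ccol k)"
  proof (rule ccontr)
    assume neg: "\<not> ?thesis"
    let ?Y = "{x \<in> S. cl t x = ccol k}"
    let ?Z = "{x \<in> S0. cl t x = ccol k \<and> rw s x \<le> crow k}"
    have "{..crow k} \<subseteq> rw s ` ?Z"
    proof
      fix b assume "b \<in> {..crow k}"
      then have "occ t s b (ccol k)" using neg by blast
      then obtain x where "x \<in> S0" "rw s x = b" "cl t x = ccol k" by (rule occE)
      then show "b \<in> rw s ` ?Z" using \<open>b \<in> {..crow k}\<close> by blast
    qed
    moreover have fZ: "finite ?Z" using finite_S by (simp add: S0_def)
    ultimately have "card {..crow k} \<le> card (rw s ` ?Z)" by (intro card_mono) auto
    also have "\<dots> \<le> card ?Z" using fZ by (rule card_image_le)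
    also have "\<dots> < card ?Y"
    proof (rule psubset_card_mono)
      have "\<exists>x\<in>?Y. x \<notin> ?Z"
      proof (cases k)
        case 0
        then show ?thesis using T(3) by (intro bexI [of _ "Suc n"]) (simp_all add: S0_iff)
      next
        case (Suc j)
        then have "occ t s (crow j) (ccol k)" using pre'(2) [of j] by simp
        then obtain x where x: "x \<in> S0" "rw s x = crow j" "cl t x = ccol k" by (rule occE)
        moreover have "crow k < crow j" using crow_strict [of j k] Suc k by simp
        ultimately show ?thesis using S0_S [OF x(1)] by (intro bexI [of _ x]) simp_all
      qed
      then show "?Z \<subset> ?Y" using S0_S by blast
    qed simp
    also have "card ?Y = Suc (crow k)"
      using card_col [OF T(1)] ccol_step(3) [OF ccol_less [OF k]] by simp
    finally show False by simp
  qed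
  then obtain b where b: "b \<le> crow k" "\<not> occ t s b (ccol k)" by blast
  have bR: "b \<noteq> crow k" using b(2) occI [OF z] by blast
  show ?thesis
  proof (cases "b = 0")
    case True
    then have "state k t s" using pre sp b N by (simp add: state_def)
    then show ?thesis using N by (rule st)
  next
    case b0: False
    have len: "row_len (rw s z) \<le> row_len b" unfolding z(2) using b(1) by (rule row_len_mono)
    have bz: "b \<noteq> rw s z" using bR z(2) by simp
    note zS = S0_S [OF z(1)]
    have "fcoeff f t (tp y z \<circ> s) = 0" if y: "y \<in> S" "rw s y = b" for y
    proof -
      let ?s = "tp y z \<circ> s"
      \<comment> \<open>Since \<open>b\<close> is not row 0, the exchange does not move the last
        entry.\<close>
      have y0: "y \<in> S0" using y N b0 by (auto simp: S0_iff)
      have T': "?s \<in> T" using tp_tableau [OF y(1) zS T(2)] .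
      have ry: "rw ?s y = crow k" and rz: "rw ?s z = b"
        using rw_tp [OF y(1) zS T(2)] y zS z(2) by simp_all
      have ro: "rw ?s w = rw s w" if "w \<in> S" "w \<noteq> y" "w \<noteq> z" for w
        using rw_tp [OF y(1) zS T(2) that(1)] that by simp
      have N': "rw ?s (Suc n) = 0" using ro [of "Suc n"] y0 z(1) N by (auto simp: S0_iff)
      have occ: "occ t ?s i j \<longleftrightarrow> occ t s i j" if "crow k < i" for i j
      proof -
        have "rw ?s w = i \<longleftrightarrow> rw s w = i" if "w \<in> S0" for w
          using ry rz ro [OF S0_S [OF that]] \<open>crow k < i\<close> b(1) y(2) z(2)
          by (cases "w = y"; cases "w = z") auto
        then show ?thesis unfolding occ_def by blast
      qed
      have "\<not> occ t ?s (crow j) (ccol j) \<and> occ t ?s (crow j) (ccol (Suc j))" if j: "j < k" for j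
        using occ [of "crow j"] crow_strict [OF j k] pre' [OF j] by simp
      then have pre1: "prefix k t ?s" using T T' unfolding prefix_def by blast
      have hole: "\<not> occ t ?s (crow k) (ccol k)"
      proof
        assume "occ t ?s (crow k) (ccol k)"
        then obtain w where w: "w \<in> S0" "rw ?s w = crow k" "cl t w = ccol k" by (rule occE)
        have "w \<noteq> z" using w(2) rz bR by auto
        moreover have "w \<noteq> y" using w(1,3) b(2) occI [OF _ y(2)] by blast
        ultimately have "rw s w = crow k" using ro [OF S0_S [OF w(1)]] w(2) by simp
        then show False using sparseD [OF sp w(1) z(1)] w(3) z \<open>w \<noteq> z\<close> by simp
      qed
      show ?thesis by (rule fcoeff_hole_zero [OF char f k _ _ pre1 N' hole]) (use st IH in blast)+
    qed
    then have "(\<Sum>y\<in>{y \<in> S. rw s y = b}. fcoeff f t (tp y z \<circ> s)) = 0"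
      by (intro sum.neutral) blast
    then show ?thesis using fcoeff_kernel [OF f T(1,2) zS bz len] by simp
  qed
qed

text \<open>The index \<open>k\<close> descends from the last corner: prefixes of length
  \<open>k\<close> are settled by states and by longer prefixes. The empty prefix demands only that
  the last entry be in column 0 of \<open>t\<close>. As row 0 and column 0 are longest, the kernel
  relation and then the Garnir relation remove the conditions on its position.\<close>

lemma endo_eq_zeroI:
  assumes char: "CHAR('f::field) \<noteq> 2" and f: "endo (f :: 'f tabvec \<Rightarrow> 'f tabvec)"
    and st: "\<And>k t s. k < ncorners \<Longrightarrow> state k t s \<Longrightarrow> rw s (Suc n) = 0 \<Longrightarrow> fcoeff f t s = 0"
  shows "f = 0"
proof -
  have pre: "fcoeff f t s = 0" if "k < ncorners" "prefix k t s" "rw s (Suc n) = 0" for k t s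
    using that
  proof (induction "ncorners - k" arbitrary: k t s rule: less_induct)
    case less
    show ?case
    proof (rule fcoeff_prefix_step [OF char f less.prems(1) _ _ less.prems(2,3)])
      show "fcoeff f t s = 0" if "state k t s" "rw s (Suc n) = 0" for t s
        using st less.prems(1) that by blast
      show "fcoeff f t s = 0" if "Suc k < ncorners" "prefix (Suc k) t s" "rw s (Suc n) = 0" for t s
        by (rule less.hyps [OF _ that]) (use less.prems(1) in simp)
    qed
  qed
  have 1: "fcoeff f t s = 0" if "t \<in> T" "s \<in> T" "cl t (Suc n) = 0" "rw s (Suc n) = 0" for t s
    using pre [OF ncorners_pos _ that(4), of t] that by (simp add: prefix_def)
  have 2: "fcoeff f t s = 0" if T: "t \<in> T" "s \<in> T" "cl t (Suc n) = 0" for t s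
  proof (cases "rw s (Suc n) = 0")
    case False
    have "fcoeff f t (tp y (Suc n) \<circ> s) = 0" if y: "y \<in> S" "rw s y = 0" for y
      using rw_tp [OF y(1) last_in_S T(2) last_in_S] y
      by (intro 1 T tp_tableau last_in_S) simp_all
    then have "(\<Sum>y\<in>{y \<in> S. rw s y = 0}. fcoeff f t (tp y (Suc n) \<circ> s)) = 0"
      by (intro sum.neutral) blast
    moreover have "row_len (rw s (Suc n)) \<le> row_len 0" by (rule row_len_mono) simp
    moreover have "0 \<noteq> rw s (Suc n)" using False by simp
    ultimately show ?thesis using fcoeff_kernel [OF f T(1,2) last_in_S, of 0] by simp
  qed (use 1 T in blast)
  have 3: "fcoeff f t s = 0" if T: "t \<in> T" "s \<in> T" for t s
  proof (cases "cl t (Suc n) = 0")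
    case False
    have len: "col_len (cl t (Suc n)) \<le> col_len 0" by (rule col_len_mono) simp
    have "fcoeff f (tp (Suc n) y \<circ> t) s = 0" if y: "y \<in> S" "cl t y = 0" for y
      using cl_tp [OF last_in_S y(1) T(1) last_in_S] y
      by (intro 2 T tp_tableau last_in_S) simp_all
    then show ?thesis
      unfolding fcoeff_garnir [OF f T(1) last_in_S False [symmetric] len]
      by (intro sum.neutral) blast
  qed (use 2 T in blast)
  have base: "f (polytabloid lam t) = 0" if t: "t \<in> T" for t
  proof (rule specht_eqI)
    show "f (polytabloid lam t) \<in> specht lam"
      using endo_in [OF f polytabloid_in_specht [OF t]] .
    show "(0 :: 'f tabvec) \<in> specht lam" by (rule tabvec.subspace_0 [OF specht_subspace])
    show "f (polytabloid lam t) (tabloid lam s) = (0 :: 'f tabvec) (tabloid lam s)" if "s \<in> T" for s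
      using 3 [OF t that] by (simp add: fcoeff_def)
  qed
  have "v \<in> specht lam \<and> f v = 0" if v: "v \<in> specht lam" for v
  proof (rule specht_induct [OF v, of "\<lambda>v. v \<in> specht lam \<and> f v = 0"])
    show "0 \<in> specht lam \<and> f 0 = 0"
      using tabvec.subspace_0 [OF specht_subspace] endo_zero [OF f] by blast
    show "v + w \<in> specht lam \<and> f (v + w) = 0"
      if "v \<in> specht lam \<and> f v = 0" "w \<in> specht lam \<and> f w = 0" for v w
    proof
      show "v + w \<in> specht lam" by (rule tabvec.subspace_add [OF specht_subspace]) (use that in blast)+
      have "f (v + w) = f v + f w" by (rule endo_add [OF f]) (use that in blast)+
      also have "\<dots> = 0" using that by simp
      finally show "f (v + w) = 0" .
    qed
    show "vscale c v \<in> specht lam \<and> f (vscale c v) = 0" if "v \<in> specht lam \<and> f v = 0" for c v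
    proof
      show "vscale c v \<in> specht lam" by (rule tabvec.subspace_scale [OF specht_subspace]) (use that in blast)
      have "f (vscale c v) = vscale c (f v)" by (rule endo_scale [OF f]) (use that in blast)
      also have "\<dots> = 0" using that by simp
      finally show "f (vscale c v) = 0" .
    qed
    show "polytabloid lam t \<in> specht lam \<and> f (polytabloid lam t) = 0" if "t \<in> T" for t
      using that polytabloid_in_specht base by blast
  qed
  then have "f v = 0" for v using endo_off [OF f] by blast
  then show ?thesis by (simp add: fun_eq_iff)
qed

section \<open>The Jucys-Murphy element\<close>

definition jm :: "'f::field tabvec \<Rightarrow> 'f tabvec" where
  "jm v = (\<Sum>x\<in>S0. perm_act (tp x (Suc n)) v)"

lemma finite_S0 [simp]: "finite S0"
  by (simp add: S0_def)

lemma jm_add: "jm (v + w) = jm v + jm w"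
  by (simp only: jm_def perm_act_add sum.distrib)

lemma jm_vscale: "jm (vscale c v) = vscale c (jm v)"
  by (simp only: jm_def perm_act_vscale tabvec.scale_sum_right)

lemma jm_zero: "jm 0 = 0"
  using jm_vscale [of 0 0] by simp

lemma jm_in: "v \<in> specht lam \<Longrightarrow> jm v \<in> specht lam"
  unfolding jm_def
  by (intro tabvec.subspace_sum [OF specht_subspace] specht_perm_act tp_permutes last_in_S S0_S)

lemma jm_coeff:
  assumes "s \<in> T"
  shows "jm v (tabloid lam s) = (\<Sum>x\<in>S0. v (tabloid lam (tp x (Suc n) \<circ> s)))"
  unfolding jm_def sum_fun_apply
  by (intro sum.cong refl perm_act_tp_tabloid assms last_in_S S0_S)

lemma jm_polytabloid:
  assumes "t \<in> T"
  shows "jm (polytabloid lam t) = (\<Sum>x\<in>S0. polytabloid lam (tp x (Suc n) \<circ> t))"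
  unfolding jm_def
  by (intro sum.cong refl polytabloid_perm tp_permutes assms last_in_S S0_S)

text \<open>Conjugation by a permutation that fixes the last entry permutes the transpositions in
  the sum.\<close>

lemma jm_perm:
  assumes \<pi>: "\<pi> permutes S" "\<pi> (Suc n) = Suc n" and v: "v \<in> (specht lam :: 'f::field tabvec set)"
  shows "jm (perm_act \<pi> v) = perm_act \<pi> (jm v)"
proof (rule specht_induct [OF v, of "\<lambda>v. jm (perm_act \<pi> v) = perm_act \<pi> (jm v)"])
  have 0: "perm_act \<pi> 0 = (0 :: 'f tabvec)" by (simp add: perm_act_def fun_eq_iff)
  show "jm (perm_act \<pi> 0) = perm_act \<pi> (jm (0 :: 'f tabvec))" by (simp only: 0 jm_zero)
  show "jm (perm_act \<pi> (v + w)) = perm_act \<pi> (jm (v + w))"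
    if "jm (perm_act \<pi> v) = perm_act \<pi> (jm v)" "jm (perm_act \<pi> w) = perm_act \<pi> (jm w)"
    for v w :: "'f tabvec"
    using that by (simp only: perm_act_add jm_add)
  show "jm (perm_act \<pi> (vscale c v)) = perm_act \<pi> (jm (vscale c v))"
    if "jm (perm_act \<pi> v) = perm_act \<pi> (jm v)" for c and v :: "'f tabvec"
    using that by (simp only: perm_act_vscale jm_vscale)
  fix t assume t: "t \<in> T"
  have inj: "inj \<pi>" using \<pi>(1) by (rule permutes_inj)
  have in0: "\<pi> x \<in> S0 \<longleftrightarrow> x \<in> S0" for x
    using permutes_in_image [OF \<pi>(1)] injD [OF inj, of x "Suc n"] \<pi>(2) unfolding S0_iff by auto
  have "perm_act \<pi> (jm (polytabloid lam t) :: 'f tabvec) =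
      (\<Sum>x\<in>S0. perm_act \<pi> (polytabloid lam (tp x (Suc n) \<circ> t)))"
    unfolding jm_polytabloid [OF t] by (rule perm_act_sum)
  also have "\<dots> = (\<Sum>x\<in>S0. polytabloid lam (\<pi> \<circ> (tp x (Suc n) \<circ> t)))"
    by (intro sum.cong refl polytabloid_perm \<pi>(1) tp_tableau t last_in_S S0_S)
  also have "\<dots> = (\<Sum>x\<in>S0. polytabloid lam (tp (\<pi> x) (Suc n) \<circ> (\<pi> \<circ> t)))"
  proof (intro sum.cong refl arg_cong [of _ _ "polytabloid lam"])
    fix x
    have "tp (\<pi> x) (Suc n) \<circ> \<pi> = \<pi> \<circ> tp x (Suc n)"
      using transpose_conj [OF inj, of x "Suc n"] unfolding \<pi>(2) .
    then show "\<pi> \<circ> (tp x (Suc n) \<circ> t) = tp (\<pi> x) (Suc n) \<circ> (\<pi> \<circ> t)"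
      unfolding o_assoc by simp
  qed
  also have "\<dots> = (\<Sum>x\<in>S0. polytabloid lam (tp x (Suc n) \<circ> (\<pi> \<circ> t)))"
  proof (rule sum.reindex_bij_betw)
    show "bij_betw \<pi> S0 S0"
    proof (rule bij_betw_imageI)
      show "inj_on \<pi> S0" using inj by (rule inj_on_subset) simp
      show "\<pi> ` S0 = S0"
        using in0 finite_S0 inj by (intro endo_inj_surj) (auto intro: inj_on_subset)
    qed
  qed
  also have "\<dots> = jm (polytabloid lam (\<pi> \<circ> t))"
    by (rule jm_polytabloid [OF perm_tableau [OF \<pi>(1) t], symmetric])
  finally show "jm (perm_act \<pi> (polytabloid lam t)) = perm_act \<pi> (jm (polytabloid lam t) :: 'f tabvec)"
    unfolding polytabloid_perm [OF \<pi>(1) t] by (rule sym)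
qed

section \<open>Polynomials in the Jucys-Murphy element\<close>

definition jm_eval :: "'f::field poly \<Rightarrow> 'f tabvec \<Rightarrow> 'f tabvec" where
  "jm_eval p = fold_coeffs (\<lambda>a g v. vscale a v + jm (g v)) p (\<lambda>v. 0)"

lemma jm_eval_0: "jm_eval 0 v = 0"
  by (simp add: jm_eval_def)

lemma jm_eval_pCons: "jm_eval (pCons a p) v = vscale a v + jm (jm_eval p v)"
proof (cases "a = 0 \<and> p = 0")
  case True
  then show ?thesis by (simp add: jm_eval_0 jm_zero)
next
  case False
  then have "fold_coeffs (\<lambda>a g v. vscale a v + jm (g v)) (pCons a p)
      = (\<lambda>g v. vscale a v + jm (g v)) \<circ> fold_coeffs (\<lambda>a g v. vscale a v + jm (g v)) p"
    by (cases "a = 0") (simp_all only: fold_coeffs_pCons_coeff_not_0_eq fold_coeffs_pCons_not_0_0_eq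
        simp_thms not_False_eq_True)
  then show ?thesis unfolding jm_eval_def by (simp only: o_apply)
qed

lemma jm_eval_1: "jm_eval 1 v = v"
  unfolding one_pCons jm_eval_pCons jm_eval_0 jm_zero by simp

lemma jm_eval_add: "jm_eval (p + q) v = jm_eval p v + jm_eval q v"
proof (induction p q rule: poly_induct2)
  case (pCons a p b q)
  have "jm_eval (pCons a p + pCons b q) v = vscale (a + b) v + jm (jm_eval (p + q) v)"
    by (simp only: add_pCons jm_eval_pCons)
  also have "\<dots> = (vscale a v + jm (jm_eval p v)) + (vscale b v + jm (jm_eval q v))"
    unfolding pCons tabvec.scale_left_distrib jm_add by (simp only: ac_simps)
  finally show "jm_eval (pCons a p + pCons b q) v = jm_eval (pCons a p) v + jm_eval (pCons b q) v"
    by (simp only: jm_eval_pCons)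
qed (simp add: jm_eval_0)

lemma jm_eval_smult: "jm_eval (Polynomial.smult c p) v = vscale c (jm_eval p v)"
proof (induction p)
  case 0
  show "jm_eval (Polynomial.smult c 0) v = vscale c (jm_eval 0 v)"
    unfolding smult_0_right jm_eval_0 by (rule tabvec.scale_zero_right [symmetric])
next
  case (pCons a p)
  have "jm_eval (Polynomial.smult c (pCons a p)) v = vscale (c * a) v + jm (jm_eval (Polynomial.smult c p) v)"
    by (simp only: smult_pCons jm_eval_pCons)
  also have "\<dots> = vscale c (vscale a v + jm (jm_eval p v))"
    unfolding pCons.IH jm_vscale tabvec.scale_right_distrib tabvec.scale_scale ..
  finally show "jm_eval (Polynomial.smult c (pCons a p)) v = vscale c (jm_eval (pCons a p) v)"
    by (simp only: jm_eval_pCons)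
qed

lemma jm_eval_mult: "jm_eval (p * q) v = jm_eval p (jm_eval q v)"
proof (induction p)
  case (pCons a p)
  have "jm_eval (pCons a p * q) v = vscale a (jm_eval q v) + jm (jm_eval (p * q) v)"
    unfolding mult_pCons_left jm_eval_add jm_eval_smult jm_eval_pCons tabvec.scale_zero_left add_0_left ..
  then show "jm_eval (pCons a p * q) v = jm_eval (pCons a p) (jm_eval q v)"
    unfolding pCons.IH jm_eval_pCons .
qed (simp add: jm_eval_0)

lemma jm_eval_linear: "jm_eval p (v + w) = jm_eval p v + jm_eval p w" "jm_eval p (vscale c v) = vscale c (jm_eval p v)"
proof (induction p)
  case (pCons a p)
  {
    case 1
    show "jm_eval (pCons a p) (v + w) = jm_eval (pCons a p) v + jm_eval (pCons a p) w"
      unfolding jm_eval_pCons pCons.IH jm_add tabvec.scale_right_distrib by (simp only: ac_simps)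
  next
    case 2
    show "jm_eval (pCons a p) (vscale c v) = vscale c (jm_eval (pCons a p) v)"
      unfolding jm_eval_pCons pCons.IH jm_vscale tabvec.scale_right_distrib tabvec.scale_scale
      by (simp only: mult.commute)
  }
qed (simp_all add: jm_eval_0)

lemma jm_eval_in: "v \<in> specht lam \<Longrightarrow> jm_eval p v \<in> specht lam"
proof (induction p)
  case 0
  then show ?case using tabvec.subspace_0 [OF specht_subspace] unfolding jm_eval_0 by blast
next
  case (pCons a p)
  then show ?case
    unfolding jm_eval_pCons
    by (intro tabvec.subspace_add [OF specht_subspace] tabvec.subspace_scale [OF specht_subspace] jm_in)
qed

lemma jm_eval_perm:
  assumes "\<pi> permutes S" "\<pi> (Suc n) = Suc n" "v \<in> specht lam"
  shows "jm_eval p (perm_act \<pi> v) = perm_act \<pi> (jm_eval p v)"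
proof (induction p)
  case 0
  have "perm_act \<pi> 0 = (0 :: 'a tabvec)" by (simp add: perm_act_def fun_eq_iff)
  then show "jm_eval 0 (perm_act \<pi> v) = perm_act \<pi> (jm_eval 0 v)" by (simp only: jm_eval_0)
next
  case (pCons a p)
  then show "jm_eval (pCons a p) (perm_act \<pi> v) = perm_act \<pi> (jm_eval (pCons a p) v)"
    unfolding jm_eval_pCons perm_act_add perm_act_vscale
    by (simp only: jm_perm [OF assms(1,2) jm_eval_in [OF assms(3)]])
qed

lemma jm_eval_X_power: "jm_eval (monom c j) v = vscale c ((jm ^^ j) v)"
proof (induction j)
  case 0
  show ?case unfolding monom_0 jm_eval_pCons jm_eval_0 jm_zero by simp
next
  case (Suc j)
  show ?case unfolding monom_Suc jm_eval_pCons Suc.IH jm_vscale by simp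
qed

text \<open>Extended by 0, as \<open>End_alg\<close> represents an endomorphism by its extension to
  the ambient space.\<close>

definition jm_endo :: "'f::field poly \<Rightarrow> 'f tabvec \<Rightarrow> 'f tabvec" where
  "jm_endo p = (\<lambda>v. if v \<in> specht lam then jm_eval p v else 0)"

lemma endo_jm_endo: "endo (jm_endo p)"
  unfolding endo_iff
proof (intro conjI ballI allI impI)
  fix v w :: "'a tabvec" assume v: "v \<in> specht lam" and w: "w \<in> specht lam"
  have "v + w \<in> specht lam" by (rule tabvec.subspace_add [OF specht_subspace v w])
  then show "jm_endo p (v + w) = jm_endo p v + jm_endo p w" using v w unfolding jm_endo_def by (simp only: if_True jm_eval_linear)
next
  fix v :: "'a tabvec" and c assume v: "v \<in> specht lam"
  have "vscale c v \<in> specht lam" by (rule tabvec.subspace_scale [OF specht_subspace v])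
  then show "jm_endo p (vscale c v) = vscale c (jm_endo p v)" using v unfolding jm_endo_def by (simp only: if_True jm_eval_linear)
next
  fix v :: "'a tabvec" and \<pi> assume v: "v \<in> specht lam" and "\<pi> \<in> Sym n"
  then have \<pi>: "\<pi> permutes S" "\<pi> (Suc n) = Suc n" unfolding Sym_iff by blast+
  show "jm_endo p (perm_act \<pi> v) = perm_act \<pi> (jm_endo p v)"
    using v specht_perm_act [OF v \<pi>(1)] unfolding jm_endo_def by (simp only: if_True jm_eval_perm [OF \<pi> v])
qed (simp_all add: jm_endo_def jm_eval_in)

section \<open>The minimal polynomial\<close>

text \<open>A descending filtration on whose successive quotients \<open>jm\<close> acts by the
  scalars \<open>corner_res k\<close>.\<close>

definition col_span :: "nat \<Rightarrow> 'f::field tabvec set" where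
  "col_span k = tabvec.span (polytabloid lam ` {t \<in> T. ccol k \<le> cl t (Suc n)})"

definition corner_res :: "nat \<Rightarrow> 'f::field" where
  "corner_res k = of_int (int (ccol (Suc k)) - 1 - int (crow k))"

lemma col_span_subspace: "tabvec.subspace (col_span k)"
  unfolding col_span_def by (rule tabvec.subspace_span)

lemma polytabloid_in_col_span: "t \<in> T \<Longrightarrow> ccol k \<le> cl t (Suc n) \<Longrightarrow> polytabloid lam t \<in> col_span k"
  unfolding col_span_def by (intro tabvec.span_base imageI) blast

lemma col_span_mono: "j \<le> k \<Longrightarrow> k \<le> ncorners \<Longrightarrow> col_span k \<subseteq> col_span j"
  unfolding col_span_def using ccol_mono [of j k] by (intro tabvec.span_mono image_mono) auto

text \<open>The transpositions are sorted by the column of \<open>x\<close>. The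
  \<open>crow k\<close> other entries in the column of the last entry give \<open>- e_t\<close>
  each. Each of the remaining \<open>ccol (Suc k) - 1\<close> columns before
  \<open>ccol (Suc k)\<close> contributes \<open>e_t\<close> in total, by a Garnir relation. All
  other terms have the last entry in a later block. The difference of the two counts is the residue
  of the corner.\<close>

lemma jm_block:
  assumes t: "t \<in> T" and k: "k < ncorners" and blk: "ccol k \<le> cl t (Suc n)" "cl t (Suc n) < ccol (Suc k)"
  shows "jm (polytabloid lam t) - vscale (corner_res k) (polytabloid lam t) \<in> (col_span (Suc k) :: 'f::field tabvec set)"
proof -
  let ?N = "Suc n" and ?e = "polytabloid lam t :: 'f tabvec"
  define F :: "nat \<Rightarrow> 'f tabvec" where "F x = polytabloid lam (tp x ?N \<circ> t)" for x
  define c0 where "c0 = cl t ?N"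
  let ?A = "{x \<in> S0. cl t x = c0}"
  let ?B = "{x \<in> S0. cl t x < ccol (Suc k) \<and> cl t x \<noteq> c0}"
  let ?C = "{x \<in> S0. ccol (Suc k) \<le> cl t x}"
  have len0: "col_len c0 = Suc (crow k)" unfolding c0_def by (rule col_len_block [OF k blk])
  have "S0 = ?A \<union> (?B \<union> ?C)" using blk by (auto simp: c0_def)
  then have "sum F S0 = sum F (?A \<union> (?B \<union> ?C))" by (rule arg_cong)
  also have "\<dots> = sum F ?A + sum F (?B \<union> ?C)"
    using blk by (intro sum.union_disjoint) (auto simp: c0_def)
  also have "sum F (?B \<union> ?C) = sum F ?B + sum F ?C"
    by (intro sum.union_disjoint) auto
  finally have split: "sum F S0 = sum F ?A + (sum F ?B + sum F ?C)" .
  have "sum F ?A = (\<Sum>x\<in>?A. - ?e)"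
  proof (rule sum.cong [OF refl])
    fix x assume "x \<in> ?A"
    then show "F x = - ?e"
      unfolding F_def c0_def by (intro polytabloid_tp t) (simp_all add: S0_iff)
  qed
  also have "\<dots> = vscale (- of_nat (card ?A)) ?e"
    by (simp add: fun_eq_iff vscale_def sum_fun_apply)
  also have "card ?A = crow k"
  proof -
    have "{x \<in> S. cl t x = c0} = insert ?N ?A" by (auto simp: S0_iff c0_def)
    then have "card {x \<in> S. cl t x = c0} = Suc (card ?A)" by (simp add: S0_iff)
    then show ?thesis using card_col [OF t] len0 by simp
  qed
  finally have A: "sum F ?A = vscale (- of_nat (crow k)) ?e" .
  let ?I = "{..<ccol (Suc k)} - {c0}"
  have "sum F ?B = (\<Sum>c\<in>?I. sum F {x \<in> ?B. cl t x = c})"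
    by (rule sum.group [symmetric]) auto
  also have "\<dots> = (\<Sum>c\<in>?I. ?e)"
  proof (rule sum.cong [OF refl])
    fix c assume c: "c \<in> ?I"
    then have "{x \<in> ?B. cl t x = c} = {x \<in> S. cl t x = c}" by (auto simp: S0_iff c0_def)
    moreover have "?e = (\<Sum>x\<in>{x \<in> S. cl t x = c}. polytabloid lam (tp ?N x \<circ> t))"
    proof (rule polytabloid_garnir [OF t last_in_S])
      show "c \<noteq> cl t ?N" using c by (simp add: c0_def)
      have "crow k < col_len c" using c unfolding less_row_len_iff [symmetric] by (simp add: ccol_Suc)
      then show "col_len (cl t ?N) \<le> col_len c" using len0 by (simp add: c0_def)
    qed
    ultimately show "sum F {x \<in> ?B. cl t x = c} = ?e"
      unfolding F_def by (simp only: transpose_commute [of ?N])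
  qed
  also have "\<dots> = vscale (of_nat (card ?I)) ?e"
    by (simp add: fun_eq_iff vscale_def sum_fun_apply)
  also have "of_nat (card ?I) = (of_int (int (ccol (Suc k)) - 1) :: 'f)"
    using blk(2) by (simp add: c0_def card_Diff_singleton of_nat_diff)
  finally have B: "sum F ?B = vscale (of_int (int (ccol (Suc k)) - 1)) ?e" .
  have C: "sum F ?C \<in> col_span (Suc k)"
  proof (rule tabvec.subspace_sum [OF col_span_subspace])
    fix x assume x: "x \<in> ?C"
    then have xS: "x \<in> S" by (simp add: S0_iff)
    show "F x \<in> col_span (Suc k)"
      unfolding F_def
      by (intro polytabloid_in_col_span tp_tableau xS last_in_S t)
        (use cl_tp [OF xS last_in_S t last_in_S] x in simp)
  qed
  have "corner_res k = (- of_nat (crow k) + of_int (int (ccol (Suc k)) - 1) :: 'f)" by (simp add: corner_res_def)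
  then have "vscale (corner_res k) ?e = sum F ?A + sum F ?B"
    unfolding A B by (simp only: tabvec.scale_left_distrib)
  then have "jm ?e - vscale (corner_res k) ?e = sum F ?C"
    unfolding jm_polytabloid [OF t] F_def [symmetric] split by (simp only: add_diff_cancel_left add.assoc [symmetric] add_diff_cancel_left')
  then show ?thesis using C by (simp only:)
qed

text \<open>For a generator in a later block \<open>j\<close>, \<open>jm_block\<close> comes with
  another scalar, but the correction is a multiple of the generator, which itself lies in
  \<open>col_span (Suc k)\<close>.\<close>

lemma col_span_step:
  assumes k: "k < ncorners" and v: "v \<in> (col_span k :: 'f::field tabvec set)"
  shows "jm v - vscale (corner_res k) v \<in> col_span (Suc k)"
proof (rule tabvec.span_induct [OF v [unfolded col_span_def], of "\<lambda>v. jm v - vscale (corner_res k) v \<in> col_span (Suc k)"])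
  let ?G = "\<lambda>v :: 'f tabvec. jm v - vscale (corner_res k) v"
  have 1: "?G (v + w) = ?G v + ?G w" for v w
    unfolding jm_add tabvec.scale_right_distrib by (rule add_diff_add)
  have 2: "?G (vscale c v) = vscale c (?G v)" for c v
    unfolding jm_vscale tabvec.scale_right_diff_distrib tabvec.scale_scale by (simp only: mult.commute)
  have 0: "?G 0 = 0" unfolding jm_zero by simp
  show "tabvec.subspace {v. ?G v \<in> col_span (Suc k)}"
  proof (rule tabvec.subspaceI)
    show "0 \<in> {v. ?G v \<in> col_span (Suc k)}"
      unfolding mem_Collect_eq 0 by (rule tabvec.subspace_0 [OF col_span_subspace])
    show "v + w \<in> {v. ?G v \<in> col_span (Suc k)}"
      if "v \<in> {v. ?G v \<in> col_span (Suc k)}" "w \<in> {v. ?G v \<in> col_span (Suc k)}" for v w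
      using that unfolding mem_Collect_eq 1 by (rule tabvec.subspace_add [OF col_span_subspace])
    show "vscale c v \<in> {v. ?G v \<in> col_span (Suc k)}" if "v \<in> {v. ?G v \<in> col_span (Suc k)}" for c v
      using that unfolding mem_Collect_eq 2 by (rule tabvec.subspace_scale [OF col_span_subspace])
  qed
  fix v :: "'f tabvec" assume "v \<in> polytabloid lam ` {t \<in> T. ccol k \<le> cl t (Suc n)}"
  then obtain t where t: "t \<in> T" "ccol k \<le> cl t (Suc n)" "v = polytabloid lam t" by blast
  have "cl t (Suc n) < row_len 0"
    using cl_less [OF t(1) last_in_S] row_len_mono [of 0 "rw t (Suc n)"] by simp
  then obtain j where j: "j < ncorners" "ccol j \<le> cl t (Suc n)" "cl t (Suc n) < ccol (Suc j)"
    by (rule block_exists)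
  have kj: "k \<le> j"
  proof (rule ccontr)
    assume "\<not> k \<le> j"
    then have "ccol (Suc j) \<le> ccol k" using k by (intro ccol_mono) auto
    then show False using t(2) j(3) by simp
  qed
  have b: "jm v - vscale (corner_res j) v \<in> col_span (Suc j)" unfolding t(3) by (rule jm_block [OF t(1) j])
  show "?G v \<in> col_span (Suc k)"
  proof (cases "j = k")
    case True
    then show ?thesis using b by blast
  next
    case False
    then have "Suc k \<le> j" using kj by simp
    then have "ccol (Suc k) \<le> cl t (Suc n)" using ccol_mono [of "Suc k" j] j by simp
    then have "v \<in> col_span (Suc k)" unfolding t(3) by (intro polytabloid_in_col_span t(1))
    then have "vscale (corner_res j - corner_res k) v \<in> col_span (Suc k)" by (rule tabvec.subspace_scale [OF col_span_subspace])
    moreover have "jm v - vscale (corner_res j) v \<in> col_span (Suc k)"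
      using b col_span_mono [of "Suc k" "Suc j"] kj j(1) by auto
    ultimately have "(jm v - vscale (corner_res j) v) + vscale (corner_res j - corner_res k) v \<in> col_span (Suc k)"
      by (intro tabvec.subspace_add [OF col_span_subspace])
    then show ?thesis unfolding tabvec.scale_left_diff_distrib by simp
  qed
qed

lemma jm_eval_linear_factor: "jm_eval [:- a, 1:] v = jm v - vscale a v"
  unfolding jm_eval_pCons jm_eval_0 jm_zero by (simp add: fun_eq_iff vscale_def)

text \<open>Each factor moves one step down the filtration, which ends in zero because no column has
  index \<open>ccol ncorners = row_len 0\<close> or more.\<close>

lemma jm_eval_min_poly:
  assumes "v \<in> (specht lam :: 'f::field tabvec set)"
  shows "jm_eval (\<Prod>j\<in>{..<ncorners}. [:- corner_res j, 1:]) v = 0"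
proof -
  have "jm_eval (\<Prod>j\<in>{k..<ncorners}. [:- corner_res j, 1:]) v = 0" if "k \<le> ncorners" "v \<in> col_span k" for k and v :: "'f tabvec"
    using that
  proof (induction "ncorners - k" arbitrary: k v)
    case 0
    then have "k = ncorners" by simp
    have none: "{t \<in> T. ccol ncorners \<le> cl t (Suc n)} = {}"
    proof -
      have "cl t (Suc n) < ccol ncorners" if "t \<in> T" for t
        using cl_less [OF that last_in_S] row_len_mono [of 0 "rw t (Suc n)"] ccol_ncorners by simp
      then show ?thesis by (auto simp: not_le [symmetric])
    qed
    have "v = 0" using 0 unfolding \<open>k = ncorners\<close> col_span_def none by simp
    have "jm_eval p 0 = 0" for p :: "'f poly"
      using jm_eval_linear(2) [of p 0 0] unfolding tabvec.scale_zero_left .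
    then show "jm_eval (\<Prod>j\<in>{k..<ncorners}. [:- corner_res j, 1:]) v = 0" unfolding \<open>v = 0\<close> .
  next
    case (Suc d)
    then have k: "k < ncorners" by simp
    have "{k..<ncorners} = insert k {Suc k..<ncorners}" using k by auto
    then have "jm_eval (\<Prod>j\<in>{k..<ncorners}. [:- corner_res j, 1:]) v = jm_eval ((\<Prod>j\<in>{Suc k..<ncorners}. [:- corner_res j, 1:]) * [:- corner_res k, 1:]) v"
      by (simp add: mult.commute)
    also have "\<dots> = jm_eval (\<Prod>j\<in>{Suc k..<ncorners}. [:- corner_res j, 1:]) (jm v - vscale (corner_res k) v)"
      unfolding jm_eval_mult jm_eval_linear_factor ..
    also have "\<dots> = 0"
      by (rule Suc.hyps(1)) (use Suc.hyps(2) k col_span_step [OF k Suc.prems(2)] in simp_all)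
    finally show ?case .
  qed
  moreover have "v \<in> col_span 0" using assms unfolding col_span_def specht_def by simp
  ultimately show ?thesis by (simp add: lessThan_atLeast0)
qed

section \<open>Independence of the powers of the Jucys-Murphy element\<close>

definition jm_coeff :: "nat \<Rightarrow> tableau \<Rightarrow> tableau \<Rightarrow> 'f::field" where
  "jm_coeff j t s = ((jm ^^ j) (polytabloid lam t)) (tabloid lam s)"

lemma jm_coeff_0: "jm_coeff 0 t s = ecoeff t s"
  by (simp add: jm_coeff_def)

lemma jm_coeff_Suc: "s \<in> T \<Longrightarrow> jm_coeff (Suc j) t s = (\<Sum>x\<in>S0. jm_coeff j t (tp x (Suc n) \<circ> s))"
  by (simp add: jm_coeff_def jm_coeff)

text \<open>In column \<open>c\<close> the matrix has the same support as the diagram.\<close>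

definition good :: "tableau \<Rightarrow> tableau \<Rightarrow> nat \<Rightarrow> bool" where
  "good t s c \<longleftrightarrow> (\<forall>i<col_len c. occ t s i c) \<and> (\<forall>x\<in>S0. cl t x = c \<longrightarrow> rw s x < col_len c)"

text \<open>Column 0 is left out: in the pairs considered it contains the last entry, which the
  matrix does not count.\<close>

definition bad :: "tableau \<Rightarrow> tableau \<Rightarrow> nat set" where
  "bad t s = {c. 0 < c \<and> c < row_len 0 \<and> \<not> good t s c}"

lemma finite_bad [simp]: "finite (bad t s)"
  by (rule finite_subset [of _ "{..<row_len 0}"]) (auto simp: bad_def)

lemma transversal_good:
  assumes T: "t \<in> T" "s \<in> T" "cl t (Suc n) = 0" and tr: "transversal t s" and c: "0 < c"
  shows "good t s c"
  unfolding good_def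
proof (intro conjI allI impI ballI)
  fix i assume "i < col_len c"
  then obtain x where x: "x \<in> S" "rw s x = i" "cl t x = c"
    by (rule transversal_cell [OF T(1,2) tr])
  then have "x \<in> S0" using T(3) c by (auto simp: S0_iff)
  then show "occ t s i c" using x(2,3) by (rule occI)
next
  fix x assume "x \<in> S0" "cl t x = c"
  then show "rw s x < col_len c"
    using transversal_in_D [OF T(1,2) tr S0_S] unfolding less_row_len_iff by blast
qed

lemma good_tp_last:
  assumes s: "s \<in> T" and x: "x \<in> S0" and c: "cl t x \<noteq> c"
  shows "good t (tp x (Suc n) \<circ> s) c \<longleftrightarrow> good t s c"
proof -
  have *: "rw (tp x (Suc n) \<circ> s) y = rw s y" if "y \<in> S0" "cl t y = c" for y
    using rw_tp_last(3) [OF s x that(1)] that(2) c by blast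
  have "occ t (tp x (Suc n) \<circ> s) i c \<longleftrightarrow> occ t s i c" for i
    unfolding occ_def using * by (intro bex_cong refl) auto
  moreover have "(\<forall>y\<in>S0. cl t y = c \<longrightarrow> rw (tp x (Suc n) \<circ> s) y < col_len c) \<longleftrightarrow>
      (\<forall>y\<in>S0. cl t y = c \<longrightarrow> rw s y < col_len c)"
    using * by (intro ball_cong refl) auto
  ultimately show ?thesis unfolding good_def by blast
qed

text \<open>Each transposition with the last entry repairs at most one column.\<close>

lemma jm_coeff_nonzero_bad:
  assumes t: "t \<in> T" "cl t (Suc n) = 0"
  shows "s \<in> T \<Longrightarrow> (jm_coeff j t s :: 'f::field) \<noteq> 0 \<Longrightarrow> card (bad t s) \<le> j"
proof (induction j arbitrary: s)
  case 0
  then have "transversal t s" using ecoeff_not_transversal [OF t(1)] unfolding jm_coeff_0 by blast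
  then have "bad t s = {}" using transversal_good [OF t(1) 0(1) t(2)] unfolding bad_def by blast
  then show ?case by simp
next
  case (Suc j)
  have "\<exists>x\<in>S0. (jm_coeff j t (tp x (Suc n) \<circ> s) :: 'f) \<noteq> 0"
  proof (rule ccontr)
    assume "\<not> ?thesis"
    then have "(\<Sum>x\<in>S0. jm_coeff j t (tp x (Suc n) \<circ> s) :: 'f) = 0" by (intro sum.neutral) blast
    then show False using Suc.prems(2) unfolding jm_coeff_Suc [OF Suc.prems(1)] by blast
  qed
  then obtain x where x: "x \<in> S0" "(jm_coeff j t (tp x (Suc n) \<circ> s) :: 'f) \<noteq> 0" by blast
  have "tp x (Suc n) \<circ> s \<in> T" by (rule tp_tableau [OF S0_S [OF x(1)] last_in_S Suc.prems(1)])
  then have le: "card (bad t (tp x (Suc n) \<circ> s)) \<le> j" using x(2) by (rule Suc.IH)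
  have "bad t s \<subseteq> insert (cl t x) (bad t (tp x (Suc n) \<circ> s))"
  proof
    fix c assume c: "c \<in> bad t s"
    show "c \<in> insert (cl t x) (bad t (tp x (Suc n) \<circ> s))"
    proof (cases "cl t x = c")
      case False
      then show ?thesis
        using good_tp_last [OF Suc.prems(1) x(1) False] c unfolding bad_def by blast
    qed simp
  qed
  then have "card (bad t s) \<le> card (insert (cl t x) (bad t (tp x (Suc n) \<circ> s)))"
    by (intro card_mono) simp_all
  also have "\<dots> \<le> Suc (card (bad t (tp x (Suc n) \<circ> s)))" by (rule card_insert_le_m1) simp_all
  finally show ?case using le by simp
qed

section \<open>Powers of the Jucys-Murphy element on prefixes and states\<close>

lemma card_corner_cols:
  assumes "k < ncorners"
  shows "card (ccol ` {1..k}) = k"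
proof -
  have "inj_on ccol {1..k}"
  proof (rule inj_onI)
    fix i j assume "i \<in> {1..k}" "j \<in> {1..k}" "ccol i = ccol j"
    then show "i = j" using assms ccol_inj [of i j] by simp
  qed
  then show ?thesis by (simp add: card_image)
qed

lemma corner_col_range:
  assumes "i \<in> {1..k}" "k < ncorners"
  shows "0 < ccol i \<and> ccol i < row_len 0"
proof
  show "0 < ccol i" using ccol_strict [of 0 i] assms by simp
  show "ccol i < row_len 0" using assms by (intro ccol_less) simp
qed

lemma not_good_extra:
  assumes "occ t s (crow (i - 1)) (ccol i)" "1 \<le> i" "i < ncorners"
  shows "\<not> good t s (ccol i)"
proof
  assume g: "good t s (ccol i)"
  obtain x where x: "x \<in> S0" "rw s x = crow (i - 1)" "cl t x = ccol i" using assms(1) by (rule occE)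
  then have "rw s x < col_len (ccol i)" using g unfolding good_def by blast
  then have "crow (i - 1) < col_len (ccol i)" unfolding x(2) .
  also have "\<dots> = Suc (crow i)" using ccol_step(3) [OF ccol_less [OF assms(3)]] .
  finally show False using crow_strict [of "i - 1" i] assms(2,3) by simp
qed

lemma not_good_hole:
  assumes "\<not> occ t s (crow i) (ccol i)" "i < ncorners"
  shows "\<not> good t s (ccol i)"
proof
  assume "good t s (ccol i)"
  moreover have "crow i < col_len (ccol i)" using ccol_step(3) [OF ccol_less [OF assms(2)]] by simp
  ultimately show False using assms(1) unfolding good_def by blast
qed

lemma prefix_extra: "prefix k t s \<Longrightarrow> i \<in> {1..k} \<Longrightarrow> occ t s (crow (i - 1)) (ccol i)"
proof -
  assume pre: "prefix k t s" and i: "i \<in> {1..k}"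
  then obtain j where j: "i = Suc j" by (cases i) auto
  then show ?thesis using pre i unfolding prefix_def by simp
qed

text \<open>The extra entries spoil the \<open>k\<close> columns \<open>ccol 1\<close> to
  \<open>ccol k\<close>, and fewer than \<open>k\<close> transpositions cannot repair them
  all.\<close>

lemma jm_coeff_zero:
  assumes "prefix k t s" "k < ncorners" "j < k"
  shows "(jm_coeff j t s :: 'f::field) = 0"
proof (rule ccontr)
  assume "(jm_coeff j t s :: 'f) \<noteq> 0"
  then have le: "card (bad t s) \<le> j" using jm_coeff_nonzero_bad prefix_tableaux [OF assms(1)] by blast
  have "ccol ` {1..k} \<subseteq> bad t s"
  proof
    fix c assume "c \<in> ccol ` {1..k}"
    then obtain i where i: "i \<in> {1..k}" "c = ccol i" by blast
    then have "\<not> good t s (ccol i)"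
      using not_good_extra [OF prefix_extra [OF assms(1) i(1)]] assms(2) by simp
    then show "c \<in> bad t s" using corner_col_range [OF i(1) assms(2)] i(2) by (simp add: bad_def)
  qed
  then have "card (ccol ` {1..k}) \<le> card (bad t s)" by (intro card_mono) simp_all
  then show False using card_corner_cols [OF assms(2)] le assms(3) by simp
qed

text \<open>Only the swap with the last extra entry survives, and it leads down to a
  \<open>k\<close>-state. After any other swap all \<open>Suc k\<close> spoiled columns are still
  spoiled, too many for the remaining \<open>k\<close> transpositions. The bound on the row of the
  last entry prevents a displaced extra entry from filling a hole of the prefix.\<close>

lemma jm_coeff_state:
  assumes "k < ncorners" "state k t s" "rw s (Suc n) \<le> crow k"
  shows "(jm_coeff k t s :: 'f::field) = 1 \<or> (jm_coeff k t s :: 'f) = - 1"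
  using assms
proof (induction k arbitrary: s)
  case 0
  have "t \<in> T" "s \<in> T" using 0 by (simp_all add: state_def prefix_def)
  then show ?case
    unfolding jm_coeff_0 using ecoeff_transversal state_0_transversal [OF 0(2)] by blast
next
  case (Suc k)
  have pre: "prefix (Suc k) t s" and sp: "sparse t s"
    using Suc.prems by (simp_all add: state_def)
  then have T: "t \<in> T" "s \<in> T" "cl t (Suc n) = 0" using prefix_tableaux by blast+
  obtain x where x: "x \<in> S0" "rw s x = crow k" "cl t x = ccol (Suc k)"
    using pre by (auto simp: prefix_def elim: occE)
  have zero: "(jm_coeff k t (tp y (Suc n) \<circ> s) :: 'f) = 0" if y: "y \<in> S0" "y \<noteq> x" for y
  proof (rule ccontr)
    let ?s = "tp y (Suc n) \<circ> s"
    assume nz: "(jm_coeff k t ?s :: 'f) \<noteq> 0"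
    have sT: "?s \<in> T" by (rule tp_tableau [OF S0_S [OF y(1)] last_in_S T(2)])
    note rws = rw_tp_last [OF T(2) y(1)]
    have le: "card (bad t ?s) \<le> k" using jm_coeff_nonzero_bad [OF T(1,3) sT nz] .
    have "ccol ` {1..Suc k} \<subseteq> bad t ?s"
    proof
      fix c assume "c \<in> ccol ` {1..Suc k}"
      then obtain i where i: "i \<in> {1..Suc k}" "c = ccol i" by blast
      then have im: "1 \<le> i" "i < ncorners" using Suc.prems(1) by auto
      obtain e where e: "e \<in> S0" "rw s e = crow (i - 1)" "cl t e = ccol i"
        using prefix_extra [OF pre i(1)] by (rule occE)
      have "\<not> good t ?s (ccol i)"
      proof (cases "e = y")
        case False
        then have "rw ?s e = crow (i - 1)" using rws(3) [OF e(1)] e(2) by simp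
        then have "occ t ?s (crow (i - 1)) (ccol i)" using e by (intro occI)
        then show ?thesis using im by (rule not_good_extra)
      next
        case True
        have "i \<noteq> Suc k"
        proof
          assume "i = Suc k"
          then have "e = x" using sparseD [OF sp e(1) x(1)] e x by simp
          then show False using True y(2) by simp
        qed
        then have ik: "i < Suc k" using i(1) by simp
        \<comment> \<open>The extra entry of this column is displaced, but the hole is still there:
          \<open>y\<close> lands in the old row of the last entry, which is above
          \<open>crow i\<close>.\<close>
        have "\<not> occ t ?s (crow i) (ccol i)"
        proof
          assume "occ t ?s (crow i) (ccol i)"
          then obtain w where w: "w \<in> S0" "rw ?s w = crow i" "cl t w = ccol i" by (rule occE)
          have "crow (Suc k) < crow i" by (rule crow_strict [OF ik Suc.prems(1)])
          then have "w \<noteq> y" using w(2) rws(2) Suc.prems(3) by auto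
          then have "occ t s (crow i) (ccol i)" using w rws(3) [OF w(1)] by (intro occI [OF w(1)]) simp_all
          then show False using pre ik unfolding prefix_def by blast
        qed
        then show ?thesis using im(2) by (rule not_good_hole)
      qed
      then show "c \<in> bad t ?s" using corner_col_range [OF i(1) Suc.prems(1)] i(2) by (simp add: bad_def)
    qed
    then have "card (ccol ` {1..Suc k}) \<le> card (bad t ?s)" by (intro card_mono) simp_all
    then show False using card_corner_cols [OF Suc.prems(1)] le by simp
  qed
  let ?s = "tp x (Suc n) \<circ> s"
  have "(jm_coeff (Suc k) t s :: 'f) = (\<Sum>y\<in>S0. jm_coeff k t (tp y (Suc n) \<circ> s))" by (rule jm_coeff_Suc [OF T(2)])
  also have "\<dots> = (\<Sum>y\<in>{x}. jm_coeff k t (tp y (Suc n) \<circ> s))"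
    using x(1) zero by (intro sum.mono_neutral_right) auto
  also have "\<dots> = jm_coeff k t ?s" by simp
  finally have eq: "(jm_coeff (Suc k) t s :: 'f) = jm_coeff k t ?s" .
  have "(jm_coeff k t ?s :: 'f) = 1 \<or> (jm_coeff k t ?s :: 'f) = - 1"
  proof (rule Suc.IH)
    show "k < ncorners" using Suc.prems(1) by simp
    show "state k t ?s" by (rule state_down [OF Suc.prems(2,1) x])
    show "rw ?s (Suc n) \<le> crow k" using rw_tp_last(1) [OF T(2) x(1)] x(2) by simp
  qed
  then show ?case unfolding eq .
qed

text \<open>\<open>state_down\<close> run backwards: in a \<open>k\<close>-state with the last entry
  in row \<open>crow k\<close>, it is exchanged with the entry at
  \<open>(\<rho>, ccol (Suc k))\<close>. That entry exists because the columns beyond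
  \<open>ccol k\<close> still agree with the diagram; goodness is carried along for this
  purpose.\<close>

lemma state_exists:
  assumes "k < ncorners" "\<rho> \<le> crow k"
  shows "\<exists>t s. state k t s \<and> rw s (Suc n) = \<rho> \<and> (\<forall>c>ccol k. good t s c)"
  using assms
proof (induction k arbitrary: \<rho>)
  case 0
  obtain t0 where t0: "t0 \<in> T" using tableaux_nonempty by blast
  have "\<rho> < col_len 0" using ccol_step(3) [OF ccol_less [OF 0(1)]] 0(2) by simp
  then have D: "(\<rho>, 0) \<in> D" unfolding in_D_iff_col .
  define x where "x = t0 (\<rho>, 0)"
  have xS: "x \<in> S" using tableau_bij [OF t0] D bij_betwE unfolding x_def by blast
  have "cell t0 x = (\<rho>, 0)" unfolding x_def by (rule cell_tab [OF t0 D])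
  then have x: "rw t0 x = \<rho>" "cl t0 x = 0" by (simp_all add: rw_def cl_def)
  let ?t = "tp x (Suc n) \<circ> t0"
  have tT: "?t \<in> T" by (rule tp_tableau [OF xS last_in_S t0])
  have N: "rw ?t (Suc n) = \<rho>" "cl ?t (Suc n) = 0"
    using rw_tp [OF xS last_in_S t0 last_in_S] cl_tp [OF xS last_in_S t0 last_in_S] x by simp_all
  have tr: "transversal ?t ?t"
    using bij_betw_imp_inj_on [OF cell_bij [OF tT]] unfolding transversal_def inj_on_def cell_eq .
  have "sparse ?t ?t" unfolding sparse_def
    by (rule inj_on_subset [OF tr [unfolded transversal_def]]) (simp add: S0_def)
  moreover have "\<not> occ ?t ?t (rw ?t (Suc n)) 0"
  proof
    assume "occ ?t ?t (rw ?t (Suc n)) 0"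
    then obtain y where y: "y \<in> S0" "rw ?t y = rw ?t (Suc n)" "cl ?t y = 0" by (rule occE)
    then have "y = Suc n"
      using tr S0_S [OF y(1)] last_in_S N(2) unfolding transversal_def inj_on_def by simp
    then show False using y(1) by (simp add: S0_iff)
  qed
  ultimately have "state 0 ?t ?t" using tT N(2) by (simp add: state_def prefix_def)
  moreover have "\<forall>c>ccol 0. good ?t ?t c" using transversal_good [OF tT tT N(2) tr] by simp
  ultimately show ?case using N(1) by blast
next
  case (Suc k)
  obtain t s where st: "state k t s" "rw s (Suc n) = crow k" "\<forall>c>ccol k. good t s c"
    using Suc.IH [of "crow k"] Suc.prems(1) by auto
  have T: "t \<in> T" "s \<in> T" "cl t (Suc n) = 0" and pre: "prefix k t s" and sp: "sparse t s"
    and hole: "\<not> occ t s (crow k) (ccol k)"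
    using st(1,2) by (auto simp: state_def prefix_def)
  have Ck: "ccol k < ccol (Suc k)" using ccol_strict [of k "Suc k"] Suc.prems(1) by simp
  then have g: "good t s (ccol (Suc k))" using st(3) by blast
  have len: "col_len (ccol (Suc k)) = Suc (crow (Suc k))"
    using ccol_step(3) [OF ccol_less [OF Suc.prems(1)]] .
  then have "\<rho> < col_len (ccol (Suc k))" using Suc.prems(2) by simp
  then have "occ t s \<rho> (ccol (Suc k))" using g unfolding good_def by blast
  then obtain x where x: "x \<in> S0" "rw s x = \<rho>" "cl t x = ccol (Suc k)" by (rule occE)
  let ?s = "tp x (Suc n) \<circ> s"
  have sT: "?s \<in> T" by (rule tp_tableau [OF S0_S [OF x(1)] last_in_S T(2)])
  note rws = rw_tp_last [OF T(2) x(1)]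
  have R: "crow (Suc k) < crow k" using crow_strict [of k "Suc k"] Suc.prems(1) by simp
  have occ: "occ t ?s i c \<longleftrightarrow> occ t s i c" if "c \<noteq> ccol (Suc k)" for i c
    unfolding occ_def
  proof (intro bex_cong refl)
    fix y assume "y \<in> S0"
    then show "rw ?s y = i \<and> cl t y = c \<longleftrightarrow> rw s y = i \<and> cl t y = c"
      using rws(3) [of y] x(3) that by (cases "y = x") auto
  qed
  have pre': "\<And>j. j < k \<Longrightarrow> \<not> occ t s (crow j) (ccol j)" "\<And>j. j < k \<Longrightarrow> occ t s (crow j) (ccol (Suc j))"
    using pre by (simp_all add: prefix_def)
  have ne: "ccol j \<noteq> ccol (Suc k)" if "j \<le> k" for j
    using ccol_strict [of j "Suc k"] that Suc.prems(1) by simp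
  have xR: "rw ?s x = crow k" using rws(2) st(2) by simp
  have "\<not> occ t ?s (crow j) (ccol j) \<and> occ t ?s (crow j) (ccol (Suc j))" if j: "j < Suc k" for j
  proof (cases "j = k")
    case True
    then show ?thesis using occ [OF ne [of k]] hole occI [OF x(1) xR x(3)] by simp
  next
    case False
    then show ?thesis using occ [OF ne [of j]] occ [OF ne [of "Suc j"]] pre' [of j] j by simp
  qed
  then have pre1: "prefix (Suc k) t ?s" using T sT unfolding prefix_def by blast
  have "\<not> occ t s (crow k) (ccol (Suc k))"
  proof
    assume "occ t s (crow k) (ccol (Suc k))"
    then have "crow k < Suc (crow (Suc k))" using g len unfolding good_def occ_def by auto
    then show False using R by simp
  qed
  then have sp1: "sparse t ?s" using st(2) x(3) by (intro sparse_tp_last T(2) sp x(1)) simp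
  have rN: "rw ?s (Suc n) = \<rho>" using rws(1) x(2) by simp
  have hole1: "\<not> occ t ?s (rw ?s (Suc n)) (ccol (Suc k))"
  proof
    assume "occ t ?s (rw ?s (Suc n)) (ccol (Suc k))"
    then obtain y where y: "y \<in> S0" "rw ?s y = \<rho>" "cl t y = ccol (Suc k)"
      unfolding rN by (rule occE)
    show False
    proof (cases "y = x")
      case True
      then show False using y(2) xR R Suc.prems(2) by simp
    next
      case False
      then have "rw s y = rw s x" using rws(3) [OF y(1)] y(2) x(2) by simp
      then show False using sparseD [OF sp y(1) x(1)] y(3) x(3) False by simp
    qed
  qed
  have "good t ?s c" if c: "c > ccol (Suc k)" for c
    using good_tp_last [OF T(2) x(1), of t c] st(3) c Ck x(3) by simp
  then show ?case using pre1 sp1 hole1 rN unfolding state_def by blast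
qed

section \<open>Removable nodes\<close>

text \<open>Diagrams are closed under going up and left, so neither the node below nor the node to
  the right of a removable one can be in \<open>D\<close>.\<close>

lemma removable_row_col:
  assumes "(i, j) \<in> removable_nodes lam"
  shows "row_len i = Suc j" "col_len j = Suc i"
proof -
  obtain m mu where ij: "(i, j) \<in> D" and mu: "partition_of m mu" "young_diagram mu = D - {(i, j)}"
    using assms by (auto simp: removable_nodes_def)
  have down: "(i, j) \<in> young_diagram mu"
    if "(i', j') \<in> young_diagram mu" "i \<le> i'" "j \<le> j'" for i' j'
  proof -
    have *: "i' < length mu" "j' < mu ! i'" using that(1) by (simp_all add: young_diagram_def)
    moreover have "mu ! i' \<le> mu ! i"
      using mu(1) * that(2) unfolding partition_of_def sorted_wrt_iff_nth_less
      by (cases "i = i'") auto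
    ultimately show ?thesis using that(2,3) by (simp add: young_diagram_def)
  qed
  have "(Suc i, j) \<notin> D"
  proof
    assume "(Suc i, j) \<in> D"
    then have "(i, j) \<in> young_diagram mu" using mu(2) by (intro down [of "Suc i" j]) simp_all
    then show False using mu(2) by simp
  qed
  moreover have "(i, Suc j) \<notin> D"
  proof
    assume "(i, Suc j) \<in> D"
    then have "(i, j) \<in> young_diagram mu" using mu(2) by (intro down [of i "Suc j"]) simp_all
    then show False using mu(2) by simp
  qed
  ultimately show "row_len i = Suc j" "col_len j = Suc i"
    using ij in_D_iff [of i j] in_D_iff_col [of i j] in_D_iff [of i "Suc j"] in_D_iff_col [of "Suc i" j]
    by simp_all
qed

lemma removable_nodeI:
  assumes r: "row_len i = Suc j" and c: "col_len j = Suc i"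
  shows "(i, j) \<in> removable_nodes lam"
proof -
  have ij: "(i, j) \<in> D" using r by (simp add: in_D_iff)
  have il: "i < length lam" "lam ! i = Suc j" using r by (auto simp: row_len_def split: if_splits)
  have below: "lam ! b \<le> j" if "i < b" "b < length lam" for b
  proof -
    have "\<not> b < col_len j" using c that(1) by simp
    then show ?thesis using that(2) unfolding less_row_len_iff [symmetric] by (simp add: row_len_def)
  qed
  have sorted: "lam ! b \<le> lam ! a" if "a < b" "b < length lam" for a b
    using partition that unfolding partition_of_def sorted_wrt_iff_nth_less by simp
  have pos: "0 \<notin> set lam" using partition by (simp add: partition_of_def)
  have "\<exists>mu. sorted_wrt (\<ge>) mu \<and> 0 \<notin> set mu \<and> young_diagram mu = D - {(i, j)}"
  proof (cases "j = 0")
    case True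
    \<comment> \<open>A row of length one must disappear from the list, as partitions have no zero
      parts; the rows below it would be empty, so it is the last.\<close>
    have "length lam = Suc i"
    proof (rule ccontr)
      assume "length lam \<noteq> Suc i"
      then have "Suc i < length lam" using il(1) by simp
      then have "lam ! Suc i = 0" using below [of "Suc i"] True by simp
      then show False using pos \<open>Suc i < length lam\<close> nth_mem by metis
    qed
    moreover have "sorted_wrt (\<ge>) (take i lam)"
      using partition unfolding partition_of_def by (intro sorted_wrt_take) blast
    moreover have "0 \<notin> set (take i lam)" using pos in_set_takeD by metis
    ultimately have "sorted_wrt (\<ge>) (take i lam) \<and> 0 \<notin> set (take i lam) \<and>
        young_diagram (take i lam) = D - {(i, j)}"
      using il(2) True by (auto simp: young_diagram_def less_Suc_eq)
    then show ?thesis by blast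
  next
    case False
    let ?mu = "lam[i := j]"
    have "sorted_wrt (\<ge>) ?mu"
      unfolding sorted_wrt_iff_nth_less
    proof (intro allI impI)
      fix a b assume ab: "a < b" "b < length ?mu"
      then have "lam ! b \<le> lam ! a" using sorted by simp
      then show "?mu ! b \<le> ?mu ! a"
        using ab below [of b] il by (cases "a = i"; cases "b = i") auto
    qed
    moreover have "0 \<notin> set ?mu" using pos False set_update_subset_insert [of lam i j] by auto
    moreover have "young_diagram ?mu = D - {(i, j)}"
      using il by (auto simp: young_diagram_def nth_list_update split: if_splits)
    ultimately show ?thesis by blast
  qed
  then show ?thesis using ij by (auto simp: removable_nodes_def partition_of_def)
qed

lemma removable_nodes_eq: "removable_nodes lam = (\<lambda>k. (crow k, ccol (Suc k) - 1)) ` {..<ncorners}"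
proof
  show "removable_nodes lam \<subseteq> (\<lambda>k. (crow k, ccol (Suc k) - 1)) ` {..<ncorners}"
  proof
    fix x assume "x \<in> removable_nodes lam"
    moreover obtain i j where x: "x = (i, j)" by fastforce
    ultimately have rc: "row_len i = Suc j" "col_len j = Suc i" using removable_row_col by blast+
    have "j < row_len 0" using row_len_mono [of 0 i] rc(1) by simp
    then obtain k where k: "k < ncorners" "ccol k \<le> j" "j < ccol (Suc k)" by (rule block_exists)
    have "i = crow k" using col_len_block [OF k] rc(2) by simp
    moreover have "ccol (Suc k) - 1 = j" unfolding ccol_Suc using rc(1) \<open>i = crow k\<close> by simp
    ultimately show "x \<in> (\<lambda>k. (crow k, ccol (Suc k) - 1)) ` {..<ncorners}" using k(1) x by blast
  qed
  show "(\<lambda>k. (crow k, ccol (Suc k) - 1)) ` {..<ncorners} \<subseteq> removable_nodes lam"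
  proof
    fix x assume "x \<in> (\<lambda>k. (crow k, ccol (Suc k) - 1)) ` {..<ncorners}"
    then obtain k where k: "k < ncorners" and x: "x = (crow k, ccol (Suc k) - 1)" by blast
    have lt: "ccol k < ccol (Suc k)" using ccol_step(1) [OF ccol_less [OF k]] .
    then have "ccol (Suc k) = Suc (ccol (Suc k) - 1)" by simp
    then have "row_len (crow k) = Suc (ccol (Suc k) - 1)" unfolding ccol_Suc .
    moreover have "col_len (ccol (Suc k) - 1) = Suc (crow k)" using lt by (intro col_len_block [OF k]) simp_all
    ultimately show "x \<in> removable_nodes lam" unfolding x by (rule removable_nodeI)
  qed
qed

section \<open>Residues of the removable nodes and the minimal polynomial\<close>

lemma p_residue_corner: "k < ncorners \<Longrightarrow> (p_residue (crow k, ccol (Suc k) - 1) :: 'f::field) = corner_res k"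
  using ccol_step(1) [OF ccol_less, of k] by (simp add: p_residue_def corner_res_def of_nat_diff)

lemma inj_on_corners: "inj_on (\<lambda>k. (crow k, ccol (Suc k) - 1)) {..<ncorners}"
proof (rule inj_onI)
  fix j k assume *: "j \<in> {..<ncorners}" "k \<in> {..<ncorners}" "(crow j, ccol (Suc j) - 1) = (crow k, ccol (Suc k) - 1)"
  then show "j = k" using crow_strict [of j k] crow_strict [of k j] by (cases j k rule: linorder_cases) auto
qed

lemma card_residue:
  "card {x \<in> removable_nodes lam. p_residue x = (r :: 'f::field)} = card {k \<in> {..<ncorners}. corner_res k = r}"
proof -
  have "{x \<in> removable_nodes lam. p_residue x = r} =
      (\<lambda>k. (crow k, ccol (Suc k) - 1)) ` {k \<in> {..<ncorners}. corner_res k = r}"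
    unfolding removable_nodes_eq using p_residue_corner [where 'f = 'f] by auto
  moreover have "inj_on (\<lambda>k. (crow k, ccol (Suc k) - 1)) {k \<in> {..<ncorners}. corner_res k = r}"
    using inj_on_corners by (rule inj_on_subset) blast
  ultimately show ?thesis by (simp only: card_image)
qed

lemma residues_eq: "p_residue ` removable_nodes lam = (corner_res ` {..<ncorners} :: 'f::field set)"
  unfolding removable_nodes_eq image_image using p_residue_corner by (intro image_cong) simp_all

lemma min_poly_by_residues:
  "(\<Prod>r\<in>p_residue ` removable_nodes lam.
      [:- r, 1:] ^ card {x \<in> removable_nodes lam. p_residue x = r}) = (\<Prod>k\<in>{..<ncorners}. [:- (corner_res k :: 'f::field), 1:])"
proof -
  have "(\<Prod>k\<in>{..<ncorners}. [:- (corner_res k :: 'f), 1:]) =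
      (\<Prod>r\<in>(corner_res ` {..<ncorners} :: 'f set). \<Prod>k\<in>{k \<in> {..<ncorners}. corner_res k = r}. [:- (corner_res k :: 'f), 1:])"
    by (rule prod.group [symmetric]) simp_all
  also have "\<dots> = (\<Prod>r\<in>(corner_res ` {..<ncorners} :: 'f set). [:- r, 1:] ^ card {k \<in> {..<ncorners}. corner_res k = r})"
    by (intro prod.cong refl) simp
  finally show ?thesis unfolding residues_eq card_residue by (rule sym)
qed

section \<open>Generation by the Jucys-Murphy element\<close>

lemma jm_endo_add: "jm_endo (p + q) = jm_endo p + jm_endo q"
  by (rule ext) (simp add: jm_endo_def jm_eval_add)

lemma jm_endo_smult: "jm_endo (Polynomial.smult c p) = op_scale c (jm_endo p)"
  by (rule ext) (simp add: jm_endo_def jm_eval_smult op_scale_def)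

lemma jm_endo_mult: "jm_endo (p * q) = jm_endo p \<circ> jm_endo q"
proof
  fix v :: "'a tabvec"
  have 0: "jm_endo p 0 = 0" by (rule endo_zero [OF endo_jm_endo])
  show "jm_endo (p * q) v = (jm_endo p \<circ> jm_endo q) v"
  proof (cases "v \<in> specht lam")
    case True
    then show ?thesis by (simp add: jm_endo_def jm_eval_mult jm_eval_in)
  next
    case False
    then have "jm_endo (p * q) v = 0" "jm_endo q v = 0" by (simp_all add: jm_endo_def)
    then show ?thesis using 0 by (simp only: o_apply)
  qed
qed

lemma jm_endo_one: "jm_endo 1 = (\<lambda>v. if v \<in> specht lam then v else 0)"
  by (rule ext) (simp add: jm_endo_def jm_eval_1)

lemma jm_endo_zero: "jm_endo 0 = 0"
  by (rule ext) (simp add: jm_endo_def jm_eval_0)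

lemma fcoeff_add: "fcoeff (f + g) t s = fcoeff f t s + fcoeff g t s"
  by (simp add: fcoeff_def)

lemma fcoeff_jm_endo_monom:
  assumes "t \<in> T"
  shows "fcoeff (jm_endo (monom (c :: 'f::field) j)) t s = c * jm_coeff j t s"
proof -
  have "polytabloid lam t \<in> (specht lam :: 'f tabvec set)" using assms by (rule polytabloid_in_specht)
  then show ?thesis by (simp add: fcoeff_def jm_endo_def jm_eval_X_power jm_coeff_def vscale_def)
qed

lemma fcoeff_jm_endo:
  assumes "t \<in> T"
  shows "fcoeff (jm_endo p) t s = (\<Sum>j\<le>degree p. coeff p j * jm_coeff j t s)"
proof -
  have "fcoeff (jm_endo (\<Sum>j\<in>J. monom (coeff p j) j)) t s = (\<Sum>j\<in>J. coeff p j * jm_coeff j t s)"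
    if "finite J" for J
    using that
  proof (induction J rule: finite_induct)
    case empty
    then show ?case by (simp add: jm_endo_zero fcoeff_def)
  next
    case (insert j J)
    show ?case
      unfolding sum.insert [OF insert.hyps] jm_endo_add fcoeff_add fcoeff_jm_endo_monom [OF assms] insert.IH ..
  qed
  from this [of "{..degree p}"] show ?thesis by (simp add: poly_as_sum_of_monoms)
qed

lemma endo_plus: 
  assumes f: "endo f" and g: "endo g"
  shows "endo (f + g)"
  unfolding endo_iff
proof (intro conjI ballI allI impI)
  fix v :: "'a tabvec" assume v: "v \<in> specht lam"
  show "(f + g) v \<in> specht lam"
    unfolding plus_fun_apply [of f g]
    by (rule tabvec.subspace_add [OF specht_subspace endo_in [OF f v] endo_in [OF g v]])
  fix w :: "'a tabvec" assume w: "w \<in> specht lam"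
  show "(f + g) (v + w) = (f + g) v + (f + g) w"
    unfolding plus_fun_apply [of f g] endo_add [OF f v w] endo_add [OF g v w] by (simp only: ac_simps)
next
  fix v :: "'a tabvec" assume v: "v \<notin> specht lam"
  show "(f + g) v = 0"
    unfolding plus_fun_apply [of f g] endo_off [OF f v] endo_off [OF g v] by (rule add_0_left)
next
  fix v :: "'a tabvec" and c assume v: "v \<in> specht lam"
  show "(f + g) (vscale c v) = vscale c ((f + g) v)"
    unfolding plus_fun_apply [of f g] endo_scale [OF f v] endo_scale [OF g v]
    by (rule tabvec.scale_right_distrib [symmetric])
next
  fix v :: "'a tabvec" and \<pi> assume v: "v \<in> specht lam" and "\<pi> \<in> Sym n"
  then have \<pi>: "\<pi> permutes S" "\<pi> (Suc n) = Suc n" unfolding Sym_iff by blast+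
  show "(f + g) (perm_act \<pi> v) = perm_act \<pi> ((f + g) v)"
    unfolding plus_fun_apply [of f g] endo_perm [OF f \<pi> v] endo_perm [OF g \<pi> v]
    by (rule perm_act_add [symmetric])
qed

text \<open>Triangular elimination from the last corner down. A multiple of the power
  \<open>k0\<close> of \<open>jm\<close> is added to kill the coefficient at one
  \<open>k0\<close>-state, hence at all of them by \<open>state_match\<close>; the states of larger
  index, already settled, are not affected by this power.\<close>

lemma endo_is_polynomial:
  assumes char: "CHAR('f::field) \<noteq> 2" and f: "endo (f :: 'f tabvec \<Rightarrow> 'f tabvec)"
  shows "\<exists>p. f = jm_endo p"
proof -
  have step: "\<exists>p. \<forall>k t s. ncorners - d \<le> k \<and> k < ncorners \<and> state k t s \<and> rw s (Suc n) = 0 \<longrightarrow>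
      fcoeff (f + jm_endo p) t s = 0" if "d \<le> ncorners" for d
    using that
  proof (induction d)
    case 0
    show ?case by (intro exI allI impI) auto
  next
    case (Suc d)
    obtain p where p: "\<forall>k t s. ncorners - d \<le> k \<and> k < ncorners \<and> state k t s \<and> rw s (Suc n) = 0 \<longrightarrow>
        fcoeff (f + jm_endo p) t s = 0" using Suc.IH [OF Suc_leD [OF Suc.prems]] by blast
    define k0 where "k0 = ncorners - Suc d"
    have k0: "k0 < ncorners" "ncorners - d = Suc k0" using Suc.prems by (simp_all add: k0_def)
    obtain t0 s0 where st0: "state k0 t0 s0" "rw s0 (Suc n) = 0"
      using state_exists [OF k0(1), of 0] by auto
    have T0: "t0 \<in> T" "s0 \<in> T" using st0(1) by (simp_all add: state_def prefix_def)
    have psi0: "(jm_coeff k0 t0 s0 :: 'f) \<noteq> 0" using jm_coeff_state [OF k0(1) st0(1), where 'f = 'f] st0(2) by auto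
    define c where "c = - fcoeff (f + jm_endo p) t0 s0 / jm_coeff k0 t0 s0"
    define g where "g = f + jm_endo (p + monom c k0)"
    have g: "endo g" unfolding g_def by (rule endo_plus [OF f endo_jm_endo])
    have g_eq: "fcoeff g t s = fcoeff (f + jm_endo p) t s + c * jm_coeff k0 t s" if "t \<in> T" for t s
      unfolding g_def jm_endo_add add.assoc [symmetric] fcoeff_add fcoeff_jm_endo_monom [OF that] ..
    have "fcoeff g t s = 0" if k: "k0 \<le> k" "k < ncorners" and st: "state k t s" "rw s (Suc n) = 0" for k t s
    proof -
      have T: "t \<in> T" "s \<in> T" and pre: "prefix k t s" using st(1) by (simp_all add: state_def prefix_def)
      show ?thesis
      proof (cases "k = k0")
        case True
        have "fcoeff g t0 s0 = 0" unfolding g_eq [OF T0(1)] using psi0 by (simp add: c_def)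
        moreover obtain \<pi> where "\<pi> permutes S" "\<pi> (Suc n) = Suc n"
          "\<forall>x\<in>S. rw s (\<pi> x) = rw s0 x \<and> cl t (\<pi> x) = cl t0 x"
          using state_match [OF k0(1) st0(1) st(1) [unfolded True]] st0(2) st(2) by auto
        ultimately show ?thesis using fcoeff_match [OF g _ _ T0 T] by blast
      next
        case False
        then have "k0 < k" using k(1) by simp
        then have "(jm_coeff k0 t s :: 'f) = 0" by (rule jm_coeff_zero [OF pre k(2)])
        moreover have "ncorners - d \<le> k" using False k(1) k0(2) by simp
        then have "fcoeff (f + jm_endo p) t s = 0" using p k(2) st by blast
        ultimately show ?thesis unfolding g_eq [OF T(1)] by simp
      qed
    qed
    then show ?case unfolding g_def k0_def by blast
  qed
  obtain p where p: "\<forall>k t s. ncorners - ncorners \<le> k \<and> k < ncorners \<and> state k t s \<and> rw s (Suc n) = 0 \<longrightarrow>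
      fcoeff (f + jm_endo p) t s = 0" using step [OF order_refl] by blast
  have "f + jm_endo p = 0"
    by (rule endo_eq_zeroI [OF char endo_plus [OF f endo_jm_endo]]) (use p in simp)
  moreover have "jm_endo (- p) + jm_endo p = 0" by (simp only: jm_endo_add [symmetric] add.left_inverse jm_endo_zero)
  ultimately have "f + jm_endo p = jm_endo (- p) + jm_endo p" by (rule trans [OF _ sym])
  then have "f = jm_endo (- p)" by (rule add_right_imp_eq)
  then show ?thesis by blast
qed

text \<open>A nonzero remainder modulo the product cannot act as zero: at a state whose index is its
  degree, the lower powers of \<open>jm\<close> have coefficient 0 and the top one has a
  sign.\<close>

lemma jm_endo_eq_zero_iff:
  "jm_endo p = 0 \<longleftrightarrow> (\<Prod>k\<in>{..<ncorners}. [:- (corner_res k :: 'f::field), 1:]) dvd p"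
proof -
  let ?\<chi> = "\<Prod>k\<in>{..<ncorners}. [:- (corner_res k :: 'f), 1:]"
  have mult_zero: "jm_endo (q * ?\<chi>) = 0" for q
  proof
    fix v :: "'f tabvec"
    have 0: "jm_endo q 0 = 0" by (rule endo_zero [OF endo_jm_endo])
    have "jm_endo ?\<chi> v = 0" using jm_eval_min_poly [of v] by (simp add: jm_endo_def)
    then have "jm_endo q (jm_endo ?\<chi> v) = jm_endo q 0" by (rule arg_cong)
    then show "jm_endo (q * ?\<chi>) v = 0 v" unfolding jm_endo_mult o_apply zero_fun_apply 0 .
  qed
  show ?thesis
  proof
    assume "?\<chi> dvd p"
    then obtain q where "p = ?\<chi> * q" by (rule dvdE)
    then show "jm_endo p = 0" using mult_zero [of q] by (simp only: mult.commute)
  next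
    assume hp: "jm_endo p = 0"
    have deg: "degree ?\<chi> = ncorners" by (subst degree_prod_eq_sum_degree) simp_all
    have "?\<chi> \<noteq> 0" by simp
    define r where "r = p mod ?\<chi>"
    have "jm_endo r = 0"
    proof -
      have "p = (p div ?\<chi>) * ?\<chi> + r" unfolding r_def by (rule div_mult_mod_eq [symmetric])
      then have "jm_endo p = jm_endo ((p div ?\<chi>) * ?\<chi>) + jm_endo r" using jm_endo_add by metis
      then show ?thesis unfolding hp mult_zero add_0_left by (rule sym)
    qed
    have "r = 0"
    proof (rule ccontr)
      assume "r \<noteq> 0"
      then have d: "degree r < ncorners" using degree_mod_less [OF \<open>?\<chi> \<noteq> 0\<close>, of p] deg unfolding r_def by simp
      obtain t s where st: "state (degree r) t s" "rw s (Suc n) = 0"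
        using state_exists [OF d, of 0] by auto
      have T: "t \<in> T" and pre: "prefix (degree r) t s" using st(1) by (simp_all add: state_def prefix_def)
      have "(\<Sum>j\<le>degree r. coeff r j * jm_coeff j t s) = (\<Sum>j\<in>{degree r}. coeff r j * jm_coeff j t s)"
      proof (intro sum.mono_neutral_right ballI)
        fix j assume "j \<in> {..degree r} - {degree r}"
        then have "(jm_coeff j t s :: 'f) = 0" by (intro jm_coeff_zero [OF pre d]) auto
        then show "coeff r j * jm_coeff j t s = 0" by simp
      qed auto
      then have "fcoeff (jm_endo r) t s = lead_coeff r * jm_coeff (degree r) t s" unfolding fcoeff_jm_endo [OF T] by simp
      moreover have "fcoeff (jm_endo r) t s = 0" unfolding \<open>jm_endo r = 0\<close> by (simp add: fcoeff_def)
      moreover have "(jm_coeff (degree r) t s :: 'f) \<noteq> 0"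
        using jm_coeff_state [OF d st(1), where 'f = 'f] st(2) by auto
      ultimately show False using \<open>r \<noteq> 0\<close> by simp
    qed
    then show "?\<chi> dvd p" unfolding r_def by (simp only: mod_eq_0_iff_dvd)
  qed
qed

end

text \<open>The ring axioms are inherited from polynomials along a surjection, so none has to be
  checked on endomorphisms.\<close>

lemma ring_of_poly_image:
  fixes A (structure) and h :: "'f::field poly \<Rightarrow> 'a"
  assumes range: "range h = carrier A" and zero: "h 0 = \<zero>" and one: "h 1 = \<one>"
    and add: "\<And>p q. h (p + q) = h p \<oplus> h q" and mult: "\<And>p q. h (p * q) = h p \<otimes> h q"
  shows "ring A"
proof (rule ringI)
  have rep: "\<exists>p. x = h p" if "x \<in> carrier A" for x using that range by blast
  have cl: "h p \<in> carrier A" for p using range by blast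
  show "abelian_group A"
  proof (rule abelian_groupI)
    fix x assume "x \<in> carrier A"
    then obtain p where "x = h p" using rep by blast
    then have "h (- p) \<oplus> x = \<zero>" by (simp flip: add zero)
    then show "\<exists>y\<in>carrier A. y \<oplus> x = \<zero>" using cl by blast
  qed (use rep cl in \<open>auto dest!: rep simp flip: add zero simp: ac_simps\<close>)
  show "monoid A"
    by (rule monoidI) (use cl in \<open>auto dest!: rep simp flip: mult one simp: ac_simps\<close>)
qed (auto dest!: equalityD2 [OF range, THEN subsetD] simp flip: add mult simp: algebra_simps)

theorem theorem1p3:
  fixes lam :: "nat list" and n :: nat
    and A :: "('f::field, 'f tabvec \<Rightarrow> 'f tabvec) module"
    and R :: "'f set"
    and m :: "'f \<Rightarrow> nat"
  assumes "CHAR('f) \<noteq> 2"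
    and "partition_of (n + 1) lam"
  defines "A \<equiv> End_alg (Sym n) (specht lam)"
    and "R \<equiv> p_residue ` removable_nodes lam"
    and "m \<equiv> \<lambda>r. card {x \<in> removable_nodes lam. p_residue x = r}"
  shows "\<exists>E :: 'f \<Rightarrow> ('f tabvec \<Rightarrow> 'f tabvec) set.
           bij_betw E R (blocks A) \<and>
           (\<lambda>x. \<Oplus>\<^bsub>A\<^esub>r\<in>R. x r) \<in> alg_iso (prod_alg R (\<lambda>r. block_alg A (E r))) A \<and>
           (\<forall>r\<in>R. tabop.dim (E r) = m r \<and>
                  alg_isomorphic (block_alg A (E r)) (truncated_poly_alg (m r)))"
proof -
  interpret specht_shape lam n by unfold_locales (use assms(2) in simp)
  define h where "h = (jm_endo :: 'f poly \<Rightarrow> 'f tabvec \<Rightarrow> 'f tabvec)"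
  have range: "range h = carrier A"
  proof
    show "range h \<subseteq> carrier A" unfolding h_def A_def using endo_jm_endo unfolding endo_def by blast
    show "carrier A \<subseteq> range h"
    proof
      fix f assume "f \<in> carrier A"
      then have "endo f" unfolding A_def endo_def .
      then show "f \<in> range h" unfolding h_def using endo_is_polynomial [OF assms(1)] by blast
    qed
  qed
  have add: "h (p + q) = h p \<oplus>\<^bsub>A\<^esub> h q" for p q
    unfolding h_def jm_endo_add by (simp add: A_def End_alg_def)
  have mult: "h (p * q) = h p \<otimes>\<^bsub>A\<^esub> h q" for p q
    unfolding h_def jm_endo_mult by (simp add: A_def End_alg_def)
  have one: "h 1 = \<one>\<^bsub>A\<^esub>" unfolding h_def jm_endo_one by (simp add: A_def End_alg_def)
  have zeroA: "\<zero>\<^bsub>A\<^esub> = 0" by (simp add: A_def End_alg_def)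
  have zero: "h 0 = \<zero>\<^bsub>A\<^esub>" unfolding h_def jm_endo_zero zeroA ..
  have sc: "c \<odot>\<^bsub>A\<^esub> a = op_scale c a" for c a by (simp add: A_def End_alg_def)
  have addA: "a \<oplus>\<^bsub>A\<^esub> b = a + b" for a b by (simp add: A_def End_alg_def)
  have fin: "finite (removable_nodes lam)" unfolding removable_nodes_eq by simp
  have A: "poly_image A h R m"
  proof (intro poly_image.intro poly_image_axioms.intro)
    show "ring A" using range zero one add mult by (rule ring_of_poly_image)
    show "h (Polynomial.smult c p) = c \<odot>\<^bsub>A\<^esub> h p" for c p unfolding sc h_def by (rule jm_endo_smult)
    show "h p = \<zero>\<^bsub>A\<^esub> \<longleftrightarrow> (\<Prod>r\<in>R. [:- r, 1:] ^ m r) dvd p" for p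
      unfolding zeroA h_def R_def m_def min_poly_by_residues by (rule jm_endo_eq_zero_iff)
    show "finite R" using fin by (simp add: R_def)
    show "m r > 0" if "r \<in> R" for r
      using that fin by (auto simp: R_def m_def card_gt_0_iff)
  qed (rule range add mult one)+
  interpret poly_image A h R m by (rule A)
  have "\<forall>r\<in>R. tabop.dim (blk r) = m r"
    using dim_blk [OF A tabop.vector_space_axioms sc addA zeroA] by blast
  then show ?thesis
    using bij_betw_blk sum_iso_prod_alg block_alg_isomorphic_truncated by blast
qed

end
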